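(* Let $L$ be a simple pseudoline arrangement with no contact point, $\chi$ a cut of $L$, and $k$ a positive integer. Then $V(\Gamma_\chi^k(L))=\mathbb G_\chi^k(L)$.
   Context: Pseudoline arrangements in the Möbius strip $\mathcal M=\mathbb R^2/\tau$, $\tau(x,y)=(x+\pi,-y)$: finite sets of pseudolines (projections of graphs of continuous $\pi$-antiperiodic functions) any two with exactly one crossing point and possibly contact points (touching points); simple. Levels: first level = boundary of the external face of the complement of the support; $j$th level inductively. $k$-kernel $\mathcal S^k$: support minus first $k$ levels; $V^k$: contact points of $L$ in $\mathcal S^k$. A $k$-pseudotriangulation of $L$ is an arrangement with support $\mathcal S^k$ and contact set containing $V^k$. For a $k$-pseudotriangulation $\Lambda$ of $L$, $V(\Lambda)$ is the set of intersection points of $L$ that are not crossing points of $\Lambda$. Cut: with $\bar{\mathcal S}=\pi^{-1}(\text{support})$ oriented by increasing abscissa and path order $\preceq$, a filter $F$ (nonempty proper upward-closed set of vertices) defines a cut $\chi$; for vertices $v,w$, $v\preceq_\chi w$ iff their unique preimages in $F\setminus\tau(F)$ satisfy $\bar v\preceq\bar w$. A flip (replace a contact point $v$ of two pseudolines by their crossing point $w$) is $\chi$-increasing if $v\prec_\chi w$. The $\chi$-greedy $k$-pseudotriangulation $\Gamma_\chi^k(L)$ is the unique source of the directed graph of $\chi$-increasing flips on $k$-pseudotriangulations of $L$. Index the pseudolines of $L$ as $\ell_1,\dots,\ell_n$ in the order in which they cross $\chi$, and write $\ell_\alpha\wedge\ell_\beta$ for their crossing point. $\mathbb G_\chi^k(L)$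 is the set of crossing points $\ell_\alpha\wedge\ell_\beta$ with $1\le\alpha<\beta\le n$ for which there do NOT exist indices $\gamma_1,\dots,\gamma_k$ and $\delta_1,\dots,\delta_k$ with $\alpha<\gamma_1<\dots<\gamma_k$, $\delta_1<\dots<\delta_k<\beta$, $\delta_k<\gamma_1$, and $\ell_\alpha\wedge\ell_{\gamma_i}\preceq_\chi\ell_\alpha\wedge\ell_\beta$ and $\ell_\beta\wedge\ell_{\delta_i}\preceq_\chi\ell_\alpha\wedge\ell_\beta$ for all $i\in\{1,\dots,k\}$.
   Formalization: In the definition of 𝔾 the comparisons ⪯_χ are taken as strict (γ_i ≠ β, δ_i ≠ α); with the reflexive order γ_1 = β, δ_1 = α is always admissible for k = 1, so 𝔾 would be empty while V(Γ) is not (e.g. n = 2, k = 1). *)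

theory Defs
  imports "HOL-Analysis.Analysis"
begin

subsection \<open>The Moebius strip\<close>

definition tau :: "real \<times> real \<Rightarrow> real \<times> real" where
  "tau p = (fst p + pi, - snd p)"

text \<open>As \<open>tau\<close> is a bijection, this is the orbit relation of the group it generates.\<close>

definition tau_equiv :: "real \<times> real \<Rightarrow> real \<times> real \<Rightarrow> bool" where
  "tau_equiv p q \<longleftrightarrow> (\<exists>m n. (tau ^^ m) p = (tau ^^ n) q)"

lemma equivp_tau_equiv: "equivp tau_equiv"
proof (rule equivpI)
  show "reflp tau_equiv"
    unfolding reflp_def tau_equiv_def by blast
  show "symp tau_equiv"
    unfolding symp_def tau_equiv_def by metis
  show "transp tau_equiv"
  proof (rule transpI)
    fix p q r
    assume "tau_equiv p q" "tau_equiv q r"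
    then obtain m n a b where 1: "(tau ^^ m) p = (tau ^^ n) q" and 2: "(tau ^^ a) q = (tau ^^ b) r"
      unfolding tau_equiv_def by blast
    have "(tau ^^ (a + m)) p = (tau ^^ (a + n)) q"
      using 1 by (simp add: funpow_add)
    also have "\<dots> = (tau ^^ (n + a)) q"
      by (simp add: add.commute)
    also have "\<dots> = (tau ^^ (n + b)) r"
      using 2 by (simp add: funpow_add)
    finally show "tau_equiv p r"
      unfolding tau_equiv_def by blast
  qed
qed

quotient_type moebius = "real \<times> real" / tau_equiv
  morphisms rep_moebius mproj
  by (rule equivp_tau_equiv)

instantiation moebius :: topological_space
begin

definition open_moebius :: "moebius set \<Rightarrow> bool" where
  "open_moebius U \<longleftrightarrow> open (mproj -` U)"

instance
  by standard (auto simp: open_moebius_def vimage_Int vimage_Union)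

end

subsection \<open>Pseudolines and arrangements\<close>

definition represents :: "(real \<Rightarrow> real) \<Rightarrow> moebius set \<Rightarrow> bool" where
  "represents f P \<longleftrightarrow>
     continuous_on UNIV f \<and> (\<forall>x. f (x + pi) = - f x) \<and> P = range (\<lambda>x. mproj (x, f x))"

definition pseudoline :: "moebius set \<Rightarrow> bool" where
  "pseudoline P \<longleftrightarrow> (\<exists>f. represents f P)"

definition crossing_point :: "moebius set \<Rightarrow> moebius set \<Rightarrow> moebius \<Rightarrow> bool" where
  "crossing_point P Q p \<longleftrightarrow>
     (\<exists>f g x. represents f P \<and> represents g Q \<and> p = mproj (x, f x) \<and> f x = g x \<and>
        (\<forall>\<^sub>F h in at_right 0. (f (x - h) - g (x - h)) * (f (x + h) - g (x + h)) < 0))"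

definition contact_point :: "moebius set \<Rightarrow> moebius set \<Rightarrow> moebius \<Rightarrow> bool" where
  "contact_point P Q p \<longleftrightarrow>
     (\<exists>f g x. represents f P \<and> represents g Q \<and> p = mproj (x, f x) \<and> f x = g x \<and>
        (\<forall>\<^sub>F h in at_right 0. (f (x - h) - g (x - h)) * (f (x + h) - g (x + h)) > 0))"

definition arrangement :: "moebius set set \<Rightarrow> bool" where
  "arrangement L \<longleftrightarrow> finite L \<and> (\<forall>P\<in>L. pseudoline P) \<and>
     (\<forall>P\<in>L. \<forall>Q\<in>L. P \<noteq> Q \<longrightarrow> finite (P \<inter> Q) \<and> (\<exists>!p. crossing_point P Q p))"

definition simple_arrangement :: "moebius set set \<Rightarrow> bool" where
  "simple_arrangement L \<longleftrightarrow> arrangement L \<and>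
     (\<forall>P\<in>L. \<forall>Q\<in>L. \<forall>R\<in>L. P \<noteq> Q \<and> P \<noteq> R \<and> Q \<noteq> R \<longrightarrow> P \<inter> Q \<inter> R = {})"

definition wedge :: "moebius set \<Rightarrow> moebius set \<Rightarrow> moebius" where
  "wedge P Q = (THE p. crossing_point P Q p)"

definition support :: "moebius set set \<Rightarrow> moebius set" where
  "support L = \<Union>L"

definition crossing_points :: "moebius set set \<Rightarrow> moebius set" where
  "crossing_points L = {p. \<exists>P\<in>L. \<exists>Q\<in>L. P \<noteq> Q \<and> crossing_point P Q p}"

definition contact_points :: "moebius set set \<Rightarrow> moebius set" where
  "contact_points L = {p. \<exists>P\<in>L. \<exists>Q\<in>L. P \<noteq> Q \<and> contact_point P Q p}"

definition intersection_points :: "moebius set set \<Rightarrow> moebius set" where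
  "intersection_points L = {p. \<exists>P\<in>L. \<exists>Q\<in>L. P \<noteq> Q \<and> p \<in> P \<inter> Q}"

subsection \<open>Levels, kernels, pseudotriangulations\<close>

text \<open>The strip has no boundary, so the external face is the face which is not relatively compact.\<close>

definition external_face :: "moebius set \<Rightarrow> moebius set" where
  "external_face S = \<Union>{C \<in> components (- S). \<not> compact (closure C)}"

definition external_hull :: "moebius set \<Rightarrow> moebius set" where
  "external_hull S = frontier (external_face S)"

text \<open>Consecutive levels meet at vertices. Removing a level means removing its edges: the vertices
  which it shares with the next level stay in the support, whence the closure.
  The \<open>(j + 1)\<close>st level of \<open>L\<close> is \<open>external_hull (kernel L j)\<close>.\<close>

fun kernel :: "moebius set set \<Rightarrow> nat \<Rightarrow> moebius set" where
  "kernel L 0 = support L"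
| "kernel L (Suc j) = closure (kernel L j - external_hull (kernel L j))"

definition pseudotriangulation :: "moebius set set \<Rightarrow> nat \<Rightarrow> moebius set set \<Rightarrow> bool" where
  "pseudotriangulation L k \<Lambda> \<longleftrightarrow> simple_arrangement \<Lambda> \<and> support \<Lambda> = kernel L k \<and>
     contact_points L \<inter> kernel L k \<subseteq> contact_points \<Lambda>"

definition pt_vertices :: "moebius set set \<Rightarrow> moebius set set \<Rightarrow> moebius set" where
  "pt_vertices L \<Lambda> = intersection_points L - crossing_points \<Lambda>"

subsection \<open>Cuts\<close>

definition lifted_vertices :: "moebius set set \<Rightarrow> (real \<times> real) set" where
  "lifted_vertices L = mproj -` intersection_points L"

definition lifted_edge :: "moebius set set \<Rightarrow> real \<times> real \<Rightarrow> real \<times> real \<Rightarrow> bool" where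
  "lifted_edge L z z' \<longleftrightarrow>
     (\<exists>P\<in>L. z \<in> lifted_vertices L \<inter> mproj -` P \<and> z' \<in> lifted_vertices L \<inter> mproj -` P \<and>
        fst z < fst z' \<and>
        (\<forall>u \<in> lifted_vertices L \<inter> mproj -` P. \<not> (fst z < fst u \<and> fst u < fst z')))"

definition path_le :: "moebius set set \<Rightarrow> real \<times> real \<Rightarrow> real \<times> real \<Rightarrow> bool" where
  "path_le L = (lifted_edge L)\<^sup>*\<^sup>*"

definition cut_filter :: "moebius set set \<Rightarrow> (real \<times> real) set \<Rightarrow> bool" where
  "cut_filter L F \<longleftrightarrow> F \<subseteq> lifted_vertices L \<and> F \<noteq> {} \<and> F \<noteq> lifted_vertices L \<and>
     (\<forall>z\<in>F. \<forall>z'\<in>lifted_vertices L. path_le L z z' \<longrightarrow> z' \<in> F)"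

definition cut_le :: "moebius set set \<Rightarrow> (real \<times> real) set \<Rightarrow> moebius \<Rightarrow> moebius \<Rightarrow> bool" where
  "cut_le L F v w \<longleftrightarrow>
     (\<exists>v'\<in>F - tau ` F. \<exists>w'\<in>F - tau ` F. mproj v' = v \<and> mproj w' = w \<and> path_le L v' w')"

definition cut_less :: "moebius set set \<Rightarrow> (real \<times> real) set \<Rightarrow> moebius \<Rightarrow> moebius \<Rightarrow> bool" where
  "cut_less L F v w \<longleftrightarrow> cut_le L F v w \<and> v \<noteq> w"

text \<open>The cut as a curve: \<open>c\<close> parametrizes a vertical curve in the plane which separates the filter
  from its complement. It may run downwards or upwards, as the order in which the pseudolines cross
  a cut is determined only up to reversal.\<close>

definition cut_curve ::
  "moebius set set \<Rightarrow> (real \<times> real) set \<Rightarrow> (real \<Rightarrow> real \<times> real) \<Rightarrow> bool" where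
  "cut_curve L F c \<longleftrightarrow> continuous_on UNIV c \<and> inj c \<and>
     (filterlim (snd \<circ> c) at_top at_bot \<and> filterlim (snd \<circ> c) at_bot at_top \<or>
      filterlim (snd \<circ> c) at_bot at_bot \<and> filterlim (snd \<circ> c) at_top at_top) \<and>
     (\<forall>P\<in>L. \<exists>!t. c t \<in> mproj -` P) \<and>
     (\<forall>P\<in>L. \<forall>t. c t \<in> mproj -` P \<longrightarrow>
        (\<forall>z \<in> lifted_vertices L \<inter> mproj -` P.
           (z \<in> F \<longrightarrow> fst (c t) < fst z) \<and> (z \<notin> F \<longrightarrow> fst z < fst (c t))))"

definition crossing_order ::
  "moebius set set \<Rightarrow> (real \<Rightarrow> real \<times> real) \<Rightarrow> nat \<Rightarrow> (nat \<Rightarrow> moebius set) \<Rightarrow> bool" where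
  "crossing_order L c n l \<longleftrightarrow> bij_betw l {1..n} L \<and>
     (\<exists>t. strict_mono_on {1..n} t \<and> (\<forall>i\<in>{1..n}. c (t i) \<in> mproj -` l i))"

subsection \<open>Flips and greedy pseudotriangulations\<close>

text \<open>Since an arrangement is determined by its support and its contact points, exchanging a contact
  point for a crossing point is expressed through these data.\<close>

definition flip :: "moebius set set \<Rightarrow> moebius set set \<Rightarrow> moebius \<Rightarrow> moebius \<Rightarrow> bool" where
  "flip \<Lambda> \<Lambda>' v w \<longleftrightarrow>
     (\<exists>P\<in>\<Lambda>. \<exists>Q\<in>\<Lambda>. P \<noteq> Q \<and> contact_point P Q v \<and> crossing_point P Q w) \<and>
     support \<Lambda>' = support \<Lambda> \<and> contact_points \<Lambda>' = (contact_points \<Lambda> - {v}) \<union> {w}"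

definition increasing_flip_arc ::
  "moebius set set \<Rightarrow> (real \<times> real) set \<Rightarrow> nat \<Rightarrow> moebius set set \<Rightarrow> moebius set set \<Rightarrow> bool" where
  "increasing_flip_arc L F k \<Lambda> \<Lambda>' \<longleftrightarrow>
     pseudotriangulation L k \<Lambda> \<and> pseudotriangulation L k \<Lambda>' \<and>
     (\<exists>v w. flip \<Lambda> \<Lambda>' v w \<and> cut_less L F v w)"

definition greedy_pseudotriangulation ::
  "moebius set set \<Rightarrow> (real \<times> real) set \<Rightarrow> nat \<Rightarrow> moebius set set" where
  "greedy_pseudotriangulation L F k =
     (THE \<Lambda>. pseudotriangulation L k \<Lambda> \<and> (\<nexists>\<Lambda>'. increasing_flip_arc L F k \<Lambda>' \<Lambda>))"

text \<open>The comparisons have to be strict: \<open>\<gamma> i = \<beta>\<close> and \<open>\<delta> i = \<alpha>\<close> must not count as witnesses.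
  With a reflexive order, \<open>\<gamma> 1 = \<beta>\<close> and \<open>\<delta> 1 = \<alpha>\<close> would make this set empty for \<open>k = 1\<close>.\<close>

definition greedy_crossings ::
  "moebius set set \<Rightarrow> (real \<times> real) set \<Rightarrow> nat \<Rightarrow> nat \<Rightarrow> (nat \<Rightarrow> moebius set) \<Rightarrow> moebius set" where
  "greedy_crossings L F k n l =
     {wedge (l \<alpha>) (l \<beta>) | \<alpha> \<beta>. 1 \<le> \<alpha> \<and> \<alpha> < \<beta> \<and> \<beta> \<le> n \<and>
        \<not> (\<exists>\<gamma> \<delta>. \<gamma> ` {1..k} \<subseteq> {1..n} \<and> \<delta> ` {1..k} \<subseteq> {1..n} \<and>
              strict_mono_on {1..k} \<gamma> \<and> strict_mono_on {1..k} \<delta> \<and>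
              \<alpha> < \<gamma> 1 \<and> \<delta> k < \<beta> \<and> \<delta> k < \<gamma> 1 \<and>
              (\<forall>i\<in>{1..k}. cut_less L F (wedge (l \<alpha>) (l (\<gamma> i))) (wedge (l \<alpha>) (l \<beta>)) \<and>
                          cut_less L F (wedge (l \<beta>) (l (\<delta> i))) (wedge (l \<alpha>) (l \<beta>))))}"

end

theory Submission
  imports Defs "HOL-Library.Real_Mod"
begin

text \<open>Pull everything back to the plane: a pseudoline is the graph of a continuous \<open>pi\<close>-antiperiodic
  function, and the \<open>k\<close>-kernel consists of the levels \<open>k + 1, ..., n - k\<close> of the lines. A curve of a
  \<open>k\<close>-pseudotriangulation follows the lines, going straight at its crossing points and changing line
  at every other vertex, so it is determined by the set of crossing points.

  If a pair of curves crosses before it touches (inside the window \<open>F - tau ` F\<close>), exchanging the two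
  curves between these points yields a flip into the arrangement. Hence in a source all contacts of a
  pair precede its crossing. Two arrangements with this property coincide: at the last vertex where they
  differ one of them has a contact; following its two curves up to their later crossing shows that the
  other arrangement has a pair that crosses twice.

  The source is given explicitly by the 0-1 principle for sorting networks. Fix a threshold \<open>t\<close>,
  call the lines with index \<open>> t\<close> ones and the others zeros, and let a point of the window have
  \<open>A\<close> ones above and \<open>B\<close> zeros below it. Sweeping backwards over a vertex, the number \<open>h i\<close> of ones
  among the \<open>i\<close> uppermost curves becomes \<open>max (h (i - 1)) (h (i + 1) - 1)\<close>. This rule is linear in max-plus
  algebra, so the greedy count is a maximum of known solutions: \<open>A - min A (min B k)\<close> curves with
  index \<open>> t - k\<close> lie above the point. At a vertex \<open>l i \<inter> l j\<close> two of these curves cross exactly if for some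
  \<open>t\<close> with \<open>i \<le> t < j\<close> both \<open>A \<ge> k\<close> and \<open>B \<ge> k\<close>, and this is the negation of the condition which
  defines \<open>greedy_crossings\<close>.\<close>

section \<open>The Moebius strip\<close>

definition deck_sign :: "int \<Rightarrow> real" where
  "deck_sign r = (if even r then 1 else - 1)"

definition deck :: "int \<Rightarrow> real \<times> real \<Rightarrow> real \<times> real" where
  "deck r z = (fst z + of_int r * pi, deck_sign r * snd z)"

lemma deck_sign_simps [simp]:
  "deck_sign 0 = 1" "deck_sign 1 = - 1" "deck_sign (- r) = deck_sign r"
  "deck_sign (r + s) = deck_sign r * deck_sign s" "deck_sign r * deck_sign r = 1"
  "deck_sign r * (deck_sign r * y) = y" "deck_sign r \<noteq> 0" "\<bar>deck_sign r * y\<bar> = \<bar>y\<bar>"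
  by (auto simp: deck_sign_def)

lemma deck_0: "deck 0 z = z"
  by (simp add: deck_def)

lemma deck_add: "deck (r + s) z = deck r (deck s z)"
  by (simp add: deck_def algebra_simps)

lemma funpow_tau: "(tau ^^ m) z = deck (int m) z"
proof (induction m)
  case (Suc m)
  have "tau w = deck 1 w" for w by (simp add: tau_def deck_def)
  then show ?case using Suc by (simp flip: deck_add)
qed (simp add: deck_0)

lemma mproj_eq_iff: "mproj z = mproj w \<longleftrightarrow> (\<exists>r. w = deck r z)"
proof -
  have "mproj z = mproj w \<longleftrightarrow> (\<exists>m n. deck (int m) z = deck (int n) w)"
    unfolding moebius.abs_eq_iff tau_equiv_def funpow_tau ..
  also have "\<dots> \<longleftrightarrow> (\<exists>r. w = deck r z)"
  proof
    assume "\<exists>m n. deck (int m) z = deck (int n) w"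
    then obtain m n where "deck (int m) z = deck (int n) w" by blast
    then have "deck (- int n) (deck (int n) w) = deck (- int n + int m) z" by (simp only: deck_add)
    then have "w = deck (- int n + int m) z" by (simp add: deck_0 flip: deck_add)
    then show "\<exists>r. w = deck r z" by blast
  next
    assume "\<exists>r. w = deck r z"
    then obtain r where "w = deck r z" by blast
    moreover obtain m n where "r = int m - int n" by (rule int_diff_cases)
    ultimately have "deck (int m) z = deck (int n) w" by (simp flip: deck_add)
    then show "\<exists>m n. deck (int m) z = deck (int n) w" by blast
  qed
  finally show ?thesis .
qed

lemma mproj_deck [simp]: "mproj (deck r z) = mproj z"
  using mproj_eq_iff by metis

lemma mproj_cases: obtains x y where "p = mproj (x, y)"
  using Quotient_abs_rep[OF Quotient_moebius, of p] by (metis surj_pair)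

lemma continuous_mproj: "continuous_on UNIV mproj"
  by (auto simp: continuous_on_open_vimage open_moebius_def)

lemma closed_moebius_iff: "closed S \<longleftrightarrow> closed (mproj -` S)"
  by (simp add: closed_def open_moebius_def vimage_Compl)

lemma vimage_mproj_image: "mproj -` (mproj ` T) = (\<Union>r. deck r -` T)"
  unfolding set_eq_iff vimage_eq image_iff UN_iff mproj_eq_iff by blast

lemma vimage_mproj_image_invariant:
  assumes "\<And>r z. z \<in> T \<Longrightarrow> deck r z \<in> T"
  shows "mproj -` (mproj ` T) = T"
proof -
  have "z \<in> T" if "deck r z \<in> T" for r z
    using assms[OF that, of "- r"] by (simp add: deck_0 flip: deck_add)
  then have "deck r z \<in> T \<longleftrightarrow> z \<in> T" for r z using assms by blast
  then have "deck r -` T = T" for r by blast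
  then show ?thesis by (simp add: vimage_mproj_image)
qed

lemma mproj_mem_image_iff:
  assumes "\<And>r z. z \<in> T \<Longrightarrow> deck r z \<in> T"
  shows "mproj z \<in> mproj ` T \<longleftrightarrow> z \<in> T"
  using vimage_mproj_image_invariant[OF assms] by blast

lemma open_mproj_image:
  assumes "open U" shows "open (mproj ` U)"
proof -
  have "open (deck r -` U)" for r
    unfolding deck_def by (intro open_vimage assms continuous_intros)
  then show ?thesis by (simp add: open_moebius_def vimage_mproj_image open_UN)
qed

lemma vimage_mproj_closure: "mproj -` closure S = closure (mproj -` S)"
proof
  have "closed (mproj -` closure S)"
    by (rule closed_vimage) (auto simp: continuous_mproj)
  then show "closure (mproj -` S) \<subseteq> mproj -` closure S"
    using closure_subset[of S] by (intro closure_minimal) auto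
  show "mproj -` closure S \<subseteq> closure (mproj -` S)"
  proof
    let ?U = "- closure (mproj -` S)"
    have "mproj ` ?U \<inter> S = {}" using closure_subset[of "mproj -` S"] by auto
    then have "mproj ` ?U \<inter> closure S = {}"
      using open_Int_closure_eq_empty[OF open_mproj_image[of ?U], of S] by auto
    then show "z \<in> closure (mproj -` S)" if "z \<in> mproj -` closure S" for z using that by blast
  qed
qed

section \<open>Antiperiodic functions\<close>

definition antiperiodic :: "(real \<Rightarrow> real) \<Rightarrow> bool" where
  "antiperiodic f \<longleftrightarrow> continuous_on UNIV f \<and> (\<forall>x. f (x + pi) = - f x)"

lemma antiperiodic_continuous_on: "antiperiodic f \<Longrightarrow> continuous_on S f"
  by (auto simp: antiperiodic_def intro: continuous_on_subset)

lemma antiperiodic_isCont: "antiperiodic f \<Longrightarrow> isCont f x"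
  by (simp add: antiperiodic_def continuous_on_eq_continuous_at)

lemma antiperiodic_add_pi: "antiperiodic f \<Longrightarrow> f (x + pi) = - f x"
  by (simp add: antiperiodic_def)

lemma antiperiodic_diff_pi: "antiperiodic f \<Longrightarrow> f (x - pi) = - f x"
  using antiperiodic_add_pi[of f "x - pi"] by simp

lemma antiperiodic_shift:
  assumes "antiperiodic f" shows "f (x + of_int r * pi) = deck_sign r * f x"
proof (induction r rule: int_induct[of _ 0])
  case (step1 r)
  then show ?case
    using antiperiodic_add_pi[OF assms, of "x + of_int r * pi"] by (simp add: algebra_simps)
next
  case (step2 r)
  then show ?case
    using antiperiodic_diff_pi[OF assms, of "x + of_int r * pi"] deck_sign_simps(4)[of r "- 1"]
    by (simp add: algebra_simps)
qed simp

lemma deck_graph: "antiperiodic f \<Longrightarrow> deck r (x, f x) = (x + of_int r * pi, f (x + of_int r * pi))"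
  by (simp add: deck_def antiperiodic_shift)

lemma antiperiodic_eq_rcong:
  "antiperiodic f \<Longrightarrow> antiperiodic g \<Longrightarrow> [x = x'] (rmod pi) \<Longrightarrow> f x = g x \<longleftrightarrow> f x' = g x'"
  by (auto simp: rcong_altdef antiperiodic_shift)

lemma rcong_less_imp_add_le:
  assumes "[x = y] (rmod m)" "x < y" "m > 0" shows "x + m \<le> y"
proof (rule ccontr)
  assume "\<not> ?thesis"
  then have "\<bar>x - y\<bar> < \<bar>m\<bar>" using assms(2) by simp
  then show False using rcong_imp_eq[OF assms(1)] assms(2) by simp
qed

lemma rcong_representative:
  assumes "m > 0" obtains y where "[x = y] (rmod m)" "a \<le> y" "y < a + m"
proof
  show "[x = a + (x - a) rmod m] (rmod m)"
    using rcong_add[OF rcong_refl[of a], of "x - a" "(x - a) rmod m" m] by simp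
qed (use assms rmod_nonneg[of m "x - a"] rmod_less[of m "x - a"] in auto)

lemma antiperiodic_bounded:
  assumes "antiperiodic f" obtains M where "\<And>x. \<bar>f x\<bar> \<le> M"
proof -
  have "bounded (f ` {0..pi})"
    by (intro compact_imp_bounded compact_continuous_image antiperiodic_continuous_on[OF assms]) auto
  then obtain M where M: "\<And>x. x \<in> {0..pi} \<Longrightarrow> \<bar>f x\<bar> \<le> M" unfolding bounded_iff by force
  have "\<bar>f x\<bar> \<le> M" for x
  proof -
    obtain x0 where x0: "[x0 = x] (rmod pi)" "0 \<le> x0" "x0 < 0 + pi"
      using rcong_representative[of pi x 0] by (metis pi_gt_zero rcong_sym)
    then have "\<bar>f x\<bar> = \<bar>f x0\<bar>" by (auto simp: rcong_altdef antiperiodic_shift[OF assms])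
    then show ?thesis using M[of x0] x0 by simp
  qed
  then show thesis by (rule that)
qed

lemma continuous_on_UNIV_piecewise:
  fixes g :: "real \<Rightarrow> 'a::topological_space"
  assumes "d > 0" and pieces: "\<And>r::int. continuous_on {a + of_int r * d..a + of_int (r + 1) * d} g"
  shows "continuous_on UNIV g"
proof -
  have "isCont g x" for x
  proof -
    define r where "r = \<lfloor>(x - a) / d\<rfloor>"
    have "of_int r \<le> (x - a) / d" "(x - a) / d < of_int r + 1" unfolding r_def by linarith+
    then have x: "a + of_int (r - 1) * d < x" "x < a + of_int (r + 1) * d"
      using assms(1) by (auto simp: field_simps)
    have "continuous_on
        ({a + of_int (r - 1) * d..a + of_int (r - 1 + 1) * d} \<union>
          {a + of_int r * d..a + of_int (r + 1) * d}) g"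
      by (intro continuous_on_closed_Un pieces) auto
    then have "continuous_on {a + of_int (r - 1) * d<..<a + of_int (r + 1) * d} g"
      by (rule continuous_on_subset) auto
    then show ?thesis using x by (simp add: continuous_on_eq_continuous_at)
  qed
  then show ?thesis by (simp add: continuous_on_eq_continuous_at)
qed

lemma antiperiodic_extension:
  fixes h :: "real \<Rightarrow> real"
  assumes h: "continuous_on {a..a + pi} h" "h (a + pi) = - h a"
  obtains g where "antiperiodic g" "\<And>x. a \<le> x \<Longrightarrow> x \<le> a + pi \<Longrightarrow> g x = h x"
proof -
  define R where "R x = \<lfloor>(x - a) / pi\<rfloor>" for x
  define g where "g x = deck_sign (R x) * h (x - of_int (R x) * pi)" for x
  have piece: "g x = deck_sign r * h (x - of_int r * pi)"
    if "a + of_int r * pi \<le> x" "x \<le> a + of_int (r + 1) * pi" for x r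
  proof (cases "x = a + of_int (r + 1) * pi")
    case True
    then have "(x - a) / pi = of_int (r + 1)" by simp
    then have "R x = r + 1" unfolding R_def by (simp only: floor_of_int)
    then have "g x = deck_sign (r + 1) * h a" using True by (simp add: g_def)
    also have "\<dots> = deck_sign r * h (a + pi)" using h(2) by simp
    finally show ?thesis using True by (simp add: algebra_simps)
  next
    case False
    then have "of_int r \<le> (x - a) / pi" "(x - a) / pi < of_int r + 1"
      using that by (auto simp: field_simps)
    then have "R x = r" unfolding R_def by linarith
    then show ?thesis by (simp add: g_def)
  qed
  have "continuous_on UNIV g"
  proof (rule continuous_on_UNIV_piecewise[of pi a])
    fix r :: int
    have "continuous_on {a + of_int r * pi..a + of_int (r + 1) * pi}
        (\<lambda>x. deck_sign r * h (x - of_int r * pi))"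
      by (intro continuous_intros continuous_on_compose2[OF h(1)]) (auto simp: algebra_simps)
    then show "continuous_on {a + of_int r * pi..a + of_int (r + 1) * pi} g"
      by (rule continuous_on_eq) (rule piece[symmetric], auto)
  qed simp
  moreover have "g (x + pi) = - g x" for x
  proof -
    have "(x + pi - a) / pi = (x - a) / pi + 1" by (simp add: field_simps)
    then have "R (x + pi) = R x + 1" by (simp add: R_def)
    then show ?thesis by (simp add: g_def algebra_simps)
  qed
  ultimately have "antiperiodic g" by (simp add: antiperiodic_def)
  moreover have "g x = h x" if "a \<le> x" "x \<le> a + pi" for x using piece[of 0 x] that by simp
  ultimately show thesis by (rule that)
qed

lemma antiperiodic_eq_at_limit:
  assumes "antiperiodic f" "antiperiodic g" "at x within S \<noteq> bot"
    and "\<forall>\<^sub>F t in at x within S. f t = g t"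
  shows "f x = g x"
proof (rule tendsto_unique[OF assms(3)])
  show "(f \<longlongrightarrow> f x) (at x within S)"
    using antiperiodic_isCont[OF assms(1)] unfolding isCont_def by (rule tendsto_within_subset) simp
  have "(g \<longlongrightarrow> g x) (at x within S)"
    using antiperiodic_isCont[OF assms(2)] unfolding isCont_def by (rule tendsto_within_subset) simp
  then show "(f \<longlongrightarrow> g x) (at x within S)"
    by (rule Lim_transform_eventually) (use assms(4) in eventually_elim, simp)
qed

section \<open>Crossings and contacts of functions\<close>

definition gap_product :: "(real \<Rightarrow> real) \<Rightarrow> (real \<Rightarrow> real) \<Rightarrow> real \<Rightarrow> real \<Rightarrow> real" where
  "gap_product f g x h = (f (x - h) - g (x - h)) * (f (x + h) - g (x + h))"

definition crosses :: "(real \<Rightarrow> real) \<Rightarrow> (real \<Rightarrow> real) \<Rightarrow> real \<Rightarrow> bool" where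
  "crosses f g x \<longleftrightarrow> f x = g x \<and> (\<forall>\<^sub>F h in at_right 0. gap_product f g x h < 0)"

definition touches :: "(real \<Rightarrow> real) \<Rightarrow> (real \<Rightarrow> real) \<Rightarrow> real \<Rightarrow> bool" where
  "touches f g x \<longleftrightarrow> f x = g x \<and> (\<forall>\<^sub>F h in at_right 0. gap_product f g x h > 0)"

lemma crosses_imp_eq: "crosses f g x \<Longrightarrow> f x = g x"
  by (simp add: crosses_def)

lemma touches_imp_eq: "touches f g x \<Longrightarrow> f x = g x"
  by (simp add: touches_def)

lemma crosses_commute: "crosses f g x \<longleftrightarrow> crosses g f x"
  and touches_commute: "touches f g x \<longleftrightarrow> touches g f x"
proof -
  have "gap_product f g x h = gap_product g f x h" for h by (simp add: gap_product_def algebra_simps)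
  then show "crosses f g x \<longleftrightarrow> crosses g f x" "touches f g x \<longleftrightarrow> touches g f x"
    unfolding crosses_def touches_def by (auto simp: eq_commute)
qed

lemma crosses_not_touches: "crosses f g x \<Longrightarrow> \<not> touches f g x"
proof
  assume "crosses f g x" "touches f g x"
  then have "\<forall>\<^sub>F h in at_right 0. gap_product f g x h < 0 \<and> gap_product f g x h > 0"
    unfolding crosses_def touches_def by (auto intro: eventually_conj)
  then show False using eventually_happens'[OF trivial_limit_at_right_real] by force
qed

lemma crosses_rcong:
  "antiperiodic f \<Longrightarrow> antiperiodic g \<Longrightarrow> [x = x'] (rmod pi) \<Longrightarrow> crosses f g x \<longleftrightarrow> crosses f g x'"
  and touches_rcong:
    "antiperiodic f \<Longrightarrow> antiperiodic g \<Longrightarrow> [x = x'] (rmod pi) \<Longrightarrow> touches f g x \<longleftrightarrow> touches f g x'"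
proof -
  assume a: "antiperiodic f" "antiperiodic g" and c: "[x = x'] (rmod pi)"
  obtain r where r: "x' = x + of_int r * pi" using c by (auto simp: rcong_altdef)
  have "gap_product f g x' h = gap_product f g x h" for h
  proof -
    have "x' - h = (x - h) + of_int r * pi" "x' + h = (x + h) + of_int r * pi" using r by auto
    then have "f (x' - h) - g (x' - h) = deck_sign r * (f (x - h) - g (x - h))"
      "f (x' + h) - g (x' + h) = deck_sign r * (f (x + h) - g (x + h))"
      using a by (simp_all only: antiperiodic_shift right_diff_distrib)
    then show ?thesis by (simp add: gap_product_def deck_sign_def)
  qed
  then show "crosses f g x \<longleftrightarrow> crosses f g x'" "touches f g x \<longleftrightarrow> touches f g x'"
    unfolding crosses_def touches_def using antiperiodic_eq_rcong[OF a c] by simp_all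
qed

lemma eventually_at_left_iff_right_0: "(\<forall>\<^sub>F t in at_left x. P t) \<longleftrightarrow> (\<forall>\<^sub>F h in at_right 0. P (x - h))"
  for x :: real
proof -
  have "(\<forall>\<^sub>F t in at_left x. P t) \<longleftrightarrow> (\<forall>\<^sub>F h in at_right 0. P (- (h + - x)))"
    unfolding eventually_at_left_to_right eventually_at_right_to_0[of _ "- x"] ..
  then show ?thesis by simp
qed

lemma eventually_at_right_iff_right_0: "(\<forall>\<^sub>F t in at_right x. P t) \<longleftrightarrow> (\<forall>\<^sub>F h in at_right 0. P (x + h))"
  for x :: real
  by (subst eventually_at_right_to_0) (simp add: add.commute)

lemma crossesI:
  assumes "f x = g x" "\<forall>\<^sub>F t in at_left x. g t < f t" "\<forall>\<^sub>F t in at_right x. f t < g t"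
  shows "crosses f g x"
  unfolding crosses_def
proof
  show "\<forall>\<^sub>F h in at_right 0. gap_product f g x h < 0"
    using assms(2,3)[unfolded eventually_at_left_iff_right_0[of _ x]
      eventually_at_right_iff_right_0[of _ x]]
    by eventually_elim (simp add: gap_product_def mult_less_0_iff)
qed (rule assms(1))

lemma touchesI:
  assumes "f x = g x" "\<forall>\<^sub>F t in at_left x. g t < f t" "\<forall>\<^sub>F t in at_right x. g t < f t"
  shows "touches f g x"
  unfolding touches_def
proof
  show "\<forall>\<^sub>F h in at_right 0. 0 < gap_product f g x h"
    using assms(2,3)[unfolded eventually_at_left_iff_right_0[of _ x]
      eventually_at_right_iff_right_0[of _ x]]
    by eventually_elim (simp add: gap_product_def zero_less_mult_iff)
qed (rule assms(1))

lemma crosses_order_right: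
  assumes "crosses f g x" "\<forall>\<^sub>F t in at_left x. g t < f t"
  shows "\<forall>\<^sub>F t in at_right x. f t < g t"
  unfolding eventually_at_right_iff_right_0[of _ x]
  using assms(1)[unfolded crosses_def gap_product_def, THEN conjunct2]
    assms(2)[unfolded eventually_at_left_iff_right_0[of _ x]]
  by eventually_elim (auto simp: mult_less_0_iff)

lemma
  assumes ev: "\<forall>\<^sub>F t in at x. f t = f' t \<and> g t = g' t" and at: "f x = f' x" "g x = g' x"
  shows crosses_cong: "crosses f g x \<longleftrightarrow> crosses f' g' x"
      and touches_cong: "touches f g x \<longleftrightarrow> touches f' g' x"
proof -
  have "\<forall>\<^sub>F h in at_right 0. gap_product f g x h = gap_product f' g' x h"
    using ev[unfolded eventually_at_split eventually_at_left_iff_right_0[of _ x]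
      eventually_at_right_iff_right_0[of _ x],
        THEN conjunct1]
      ev[unfolded eventually_at_split eventually_at_left_iff_right_0[of _ x]
          eventually_at_right_iff_right_0[of _ x],
        THEN conjunct2]
    by eventually_elim (simp add: gap_product_def)
  then have "(\<forall>\<^sub>F h in at_right 0. gap_product f g x h < 0) \<longleftrightarrow>
      (\<forall>\<^sub>F h in at_right 0. gap_product f' g' x h < 0)"
    "(\<forall>\<^sub>F h in at_right 0. gap_product f g x h > 0) \<longleftrightarrow> (\<forall>\<^sub>F h in at_right 0. gap_product f' g' x h > 0)"
    by (auto elim: eventually_elim2)
  then show "crosses f g x \<longleftrightarrow> crosses f' g' x" "touches f g x \<longleftrightarrow> touches f' g' x"
    unfolding crosses_def touches_def using at by simp_all
qed

lemma
  assumes "\<forall>\<^sub>F t in at_left x. f t = f' t \<and> g t = g' t"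
    "\<forall>\<^sub>F t in at_right x. f t = g' t \<and> g t = f' t" "f x = g x"
  shows crosses_swap: "crosses f' g' x \<Longrightarrow> touches f g x"
      and touches_swap: "touches f' g' x \<Longrightarrow> crosses f g x"
proof -
  have "\<forall>\<^sub>F h in at_right 0. gap_product f g x h = - gap_product f' g' x h"
    using assms(1,2)[unfolded eventually_at_left_iff_right_0[of _ x]
      eventually_at_right_iff_right_0[of _ x]]
    by eventually_elim (simp add: gap_product_def algebra_simps)
  then show "crosses f' g' x \<Longrightarrow> touches f g x" "touches f' g' x \<Longrightarrow> crosses f g x"
    unfolding crosses_def touches_def using assms(3) by (auto elim: eventually_elim2)
qed

lemma connected_neq_imp_less_or_greater:
  fixes f g :: "'a::topological_space \<Rightarrow> real"
  assumes "continuous_on UNIV f" "continuous_on UNIV g" "connected S" "\<And>t. t \<in> S \<Longrightarrow> f t \<noteq> g t"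
  shows "(\<forall>t\<in>S. f t < g t) \<or> (\<forall>t\<in>S. g t < f t)"
proof -
  have "{t. f t \<le> g t} \<inter> S = {} \<or> {t. g t \<le> f t} \<inter> S = {}"
    using assms by (intro connected_closedD closed_Collect_le) (force+)
  then show ?thesis by (auto simp: disjoint_iff not_le)
qed

lemma eventually_neq_imp_less_or_greater:
  fixes f g :: "real \<Rightarrow> real"
  assumes f: "continuous_on UNIV f" "continuous_on UNIV g" and neq: "\<forall>\<^sub>F t in at x. f t \<noteq> g t"
  shows "(\<forall>\<^sub>F t in at_left x. f t < g t) \<or> (\<forall>\<^sub>F t in at_left x. g t < f t)"
    and "(\<forall>\<^sub>F t in at_right x. f t < g t) \<or> (\<forall>\<^sub>F t in at_right x. g t < f t)"
proof -
  obtain b where b: "b < x" "\<And>t. b < t \<Longrightarrow> t < x \<Longrightarrow> f t \<noteq> g t"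
    using neq unfolding eventually_at_split eventually_at_left_field by blast
  have "(\<forall>t\<in>{b<..<x}. f t < g t) \<or> (\<forall>t\<in>{b<..<x}. g t < f t)"
    by (rule connected_neq_imp_less_or_greater[OF f connected_Ioo]) (use b in auto)
  then show "(\<forall>\<^sub>F t in at_left x. f t < g t) \<or> (\<forall>\<^sub>F t in at_left x. g t < f t)"
    unfolding eventually_at_left_field using b(1) by (metis greaterThanLessThan_iff)
  obtain b where b: "b > x" "\<And>t. x < t \<Longrightarrow> t < b \<Longrightarrow> f t \<noteq> g t"
    using neq unfolding eventually_at_split eventually_at_right_field by blast
  have "(\<forall>t\<in>{x<..<b}. f t < g t) \<or> (\<forall>t\<in>{x<..<b}. g t < f t)"
    by (rule connected_neq_imp_less_or_greater[OF f connected_Ioo]) (use b in auto)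
  then show "(\<forall>\<^sub>F t in at_right x. f t < g t) \<or> (\<forall>\<^sub>F t in at_right x. g t < f t)"
    unfolding eventually_at_right_field using b(1) by (metis greaterThanLessThan_iff)
qed

lemma continuous_crosses_iff_not_touches:
  assumes f: "continuous_on UNIV f" "continuous_on UNIV g" and neq: "\<forall>\<^sub>F t in at x. f t \<noteq> g t"
    and eq: "f x = g x"
  shows "crosses f g x \<longleftrightarrow> \<not> touches f g x"
proof -
  have "crosses f g x \<or> touches f g x"
    using eventually_neq_imp_less_or_greater[OF f neq] crossesI[of f x g] touchesI[of f x g]
      crossesI[of g x f] touchesI[of g x f] eq crosses_commute touches_commute by metis
  then show ?thesis using crosses_not_touches by blast
qed

lemma interval_induction_right:
  fixes P :: "real \<Rightarrow> bool"
  assumes start: "\<forall>\<^sub>F t in at_right a. P t"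
    and limit: "\<And>s. a < s \<Longrightarrow> s \<le> b \<Longrightarrow> \<forall>\<^sub>F t in at_left s. P t \<Longrightarrow> P s"
    and step: "\<And>s. a < s \<Longrightarrow> s < b \<Longrightarrow> P s \<Longrightarrow> \<forall>\<^sub>F t in at_left s. P t \<Longrightarrow> \<forall>\<^sub>F t in at_right s. P t"
    and t: "a < t" "t \<le> b"
  shows "P t"
proof (rule ccontr)
  assume "\<not> P t"
  define S where "S = {u. a < u \<and> u \<le> b \<and> \<not> P u}"
  define s where "s = Inf S"
  have S: "t \<in> S" "bdd_below S" using \<open>\<not> P t\<close> t by (auto simp: S_def intro: bdd_belowI[of _ a])
  obtain e where e: "e > a" "\<And>u. a < u \<Longrightarrow> u < e \<Longrightarrow> P u"
    using start unfolding eventually_at_right_field by blast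
  have "e \<le> s" unfolding s_def
    using S(1) e(2) by (intro cInf_greatest) (auto simp: S_def not_less[symmetric])
  then have "a < s" using e(1) by simp
  have "s \<le> t" unfolding s_def using S by (rule cInf_lower)
  then have "s \<le> b" using t by simp
  have "u \<notin> S" if "u < s" for u using that S(2) unfolding s_def by (meson cInf_lower not_le)
  then have left: "\<forall>\<^sub>F u in at_left s. P u"
    unfolding eventually_at_left_field using \<open>a < s\<close> \<open>s \<le> b\<close> by (intro exI[of _ a]) (auto simp: S_def)
  have "P s" by (rule limit[OF \<open>a < s\<close> \<open>s \<le> b\<close> left])
  then have "s < t" using \<open>s \<le> t\<close> \<open>\<not> P t\<close> by (cases "s = t") auto
  then have "\<forall>\<^sub>F u in at_right s. P u" using step[OF \<open>a < s\<close> _ \<open>P s\<close> left] t(2) by simp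
  then obtain d where d: "d > s" "\<And>u. s < u \<Longrightarrow> u < d \<Longrightarrow> P u" unfolding eventually_at_right_field by blast
  have "S \<noteq> {}" "Inf S < d" using S(1) d(1) by (auto simp: s_def)
  then obtain u where "u \<in> S" "u < d" using cInf_lessD by blast
  moreover have "s \<le> u" unfolding s_def using \<open>u \<in> S\<close> S(2) by (rule cInf_lower)
  ultimately show False using d(2) \<open>P s\<close> by (cases "u = s") (auto simp: S_def)
qed

lemma
  fixes f g :: "real \<Rightarrow> real"
  assumes cont: "continuous_on UNIV f" "continuous_on UNIV g"
  shows continuous_less_eventually: "f x < g x \<Longrightarrow> \<forall>\<^sub>F t in at x within S. f t < g t"
    and continuous_eventually_le: "at x within S \<noteq> bot \<Longrightarrow> \<forall>\<^sub>F t in at x within S. f t \<le> g t \<Longrightarrow> f x \<le> g x"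
proof -
  have lim: "(f \<longlongrightarrow> f x) (at x within S)" "(g \<longlongrightarrow> g x) (at x within S)"
    using cont by (auto simp: continuous_on_def intro: tendsto_within_subset)
  show "\<forall>\<^sub>F t in at x within S. f t < g t" if "f x < g x"
    using order_tendstoD(1)[OF tendsto_diff[OF lim(2,1)], of 0] that by simp
  show "f x \<le> g x" if "at x within S \<noteq> bot" "\<forall>\<^sub>F t in at x within S. f t \<le> g t"
    by (rule tendsto_le[OF that(1) lim(2,1) that(2)])
qed

lemma no_crossing_imp_order_persists:
  fixes f g :: "real \<Rightarrow> real"
  assumes cont: "continuous_on UNIV f" "continuous_on UNIV g" and neq: "\<And>x. \<forall>\<^sub>F t in at x. f t \<noteq> g t"
    and none: "\<And>x. \<not> crosses f g x" and "g a < f a" "a < b"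
  shows "g b \<le> f b"
proof (rule interval_induction_right[of "\<lambda>t. g t \<le> f t" a b b])
  note sides = eventually_neq_imp_less_or_greater[OF cont neq]
  have keeps: "\<forall>\<^sub>F t in at_right x. g t \<le> f t" if "g x < f x" for x
    by (rule eventually_mono[OF continuous_less_eventually[OF cont(2,1) that]]) simp
  show "\<forall>\<^sub>F t in at_right a. g t \<le> f t" by (rule keeps[OF \<open>g a < f a\<close>])
  show "g s \<le> f s" if "\<forall>\<^sub>F t in at_left s. g t \<le> f t" for s
    by (rule continuous_eventually_le[OF cont(2,1) trivial_limit_at_left_real that])
  show "\<forall>\<^sub>F t in at_right s. g t \<le> f t" if "g s \<le> f s" "\<forall>\<^sub>F t in at_left s. g t \<le> f t" for s
  proof (cases "f s = g s")
    case True
    have left: "\<forall>\<^sub>F t in at_left s. g t < f t"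
      using that(2) neq[of s, unfolded eventually_at_split, THEN conjunct1] by eventually_elim simp
    then have "\<not> (\<forall>\<^sub>F t in at_right s. f t < g t)" using none crossesI[OF True left] by blast
    then have "\<forall>\<^sub>F t in at_right s. g t < f t" using sides(2) by blast
    then show ?thesis by (auto elim: eventually_mono)
  qed (use that(1) in \<open>simp add: keeps\<close>)
qed (use \<open>a < b\<close> in auto)

lemma antiperiodic_crossing_exists:
  assumes f: "antiperiodic f" "antiperiodic g" and sparse: "{t. f t = g t} sparse_in UNIV"
  obtains x where "crosses f g x"
proof -
  have neq: "\<forall>\<^sub>F t in at x. f t \<noteq> g t" for x
    using sparse by (simp add: sparse_in_eventually_iff)
  note add_pi = antiperiodic_add_pi[OF f(1)] antiperiodic_add_pi[OF f(2)]
  obtain t where "f t \<noteq> g t" using eventually_happens'[OF at_neq_bot neq[of 0]] by blast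
  then have "g t < f t \<or> g (t + pi) < f (t + pi)" using add_pi[of t] by linarith
  then obtain a where a: "g a < f a" by blast
  have "\<exists>x. crosses f g x"
  proof (rule ccontr)
    assume "\<not> ?thesis"
    then have "g (a + pi) \<le> f (a + pi)"
      by (intro no_crossing_imp_order_persists[OF antiperiodic_continuous_on[OF f(1)]
        antiperiodic_continuous_on[OF f(2)] neq _ a])
        auto
    then show False using add_pi[of a] a by simp
  qed
  then show thesis using that by blast
qed

lemma order_until_next_meeting:
  fixes f g :: "real \<Rightarrow> real"
  assumes cont: "continuous_on UNIV f" "continuous_on UNIV g"
    and right: "\<forall>\<^sub>F t in at_right a. f t < g t" and b: "a < b" "f b = g b"
  obtains u where "a < u" "u \<le> b" "f u = g u" "\<forall>\<^sub>F t in at_left u. f t < g t"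
proof -
  have "\<exists>u. a < u \<and> u \<le> b \<and> f u = g u \<and> (\<forall>\<^sub>F t in at_left u. f t < g t)"
  proof (rule ccontr)
    assume none: "\<not> ?thesis"
    have "f b < g b"
    proof (rule interval_induction_right[OF right])
      show "f s < g s" if "a < s" "s \<le> b" and left: "\<forall>\<^sub>F t in at_left s. f t < g t" for s
      proof -
        have "f s \<le> g s"
          by (rule continuous_eventually_le[OF cont trivial_limit_at_left_real])
            (use left in \<open>auto elim: eventually_mono\<close>)
        moreover have "f s \<noteq> g s" using none that by blast
        ultimately show ?thesis by simp
      qed
    qed (use b continuous_less_eventually[OF cont] in auto)
    then show False using b(2) by simp
  qed
  then show thesis using that by blast
qed

section \<open>Pseudolines as graphs\<close>

definition rep_fun :: "moebius set \<Rightarrow> real \<Rightarrow> real" where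
  "rep_fun P = (THE f. represents f P)"

definition proj_graph :: "(real \<Rightarrow> real) \<Rightarrow> moebius set" where
  "proj_graph f = range (\<lambda>x. mproj (x, f x))"

lemma represents_iff: "represents f P \<longleftrightarrow> antiperiodic f \<and> P = proj_graph f"
  by (simp add: represents_def antiperiodic_def proj_graph_def)

lemma mproj_eq_graph_iff:
  assumes "antiperiodic f" shows "mproj (x, y) = mproj (u, f u) \<longleftrightarrow> [u = x] (rmod pi) \<and> y = f x"
proof -
  have "mproj (x, y) = mproj (u, f u) \<longleftrightarrow> (\<exists>r. (x, y) = deck r (u, f u))"
    unfolding mproj_eq_iff[symmetric] by (rule eq_commute)
  then show ?thesis unfolding deck_graph[OF assms] rcong_altdef by auto
qed

lemma mem_proj_graph: "antiperiodic f \<Longrightarrow> mproj (x, y) \<in> proj_graph f \<longleftrightarrow> y = f x"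
  unfolding proj_graph_def by (auto simp: mproj_eq_graph_iff)

lemma represents_unique: "represents f P \<Longrightarrow> represents g P \<Longrightarrow> f = g"
  unfolding represents_iff by (metis ext mem_proj_graph)

lemma rep_fun_eq: "represents f P \<Longrightarrow> rep_fun P = f"
  unfolding rep_fun_def by (blast intro: the_equality represents_unique)

lemma represents_rep_fun: "pseudoline P \<Longrightarrow> represents (rep_fun P) P"
  using rep_fun_eq pseudoline_def by auto

lemma antiperiodic_rep_fun: "pseudoline P \<Longrightarrow> antiperiodic (rep_fun P)"
  using represents_rep_fun represents_iff by blast

lemma proj_graph_rep_fun: "pseudoline P \<Longrightarrow> proj_graph (rep_fun P) = P"
  using represents_rep_fun represents_iff by blast

lemma rep_fun_proj_graph: "antiperiodic f \<Longrightarrow> rep_fun (proj_graph f) = f"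
  by (rule rep_fun_eq) (simp add: represents_iff)

lemma pseudoline_proj_graph: "antiperiodic f \<Longrightarrow> pseudoline (proj_graph f)"
  using represents_iff pseudoline_def by blast

lemma mem_pseudoline: "pseudoline P \<Longrightarrow> mproj (x, y) \<in> P \<longleftrightarrow> y = rep_fun P x"
  by (metis mem_proj_graph antiperiodic_rep_fun proj_graph_rep_fun)

lemma represents_pseudoline_iff: "pseudoline P \<Longrightarrow> represents f P \<longleftrightarrow> f = rep_fun P"
  using represents_rep_fun rep_fun_eq by blast

lemma ex_mproj_graph_iff:
  assumes "antiperiodic f" "\<And>u u'. [u = u'] (rmod pi) \<Longrightarrow> R u \<longleftrightarrow> R u'"
  shows "(\<exists>u. mproj (x, y) = mproj (u, f u) \<and> R u) \<longleftrightarrow> y = f x \<and> R x"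
  unfolding mproj_eq_graph_iff[OF assms(1)] using assms(2) by blast

lemma crossing_point_iff:
  assumes "pseudoline P" "pseudoline Q"
  shows "crossing_point P Q (mproj (x, y)) \<longleftrightarrow> y = rep_fun P x \<and> crosses (rep_fun P) (rep_fun Q) x"
proof -
  note anti = antiperiodic_rep_fun[OF assms(1)] antiperiodic_rep_fun[OF assms(2)]
  have "crossing_point P Q p \<longleftrightarrow> (\<exists>u. p = mproj (u, rep_fun P u) \<and> crosses (rep_fun P) (rep_fun Q) u)"
      for p
    unfolding crossing_point_def crosses_def gap_product_def
    by (auto simp: represents_pseudoline_iff[OF assms(1)] represents_pseudoline_iff[OF assms(2)])
  then show ?thesis using ex_mproj_graph_iff[OF anti(1)] crosses_rcong[OF anti] by simp
qed

lemma contact_point_iff: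
  assumes "pseudoline P" "pseudoline Q"
  shows "contact_point P Q (mproj (x, y)) \<longleftrightarrow> y = rep_fun P x \<and> touches (rep_fun P) (rep_fun Q) x"
proof -
  note anti = antiperiodic_rep_fun[OF assms(1)] antiperiodic_rep_fun[OF assms(2)]
  have "contact_point P Q p \<longleftrightarrow> (\<exists>u. p = mproj (u, rep_fun P u) \<and> touches (rep_fun P) (rep_fun Q) u)" for p
    unfolding contact_point_def touches_def gap_product_def
    by (auto simp: represents_pseudoline_iff[OF assms(1)] represents_pseudoline_iff[OF assms(2)])
  then show ?thesis using ex_mproj_graph_iff[OF anti(1)] touches_rcong[OF anti] by simp
qed

lemma crossing_point_commute: "crossing_point P Q p \<longleftrightarrow> crossing_point Q P p"
proof -
  have "crossing_point P Q p \<longleftrightarrow> (\<exists>f g x. represents f P \<and> represents g Q \<and> p = mproj (x, f x) \<and>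
      crosses f g x)" for P Q
    unfolding crossing_point_def crosses_def gap_product_def ..
  then show ?thesis by (metis crosses_commute crosses_imp_eq)
qed

lemma wedge_commute: "wedge P Q = wedge Q P"
proof -
  have "crossing_point P Q = crossing_point Q P" by (intro ext crossing_point_commute)
  then show ?thesis by (simp only: wedge_def)
qed

lemma sparse_coincidences:
  assumes "pseudoline P" "pseudoline Q" "finite (P \<inter> Q)"
  shows "{t. rep_fun P t = rep_fun Q t} sparse_in UNIV"
proof (rule sparse_in_subset2)
  have orbit: "{t. mproj (t, rep_fun P t) = p} sparse_in UNIV" for p
    unfolding sparse_in_eventually_iff[OF open_UNIV]
  proof (intro ballI)
    fix x :: real
    have cong: "[t = t'] (rmod pi)"
      if "mproj (t, rep_fun P t) = p" "mproj (t', rep_fun P t') = p" for t t'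
      using that mproj_eq_graph_iff[OF antiperiodic_rep_fun[OF assms(1)]] by metis
    have near: "\<forall>\<^sub>F u in at x. dist u x < pi / 2"
      by (rule eventually_at_ball'[of "pi / 2" x UNIV, THEN eventually_mono]) (auto simp: dist_commute)
    show "\<forall>\<^sub>F t in at x. t \<notin> {t. mproj (t, rep_fun P t) = p}"
    proof (cases "\<exists>t. \<bar>t - x\<bar> < pi / 2 \<and> mproj (t, rep_fun P t) = p")
      case True
      then obtain t where t: "\<bar>t - x\<bar> < pi / 2" "mproj (t, rep_fun P t) = p" by blast
      from near eventually_neq_at_within[of t x UNIV] show ?thesis
      proof eventually_elim
        case (elim u)
        then have "\<bar>t - u\<bar> < \<bar>pi\<bar>" using t(1) by (auto simp: dist_real_def abs_if split: if_splits)
        then show ?case using cong[OF t(2), of u] rcong_imp_eq[of t u pi] elim by auto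
      qed
    next
      case False
      from near show ?thesis by eventually_elim (use False in \<open>auto simp: dist_real_def\<close>)
    qed
  qed
  show "(\<Union>p\<in>P \<inter> Q. {t. mproj (t, rep_fun P t) = p}) sparse_in UNIV"
    by (rule sparse_in_UN_finite[OF orbit assms(3)])
  show "{t. rep_fun P t = rep_fun Q t} \<subseteq> (\<Union>p\<in>P \<inter> Q. {t. mproj (t, rep_fun P t) = p})"
    using mem_pseudoline[OF assms(1)] mem_pseudoline[OF assms(2)] by auto
qed

section \<open>Families of curves\<close>

definition vertices :: "'i set \<Rightarrow> ('i \<Rightarrow> real \<Rightarrow> real) \<Rightarrow> (real \<times> real) set" where
  "vertices G g = {(x, y). \<exists>p\<in>G. \<exists>q\<in>G. p \<noteq> q \<and> g p x = y \<and> g q x = y}"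

definition crossings :: "'i set \<Rightarrow> ('i \<Rightarrow> real \<Rightarrow> real) \<Rightarrow> (real \<times> real) set" where
  "crossings G g = {(x, y). \<exists>p\<in>G. \<exists>q\<in>G. p \<noteq> q \<and> g p x = y \<and> crosses (g p) (g q) x}"

definition contacts :: "'i set \<Rightarrow> ('i \<Rightarrow> real \<Rightarrow> real) \<Rightarrow> (real \<times> real) set" where
  "contacts G g = {(x, y). \<exists>p\<in>G. \<exists>q\<in>G. p \<noteq> q \<and> g p x = y \<and> touches (g p) (g q) x}"

definition num_above :: "'i set \<Rightarrow> ('i \<Rightarrow> real \<Rightarrow> real) \<Rightarrow> real \<Rightarrow> real \<Rightarrow> nat" where
  "num_above G g x y = card {p \<in> G. y < g p x}"

definition num_below :: "'i set \<Rightarrow> ('i \<Rightarrow> real \<Rightarrow> real) \<Rightarrow> real \<Rightarrow> real \<Rightarrow> nat" where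
  "num_below G g x y = card {p \<in> G. g p x < y}"

lemma verticesI: "p \<in> G \<Longrightarrow> q \<in> G \<Longrightarrow> p \<noteq> q \<Longrightarrow> g p x = y \<Longrightarrow> g q x = y \<Longrightarrow> (x, y) \<in> vertices G g"
  unfolding vertices_def by blast

lemma verticesE:
  assumes "(x, y) \<in> vertices G g"
  obtains p q where "p \<in> G" "q \<in> G" "p \<noteq> q" "g p x = y" "g q x = y"
  using assms unfolding vertices_def by blast

lemma crossingsI: "p \<in> G \<Longrightarrow> q \<in> G \<Longrightarrow> p \<noteq> q \<Longrightarrow> crosses (g p) (g q) x \<Longrightarrow> (x, g p x) \<in> crossings G g"
  unfolding crossings_def by blast

lemma crossingsE:
  assumes "(x, y) \<in> crossings G g"
  obtains p q where "p \<in> G" "q \<in> G" "p \<noteq> q" "g p x = y" "g q x = y" "crosses (g p) (g q) x"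
  using assms unfolding crossings_def crosses_def by fastforce

lemma contactsI: "p \<in> G \<Longrightarrow> q \<in> G \<Longrightarrow> p \<noteq> q \<Longrightarrow> touches (g p) (g q) x \<Longrightarrow> (x, g p x) \<in> contacts G g"
  unfolding contacts_def by blast

lemma contactsE:
  assumes "(x, y) \<in> contacts G g"
  obtains p q where "p \<in> G" "q \<in> G" "p \<noteq> q" "g p x = y" "g q x = y" "touches (g p) (g q) x"
  using assms unfolding contacts_def touches_def by fastforce

lemma card_filter_add_card_filter_not:
  assumes "finite S" shows "card {s \<in> S. P s} + card {s \<in> S. \<not> P s} = card S"
proof -
  have "card ({s \<in> S. P s} \<union> {s \<in> S. \<not> P s}) = card {s \<in> S. P s} + card {s \<in> S. \<not> P s}"
    using assms by (intro card_Un_disjoint) auto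
  moreover have "{s \<in> S. P s} \<union> {s \<in> S. \<not> P s} = S" by auto
  ultimately show ?thesis by simp
qed

lemma above_add_through_add_below:
  assumes "finite G"
  shows "num_above G g x y + card {p \<in> G. g p x = y} + num_below G g x y = card G"
proof -
  have "card {p \<in> {p \<in> G. \<not> y < g p x}. g p x = y} + card {p \<in> {p \<in> G. \<not> y < g p x}. g p x \<noteq> y}
      = card {p \<in> G. \<not> y < g p x}"
    using assms by (intro card_filter_add_card_filter_not) simp
  moreover have "{p \<in> {p \<in> G. \<not> y < g p x}. g p x = y} = {p \<in> G. g p x = y}"
    "{p \<in> {p \<in> G. \<not> y < g p x}. g p x \<noteq> y} = {p \<in> G. g p x < y}" by auto
  ultimately show ?thesis
    using card_filter_add_card_filter_not[OF assms, of "\<lambda>p. y < g p x"]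
    by (simp add: num_above_def num_below_def)
qed

lemma connected_unique_choice:
  fixes h :: "'a::topological_space \<Rightarrow> 'b::t2_space" and f :: "'i \<Rightarrow> 'a \<Rightarrow> 'b"
  assumes fin: "finite I" and cont: "continuous_on UNIV h" "\<And>i. i \<in> I \<Longrightarrow> continuous_on UNIV (f i)"
    and S: "connected S" "S \<noteq> {}"
    and ex1: "\<And>t. t \<in> S \<Longrightarrow> \<exists>!i. i \<in> I \<and> h t = f i t"
  shows "\<exists>i\<in>I. \<forall>t\<in>S. h t = f i t"
proof -
  obtain u where u: "u \<in> S" using S(2) by blast
  then obtain i where i: "i \<in> I" "h u = f i u" using ex1 by blast
  define A where "A = {t. h t = f i t}"
  define B where "B = (\<Union>j\<in>I - {i}. {t. h t = f j t})"
  have "A \<inter> S = {} \<or> B \<inter> S = {}"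
  proof (rule connected_closedD[OF S(1)])
    show "closed A" "closed B" unfolding A_def B_def
      using cont i fin by (auto intro!: closed_UN closed_Collect_eq)
    show "S \<subseteq> A \<union> B" using ex1 unfolding A_def B_def by blast
    show "A \<inter> B \<inter> S = {}" using ex1 i(1) unfolding A_def B_def by blast
  qed
  then have "B \<inter> S = {}" using u i(2) by (auto simp: A_def)
  then have "h t = f i t" if "t \<in> S" for t using ex1[OF that] that by (auto simp: B_def)
  then show ?thesis using i(1) by blast
qed

locale curve_family =
  fixes G :: "'i set" and g :: "'i \<Rightarrow> real \<Rightarrow> real"
  assumes finite_index: "finite G"
    and antiperiodic: "p \<in> G \<Longrightarrow> antiperiodic (g p)"
    and sparse_meetings: "p \<in> G \<Longrightarrow> q \<in> G \<Longrightarrow> p \<noteq> q \<Longrightarrow> {t. g p t = g q t} sparse_in UNIV"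
    and crossing_unique:
      "p \<in> G \<Longrightarrow> q \<in> G \<Longrightarrow> p \<noteq> q \<Longrightarrow> crosses (g p) (g q) x \<Longrightarrow> crosses (g p) (g q) x' \<Longrightarrow> [x = x'] (rmod pi)"
    and no_triple_point:
      "p \<in> G \<Longrightarrow> q \<in> G \<Longrightarrow> r \<in> G \<Longrightarrow> p \<noteq> q \<Longrightarrow> p \<noteq> r \<Longrightarrow> q \<noteq> r \<Longrightarrow> g p x = g q x \<Longrightarrow> g p x \<noteq> g r x"
begin

lemma continuous: "p \<in> G \<Longrightarrow> continuous_on S (g p)"
  by (simp add: antiperiodic antiperiodic_continuous_on)

lemma sparse_fst_vertices: "fst ` vertices G g sparse_in UNIV"
proof -
  have "(\<Union>p\<in>G. \<Union>q\<in>G - {p}. {t. g p t = g q t}) sparse_in UNIV"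
    using finite_index sparse_meetings by (intro sparse_in_UN_finite) auto
  moreover have "fst ` vertices G g \<subseteq> (\<Union>p\<in>G. \<Union>q\<in>G - {p}. {t. g p t = g q t})"
    by (fastforce simp: vertices_def)
  ultimately show ?thesis by (rule sparse_in_subset2)
qed

lemma eventually_inj_on: "\<forall>\<^sub>F t in at x. inj_on (\<lambda>p. g p t) G"
proof -
  have "\<forall>\<^sub>F t in at x. t \<notin> fst ` vertices G g"
    using sparse_fst_vertices sparse_in_eventually_iff[OF open_UNIV] by blast
  then show ?thesis by eventually_elim (force simp: inj_on_def intro: verticesI)
qed

lemma
  assumes h: "continuous_on UNIV h"
  shows right_germ: "\<forall>\<^sub>F t in at_right x. \<exists>p\<in>G. h t = g p t \<Longrightarrow> \<exists>p\<in>G. \<forall>\<^sub>F t in at_right x. h t = g p t"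
    and left_germ: "\<forall>\<^sub>F t in at_left x. \<exists>p\<in>G. h t = g p t \<Longrightarrow> \<exists>p\<in>G. \<forall>\<^sub>F t in at_left x. h t = g p t"
proof -
  have choice: "\<exists>p\<in>G. \<forall>t\<in>S. h t = g p t"
    if S: "connected S" "S \<noteq> {}" and good: "\<forall>t\<in>S. (\<exists>p\<in>G. h t = g p t) \<and> inj_on (\<lambda>p. g p t) G" for S
  proof -
    have unique: "\<exists>!p. p \<in> G \<and> h t = g p t" if "t \<in> S" for t
    proof -
      obtain p where "p \<in> G" "h t = g p t" "inj_on (\<lambda>p. g p t) G" using good \<open>t \<in> S\<close> by blast
      then show ?thesis by (intro ex1I[of _ p]) (auto dest: inj_onD)
    qed
    show ?thesis by (rule connected_unique_choice[OF finite_index h continuous S unique])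
  qed
  { assume "\<forall>\<^sub>F t in at_right x. \<exists>p\<in>G. h t = g p t"
    then have "\<forall>\<^sub>F t in at_right x. (\<exists>p\<in>G. h t = g p t) \<and> inj_on (\<lambda>p. g p t) G"
      using eventually_inj_on by (simp add: eventually_conj eventually_at_split)
    then obtain b where "b > x" "\<forall>t\<in>{x<..<b}. (\<exists>p\<in>G. h t = g p t) \<and> inj_on (\<lambda>p. g p t) G"
      by (auto simp: eventually_at_right_field)
    then show "\<exists>p\<in>G. \<forall>\<^sub>F t in at_right x. h t = g p t"
      using choice[OF connected_Ioo[of x b]] dense
      by (fastforce simp: eventually_at_right_field) }
  { assume "\<forall>\<^sub>F t in at_left x. \<exists>p\<in>G. h t = g p t"
    then have "\<forall>\<^sub>F t in at_left x. (\<exists>p\<in>G. h t = g p t) \<and> inj_on (\<lambda>p. g p t) G"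
      using eventually_inj_on by (simp add: eventually_conj eventually_at_split)
    then obtain b where "b < x" "\<forall>t\<in>{b<..<x}. (\<exists>p\<in>G. h t = g p t) \<and> inj_on (\<lambda>p. g p t) G"
      by (auto simp: eventually_at_left_field)
    then show "\<exists>p\<in>G. \<forall>\<^sub>F t in at_left x. h t = g p t"
      using choice[OF connected_Ioo[of b x]] dense
      by (fastforce simp: eventually_at_left_field) }
qed

lemma germ_unique:
  assumes "p \<in> G" "q \<in> G" "at x within S \<noteq> bot" "\<forall>\<^sub>F t in at x within S. g p t = g q t"
  shows "p = q"
proof -
  have "\<forall>\<^sub>F t in at x within S. inj_on (\<lambda>p. g p t) G"
    by (rule filter_leD[OF at_le eventually_inj_on]) simp
  with assms(4) have "\<forall>\<^sub>F t in at x within S. p = q"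
    by eventually_elim (use assms(1,2) in \<open>auto dest: inj_onD\<close>)
  then show ?thesis using assms(3) by simp
qed

lemma crosses_iff_not_touches:
  assumes "p \<in> G" "q \<in> G" "p \<noteq> q" "g p x = g q x"
  shows "crosses (g p) (g q) x \<longleftrightarrow> \<not> touches (g p) (g q) x"
proof (rule continuous_crosses_iff_not_touches)
  show "\<forall>\<^sub>F t in at x. g p t \<noteq> g q t"
    using eventually_inj_on[of x] by eventually_elim (use assms(1-3) in \<open>auto dest: inj_onD\<close>)
qed (use assms continuous in auto)

lemma crossing_exists:
  assumes "p \<in> G" "q \<in> G" "p \<noteq> q" obtains x where "crosses (g p) (g q) x"
  using antiperiodic_crossing_exists[OF antiperiodic[OF assms(1)] antiperiodic[OF assms(2)]]
    sparse_meetings[OF assms] by blast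

lemma pair_through:
  assumes "p \<in> G" "q \<in> G" "p \<noteq> q" "g p x = y" "g q x = y" "r \<in> G" "g r x = y"
  shows "r = p \<or> r = q"
  using no_triple_point[of p q r x] assms by metis

lemma
  assumes pq: "p \<in> G" "q \<in> G" "p \<noteq> q" "g p x = y" "g q x = y"
  shows crossings_pair_iff: "(x, y) \<in> crossings G g \<longleftrightarrow> crosses (g p) (g q) x"
    and contacts_pair_iff: "(x, y) \<in> contacts G g \<longleftrightarrow> touches (g p) (g q) x"
proof -
  have pair: "r = p \<and> s = q \<or> r = q \<and> s = p"
    if "r \<in> G" "s \<in> G" "r \<noteq> s" "g r x = y" "g s x = y" for r s
    using pair_through[OF pq that(1,4)] pair_through[OF pq that(2,5)] that(3) by blast
  show "(x, y) \<in> crossings G g \<longleftrightarrow> crosses (g p) (g q) x"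
    using crossingsI[OF pq(1-3)] pq(4) by (metis crossingsE pair crosses_commute)
  show "(x, y) \<in> contacts G g \<longleftrightarrow> touches (g p) (g q) x"
    using contactsI[OF pq(1-3)] pq(4) by (metis contactsE pair touches_commute)
qed

lemma crossings_eq: "crossings G g = vertices G g - contacts G g"
proof (rule set_eqI)
  fix z :: "real \<times> real"
  obtain x y where z: "z = (x, y)" by fastforce
  show "z \<in> crossings G g \<longleftrightarrow> z \<in> vertices G g - contacts G g"
  proof (cases "z \<in> vertices G g")
    case True
    then obtain p q where pq: "p \<in> G" "q \<in> G" "p \<noteq> q" "g p x = y" "g q x = y"
      unfolding z by (rule verticesE)
    then show ?thesis
      using True crosses_iff_not_touches[OF pq(1-3)]
      by (simp add: z crossings_pair_iff[OF pq] contacts_pair_iff[OF pq])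
  qed (auto simp: z vertices_def elim!: crossingsE)
qed

lemma deck_mem_vertices_iff: "deck r z \<in> vertices G g \<longleftrightarrow> z \<in> vertices G g"
  and deck_mem_crossings_iff: "deck r z \<in> crossings G g \<longleftrightarrow> z \<in> crossings G g"
proof -
  obtain x y where z: "z = (x, y)" by fastforce
  have value_iff: "g p (x + of_int r * pi) = deck_sign r * y \<longleftrightarrow> g p x = y" if "p \<in> G" for p
    unfolding antiperiodic_shift[OF antiperiodic[OF that]] by simp
  have cross_iff: "crosses (g p) (g q) (x + of_int r * pi) \<longleftrightarrow> crosses (g p) (g q) x"
    if "p \<in> G" "q \<in> G" for p q
    by (rule crosses_rcong[OF antiperiodic antiperiodic, symmetric])
      (use that in \<open>auto simp: rcong_altdef\<close>)
  show "deck r z \<in> vertices G g \<longleftrightarrow> z \<in> vertices G g" "deck r z \<in> crossings G g \<longleftrightarrow> z \<in> crossings G g"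
    unfolding z deck_def vertices_def crossings_def by (auto simp: value_iff cross_iff)
qed

lemma
  assumes "S \<subseteq> G"
  shows num_above_shift: "num_above S g (x + of_int r * pi) (deck_sign r * y) =
      (if even r then num_above S g x y else num_below S g x y)"
    and num_below_shift: "num_below S g (x + of_int r * pi) (deck_sign r * y) =
      (if even r then num_below S g x y else num_above S g x y)"
proof -
  have shift: "g p (x + of_int r * pi) = deck_sign r * g p x" if "p \<in> S" for p
    using that assms by (intro antiperiodic_shift antiperiodic) auto
  show "num_above S g (x + of_int r * pi) (deck_sign r * y) =
      (if even r then num_above S g x y else num_below S g x y)"
    "num_below S g (x + of_int r * pi) (deck_sign r * y) =
      (if even r then num_below S g x y else num_above S g x y)"
    unfolding num_above_def num_below_def
    by (auto simp: shift deck_sign_def intro!: arg_cong[where f = card])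
qed

lemma card_through_le_2: "card {p \<in> G. g p x = y} \<le> 2"
proof (rule ccontr)
  assume "\<not> ?thesis"
  then have "3 \<le> card {p \<in> G. g p x = y}" by simp
  then obtain T where T: "T \<subseteq> {p \<in> G. g p x = y}" "card T = 3"
    by (rule obtain_subset_with_card_n)
  then obtain p q r where "T = {p, q, r}" "p \<noteq> q" "q \<noteq> r" "p \<noteq> r" by (auto simp: card_3_iff)
  then show False using T(1) no_triple_point[of p q r x] by auto
qed

lemma eventually_order_preserved:
  "\<forall>\<^sub>F z in nhds z0. \<forall>p\<in>G. (g p (fst z0) < snd z0 \<longrightarrow> g p (fst z) < snd z) \<and>
     (snd z0 < g p (fst z0) \<longrightarrow> snd z < g p (fst z))"
proof (intro eventually_ball_finite[OF finite_index] ballI eventually_conj)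
  fix p assume "p \<in> G"
  have "((\<lambda>z. g p (fst z)) \<longlongrightarrow> g p (fst z0)) (nhds z0)" "(snd \<longlongrightarrow> snd z0) (nhds z0)"
    by (intro isCont_tendsto_compose[OF antiperiodic_isCont[OF antiperiodic[OF \<open>p \<in> G\<close>]]]
        tendsto_intros filterlim_ident)+
  then have lim: "((\<lambda>z. g p (fst z) - snd z) \<longlongrightarrow> g p (fst z0) - snd z0) (nhds z0)"
    by (rule tendsto_diff)
  show "\<forall>\<^sub>F z in nhds z0. g p (fst z0) < snd z0 \<longrightarrow> g p (fst z) < snd z"
    using order_tendstoD(2)[OF lim, of 0] by (cases "g p (fst z0) < snd z0") auto
  show "\<forall>\<^sub>F z in nhds z0. snd z0 < g p (fst z0) \<longrightarrow> snd z < g p (fst z)"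
    using order_tendstoD(1)[OF lim, of 0] by (cases "snd z0 < g p (fst z0)") auto
qed

lemma eventually_order_preserved_along:
  assumes "antiperiodic h"
  shows "\<forall>\<^sub>F t in nhds x. \<forall>p\<in>G. (g p x < h x \<longrightarrow> g p t < h t) \<and> (h x < g p x \<longrightarrow> h t < g p t)"
proof -
  have "(h \<longlongrightarrow> h x) (nhds x)"
    using antiperiodic_isCont[OF assms, of x] by (simp add: continuous_at tendsto_at_iff_tendsto_nhds)
  then have "filterlim (\<lambda>t. (t, h t)) (nhds (x, h x)) (nhds x)"
    by (intro tendsto_Pair filterlim_ident)
  from eventually_compose_filterlim[OF eventually_order_preserved this] show ?thesis by simp
qed

lemma eventually_counts_near_vertex:
  assumes pq: "p \<in> G" "q \<in> G" "p \<noteq> q" "g p x = y" "g q x = y"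
  shows "\<forall>\<^sub>F t in nhds x. g q t < g p t \<longrightarrow> (\<forall>S\<subseteq>G.
    num_above S g t (g p t) = num_above S g x y \<and> num_above S g t (g q t) = num_above S g x y +
        of_bool (p \<in> S) \<and>
    num_below S g t (g p t) = num_below S g x y + of_bool (q \<in> S) \<and> num_below S g t (g q t) =
        num_below S g x y)"
  using eventually_order_preserved_along[OF antiperiodic[OF pq(1)], of x]
    eventually_order_preserved_along[OF antiperiodic[OF pq(2)], of x]
proof eventually_elim
  case (elim t)
  show ?case
  proof (intro impI allI)
    fix S assume gt: "g q t < g p t" and "S \<subseteq> G"
    have finS: "finite S" using \<open>S \<subseteq> G\<close> finite_index by (rule finite_subset)
    have order: "(g p t < g r t \<longleftrightarrow> y < g r x) \<and> (g q t < g r t \<longleftrightarrow> y < g r x \<or> r = p) \<and>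
        (g r t < g p t \<longleftrightarrow> g r x < y \<or> r = q) \<and> (g r t < g q t \<longleftrightarrow> g r x < y)" if "r \<in> S" for r
    proof (cases "r = p \<or> r = q")
      case False
      moreover have "r \<in> G" using that \<open>S \<subseteq> G\<close> by blast
      ultimately have "g r x < y \<or> y < g r x" using pair_through[OF pq, of r] by linarith
      then show ?thesis using elim \<open>r \<in> G\<close> False gt pq(4,5) by force
    qed (use gt pq in auto)
    have "{r \<in> S. g q t < g r t} = (if p \<in> S then {p} else {}) \<union> {r \<in> S. y < g r x}"
      "{r \<in> S. g r t < g p t} = (if q \<in> S then {q} else {}) \<union> {r \<in> S. g r x < y}"
      using order by (auto split: if_splits)
    then show "num_above S g t (g p t) = num_above S g x y \<and>
        num_above S g t (g q t) = num_above S g x y + of_bool (p \<in> S) \<and>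
        num_below S g t (g p t) = num_below S g x y + of_bool (q \<in> S) \<and> num_below S g t (g q t) =
            num_below S g x y"
      unfolding num_above_def num_below_def using order pq(4,5) finS
      by (auto intro!: arg_cong[where f = card])
  qed
qed

end

lemma curve_family_reindex:
  assumes "curve_family S h" "inj_on l I" "l ` I \<subseteq> S" "finite I" shows "curve_family I (\<lambda>i. h (l i))"
proof -
  interpret curve_family S h by (rule assms(1))
  have mem: "l i \<in> S" if "i \<in> I" for i using that assms(3) by blast
  have neq: "l i \<noteq> l j" if "i \<in> I" "j \<in> I" "i \<noteq> j" for i j using inj_onD[OF assms(2)] that by blast
  show ?thesis
  proof
    show "[x = x'] (rmod pi)"
      if "i \<in> I" "j \<in> I" "i \<noteq> j" "crosses (h (l i)) (h (l j)) x" "crosses (h (l i)) (h (l j)) x'"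
        for i j x x'
      using crossing_unique[OF mem mem neq] that by blast
    show "h (l p) x \<noteq> h (l r) x"
      if "p \<in> I" "q \<in> I" "r \<in> I" "p \<noteq> q" "p \<noteq> r" "q \<noteq> r" "h (l p) x = h (l q) x" for p q r x
      using no_triple_point[OF mem mem mem neq neq neq] that by blast
  qed (use assms(4) mem neq antiperiodic sparse_meetings in auto)
qed

section \<open>Arrangements as families of curves\<close>

definition arrangement_of :: "'i set \<Rightarrow> ('i \<Rightarrow> real \<Rightarrow> real) \<Rightarrow> moebius set set" where
  "arrangement_of G g = (\<lambda>p. proj_graph (g p)) ` G"

context curve_family
begin

lemma inj_on_proj_graph: "inj_on (\<lambda>p. proj_graph (g p)) G"
proof (rule inj_onI)
  fix p q assume pq: "p \<in> G" "q \<in> G" and "proj_graph (g p) = proj_graph (g q)"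
  then have "g p = g q" using rep_fun_proj_graph antiperiodic by metis
  moreover obtain t where "inj_on (\<lambda>p. g p t) G"
    using eventually_happens'[OF at_neq_bot eventually_inj_on] by blast
  ultimately show "p = q" using inj_onD[of "\<lambda>p. g p t" G p q] pq by simp
qed

lemma pseudoline_curve: "p \<in> G \<Longrightarrow> pseudoline (proj_graph (g p))"
  by (simp add: antiperiodic pseudoline_proj_graph)

lemma mem_curve_iff: "p \<in> G \<Longrightarrow> mproj (x, y) \<in> proj_graph (g p) \<longleftrightarrow> y = g p x"
  by (simp add: antiperiodic mem_proj_graph)

lemma crossing_point_curves_iff:
  "p \<in> G \<Longrightarrow> q \<in> G \<Longrightarrow> crossing_point (proj_graph (g p)) (proj_graph (g q)) (mproj (x, y)) \<longleftrightarrow>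
     y = g p x \<and> crosses (g p) (g q) x"
  by (simp add: crossing_point_iff pseudoline_curve rep_fun_proj_graph antiperiodic)

lemma contact_point_curves_iff:
  "p \<in> G \<Longrightarrow> q \<in> G \<Longrightarrow> contact_point (proj_graph (g p)) (proj_graph (g q)) (mproj (x, y)) \<longleftrightarrow>
     y = g p x \<and> touches (g p) (g q) x"
  by (simp add: contact_point_iff pseudoline_curve rep_fun_proj_graph antiperiodic)

lemma ex_distinct_curves_iff:
  "(\<exists>P\<in>arrangement_of G g. \<exists>Q\<in>arrangement_of G g. P \<noteq> Q \<and> R P Q) \<longleftrightarrow>
   (\<exists>p\<in>G. \<exists>q\<in>G. p \<noteq> q \<and> R (proj_graph (g p)) (proj_graph (g q)))"
  by (simp add: arrangement_of_def inj_on_eq_iff[OF inj_on_proj_graph] cong: bex_cong_simp)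

lemma mem_crossing_points_iff: "mproj z \<in> crossing_points (arrangement_of G g) \<longleftrightarrow> z \<in> crossings G g"
  unfolding crossing_points_def mem_Collect_eq ex_distinct_curves_iff crossings_def
  by (cases z) (auto simp: crossing_point_curves_iff)

lemma mem_contact_points_iff: "mproj z \<in> contact_points (arrangement_of G g) \<longleftrightarrow> z \<in> contacts G g"
  unfolding contact_points_def mem_Collect_eq ex_distinct_curves_iff contacts_def
  by (cases z) (auto simp: contact_point_curves_iff)

lemma mem_intersection_points_iff:
  "mproj z \<in> intersection_points (arrangement_of G g) \<longleftrightarrow> z \<in> vertices G g"
  unfolding intersection_points_def mem_Collect_eq ex_distinct_curves_iff vertices_def
  by (cases z) (simp add: mem_curve_iff, metis)

lemma mem_support_iff: "mproj (x, y) \<in> support (arrangement_of G g) \<longleftrightarrow> (\<exists>p\<in>G. g p x = y)"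
  unfolding support_def arrangement_of_def by (auto simp: mem_curve_iff)

lemma finite_curve_Int:
  assumes "p \<in> G" "q \<in> G" "p \<noteq> q"
  shows "finite (proj_graph (g p) \<inter> proj_graph (g q))"
proof (rule finite_subset)
  show "finite ((\<lambda>t. mproj (t, g p t)) ` ({0..pi} \<inter> {t. g p t = g q t}))"
    by (intro finite_imageI sparse_in_compact_finite sparse_in_subset[OF sparse_meetings[OF assms]]) auto
  show "proj_graph (g p) \<inter> proj_graph (g q) \<subseteq> (\<lambda>t. mproj (t, g p t)) ` ({0..pi} \<inter> {t. g p t = g q t})"
  proof
    fix z assume z: "z \<in> proj_graph (g p) \<inter> proj_graph (g q)"
    obtain x y where xy: "z = mproj (x, y)" by (rule mproj_cases)
    then have y: "y = g p x" "y = g q x" using z assms mem_curve_iff by auto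
    obtain x0 where x0: "[x = x0] (rmod pi)" "0 \<le> x0" "x0 < 0 + pi"
      using rcong_representative[OF pi_gt_zero] .
    have "g p x0 = g q x0"
      using antiperiodic_eq_rcong[OF antiperiodic[OF assms(1)] antiperiodic[OF assms(2)] x0(1)] y by simp
    moreover have "z = mproj (x0, g p x0)"
      unfolding xy mproj_eq_graph_iff[OF antiperiodic[OF assms(1)]] using rcong_sym[OF x0(1)] y by simp
    ultimately show "z \<in> (\<lambda>t. mproj (t, g p t)) ` ({0..pi} \<inter> {t. g p t = g q t})" using x0 by auto
  qed
qed

lemma ex1_crossing_point:
  assumes "p \<in> G" "q \<in> G" "p \<noteq> q"
  shows "\<exists>!z. crossing_point (proj_graph (g p)) (proj_graph (g q)) z"
proof -
  obtain x where x: "crosses (g p) (g q) x" using crossing_exists[OF assms] .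
  show ?thesis
  proof (rule ex1I[of _ "mproj (x, g p x)"])
    show "crossing_point (proj_graph (g p)) (proj_graph (g q)) (mproj (x, g p x))"
      using x crossing_point_curves_iff[OF assms(1,2)] by simp
    fix z assume z: "crossing_point (proj_graph (g p)) (proj_graph (g q)) z"
    obtain x' y' where xy: "z = mproj (x', y')" by (rule mproj_cases)
    then have "y' = g p x'" "crosses (g p) (g q) x'"
      using z crossing_point_curves_iff[OF assms(1,2)] by auto
    then show "z = mproj (x, g p x)"
      unfolding xy mproj_eq_graph_iff[OF antiperiodic[OF assms(1)]]
      using crossing_unique[OF assms x] by simp
  qed
qed

theorem simple_arrangement_of: "simple_arrangement (arrangement_of G g)"
  unfolding simple_arrangement_def arrangement_def
proof (intro conjI ballI impI)
  show "finite (arrangement_of G g)" by (simp add: arrangement_of_def finite_index)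
  show "pseudoline P" if "P \<in> arrangement_of G g" for P
    using that pseudoline_curve by (auto simp: arrangement_of_def)
next
  fix P Q assume "P \<in> arrangement_of G g" "Q \<in> arrangement_of G g" "P \<noteq> Q"
  then obtain p q where pq: "p \<in> G" "q \<in> G" "p \<noteq> q" "P = proj_graph (g p)" "Q = proj_graph (g q)"
    by (auto simp: arrangement_of_def)
  show "finite (P \<inter> Q)" "\<exists>!z. crossing_point P Q z"
    using finite_curve_Int[OF pq(1-3)] ex1_crossing_point[OF pq(1-3)] pq(4,5) by simp_all
next
  fix P Q R assume "P \<in> arrangement_of G g" "Q \<in> arrangement_of G g" "R \<in> arrangement_of G g"
    "P \<noteq> Q \<and> P \<noteq> R \<and> Q \<noteq> R"
  then obtain p q r where pqr: "p \<in> G" "q \<in> G" "r \<in> G" "p \<noteq> q" "p \<noteq> r" "q \<noteq> r"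
    "P = proj_graph (g p)" "Q = proj_graph (g q)" "R = proj_graph (g r)"
    by (auto simp: arrangement_of_def)
  show "P \<inter> Q \<inter> R = {}"
  proof (rule equals0I)
    fix z assume "z \<in> P \<inter> Q \<inter> R"
    moreover obtain x y where "z = mproj (x, y)" by (rule mproj_cases)
    ultimately show False using no_triple_point[OF pqr(1-6), of x] pqr mem_curve_iff by auto
  qed
qed

end

lemma arrangement_of_rep_fun: assumes "arrangement S" shows "arrangement_of S rep_fun = S"
proof -
  have "proj_graph (rep_fun P) = P" if "P \<in> S" for P
    using assms that by (simp add: arrangement_def proj_graph_rep_fun)
  then show ?thesis by (simp add: arrangement_of_def)
qed

theorem curve_family_rep_fun: assumes "simple_arrangement S" shows "curve_family S rep_fun"
proof
  have arr: "arrangement S" and pseudoline: "\<And>P. P \<in> S \<Longrightarrow> pseudoline P"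
    using assms by (auto simp: simple_arrangement_def arrangement_def)
  then show "finite S" "\<And>P. P \<in> S \<Longrightarrow> antiperiodic (rep_fun P)"
    by (auto simp: arrangement_def antiperiodic_rep_fun)
  show "{t. rep_fun P t = rep_fun Q t} sparse_in UNIV" if "P \<in> S" "Q \<in> S" "P \<noteq> Q" for P Q
    using arr that pseudoline by (intro sparse_coincidences) (auto simp: arrangement_def)
  show "[x = x'] (rmod pi)"
    if PQ: "P \<in> S" "Q \<in> S" "P \<noteq> Q"
        and c: "crosses (rep_fun P) (rep_fun Q) x" "crosses (rep_fun P) (rep_fun Q) x'"
    for P Q x x'
  proof -
    have "crossing_point P Q (mproj (x, rep_fun P x))" "crossing_point P Q (mproj (x', rep_fun P x'))"
      using crossing_point_iff[OF pseudoline[OF PQ(1)] pseudoline[OF PQ(2)]] c by blast+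
    moreover have "\<exists>!z. crossing_point P Q z" using arr PQ unfolding arrangement_def by blast
    ultimately have "mproj (x', rep_fun P x') = mproj (x, rep_fun P x)" by blast
    then show ?thesis using mproj_eq_graph_iff[OF antiperiodic_rep_fun[OF pseudoline[OF PQ(1)]]] by blast
  qed
  show "rep_fun P x \<noteq> rep_fun R x"
    if "P \<in> S" "Q \<in> S" "R \<in> S" "P \<noteq> Q" "P \<noteq> R" "Q \<noteq> R" "rep_fun P x = rep_fun Q x" for P Q R x
  proof
    assume "rep_fun P x = rep_fun R x"
    then have "mproj (x, rep_fun P x) \<in> P \<inter> Q \<inter> R" using that pseudoline by (simp add: mem_pseudoline)
    then show False using assms that unfolding simple_arrangement_def by blast
  qed
qed

section \<open>Kernels as sets of middle levels\<close>

lemma openI_eventually: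
  assumes "\<And>z. z \<in> S \<Longrightarrow> \<forall>\<^sub>F w in nhds z. w \<in> S" shows "open S"
proof (subst open_subopen, intro ballI)
  fix z assume "z \<in> S"
  from assms[OF this] obtain T where "open T" "z \<in> T" "\<forall>w\<in>T. w \<in> S"
    by (auto simp: eventually_nhds)
  then show "\<exists>T. open T \<and> z \<in> T \<and> T \<subseteq> S" by (intro exI[of _ T]) auto
qed

lemma clopen_connected_component:
  assumes "connected C" "C \<noteq> {}" "C \<subseteq> S" "open C" "open (S - C)"
  shows "C \<in> components S"
  unfolding in_components_maximal
proof (intro conjI allI impI)
  fix d assume d: "d \<noteq> {} \<and> C \<subseteq> d \<and> d \<subseteq> S \<and> connected d"
  then have "C \<inter> d = {} \<or> (S - C) \<inter> d = {}"
    using connectedD[of d C "S - C"] assms by blast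
  then show "d = C" using d assms by blast
qed (use assms in auto)

lemma
  shows closed_strip: "closed (mproj ` {z. \<bar>snd z\<bar> \<le> M})"
    and compact_strip: "compact (mproj ` {z. \<bar>snd z\<bar> \<le> M})"
proof -
  have "mproj -` mproj ` {z. \<bar>snd z\<bar> \<le> M} = {z. \<bar>snd z\<bar> \<le> M}"
    by (rule vimage_mproj_image_invariant) (simp add: deck_def)
  then show "closed (mproj ` {z. \<bar>snd z\<bar> \<le> M})"
    unfolding closed_moebius_iff by (simp add: closed_Collect_le continuous_intros)
  have "mproj ` {z. \<bar>snd z\<bar> \<le> M} = mproj ` ({0..pi} \<times> {-M..M})"
  proof
    show "mproj ` {z. \<bar>snd z\<bar> \<le> M} \<subseteq> mproj ` ({0..pi} \<times> {-M..M})"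
    proof
      fix p assume "p \<in> mproj ` {z. \<bar>snd z\<bar> \<le> M}"
      then obtain x y where p: "p = mproj (x, y)" "\<bar>y\<bar> \<le> M" by auto
      obtain x0 where "[x = x0] (rmod pi)" "0 \<le> x0" "x0 < 0 + pi"
        using rcong_representative[OF pi_gt_zero] .
      moreover from this(1) obtain r where "x0 = x + of_int r * pi" by (auto simp: rcong_altdef)
      ultimately have "deck r (x, y) \<in> {0..pi} \<times> {-M..M}"
        using p(2) by (auto simp: deck_def deck_sign_def abs_le_iff)
      then show "p \<in> mproj ` ({0..pi} \<times> {-M..M})" unfolding p by (metis mproj_deck imageI)
    qed
    show "mproj ` ({0..pi} \<times> {-M..M}) \<subseteq> mproj ` {z. \<bar>snd z\<bar> \<le> M}" by (intro image_mono) auto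
  qed
  moreover have "compact (mproj ` ({0..pi} \<times> {-M..M}))"
    by (intro compact_continuous_image continuous_on_subset[OF continuous_mproj] compact_Times) auto
  ultimately show "compact (mproj ` {z. \<bar>snd z\<bar> \<le> M})" by simp
qed

lemma compact_moebius_bounded:
  assumes "compact C" shows "\<exists>M. \<forall>x y. mproj (x, y) \<in> C \<longrightarrow> \<bar>y\<bar> \<le> M"
proof -
  define U where "U r = mproj ` {z. \<bar>snd z\<bar> < real r}" for r :: nat
  have U: "mproj z \<in> U r \<longleftrightarrow> z \<in> {z. \<bar>snd z\<bar> < real r}" for z r
    unfolding U_def by (rule mproj_mem_image_iff) (simp add: deck_def)
  have "C \<subseteq> (\<Union>r\<in>UNIV. U r)"
  proof
    fix p
    obtain x y where "p = mproj (x, y)" by (rule mproj_cases)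
    moreover obtain r :: nat where "\<bar>y\<bar> < real r" using reals_Archimedean2 by blast
    ultimately show "p \<in> (\<Union>r\<in>UNIV. U r)" using U by auto
  qed
  moreover have "open (U r)" for r unfolding U_def
    by (intro open_mproj_image open_Collect_less continuous_intros)
  ultimately obtain D where D: "finite D" "C \<subseteq> (\<Union>r\<in>D. U r)"
    using compactE_image[OF assms] by metis
  have "\<bar>y\<bar> \<le> real (Max D)" if mem: "mproj (x, y) \<in> C" for x y
  proof -
    obtain r where "r \<in> D" "\<bar>y\<bar> < real r" using mem D(2) U by fastforce
    moreover have "r \<le> Max D" using D(1) \<open>r \<in> D\<close> by simp
    ultimately show ?thesis by linarith
  qed
  then show ?thesis by blast
qed

lemma compact_closure_moebius_iff:
  "compact (closure C) \<longleftrightarrow> (\<exists>M. \<forall>x y. mproj (x, y) \<in> C \<longrightarrow> \<bar>y\<bar> \<le> M)"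
proof
  assume "compact (closure C)"
  then show "\<exists>M. \<forall>x y. mproj (x, y) \<in> C \<longrightarrow> \<bar>y\<bar> \<le> M"
    using compact_moebius_bounded closure_subset[of C] by (meson subsetD)
next
  assume "\<exists>M. \<forall>x y. mproj (x, y) \<in> C \<longrightarrow> \<bar>y\<bar> \<le> M"
  then obtain M where M: "\<And>x y. mproj (x, y) \<in> C \<Longrightarrow> \<bar>y\<bar> \<le> M" by blast
  have "C \<subseteq> mproj ` {z. \<bar>snd z\<bar> \<le> M}"
  proof
    fix p assume "p \<in> C"
    moreover obtain x y where "p = mproj (x, y)" by (rule mproj_cases)
    ultimately show "p \<in> mproj ` {z. \<bar>snd z\<bar> \<le> M}" using M[of x y] by auto
  qed
  then have "closure C \<subseteq> mproj ` {z. \<bar>snd z\<bar> \<le> M}" using closed_strip by (rule closure_minimal)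
  then show "compact (closure C)"
    using compact_Int_closed[OF compact_strip closed_closure, of M C] by (simp add: Int_absorb1)
qed

text \<open>If \<open>card G = 2 * k\<close>, the last two conditions alone hold at the vertices where the two middle
  levels meet, although the kernel is empty.\<close>

definition middle_levels :: "nat \<Rightarrow> 'i set \<Rightarrow> ('i \<Rightarrow> real \<Rightarrow> real) \<Rightarrow> (real \<times> real) set" where
  "middle_levels k G g = {(x, y). 2 * k < card G \<and> (\<exists>p\<in>G. g p x = y) \<and>
     num_above G g x y + k < card G \<and> num_below G g x y + k < card G}"

context curve_family
begin

definition upper_exterior :: "nat \<Rightarrow> (real \<times> real) set" where
  "upper_exterior k = {(x, y). card G \<le> num_below G g x y + k}"

definition exterior :: "nat \<Rightarrow> (real \<times> real) set" where
  "exterior k = {(x, y). card G \<le> num_below G g x y + k \<or> card G \<le> num_above G g x y + k}"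

lemma card_through_pos_iff: "0 < card {p \<in> G. g p x = y} \<longleftrightarrow> (\<exists>p\<in>G. g p x = y)"
  using finite_index by (auto simp: card_gt_0_iff)

lemma eventually_counts_ge:
  "\<forall>\<^sub>F z in nhds z0. num_above G g (fst z0) (snd z0) \<le> num_above G g (fst z) (snd z) \<and>
     num_below G g (fst z0) (snd z0) \<le> num_below G g (fst z) (snd z) \<and>
     ((\<exists>p\<in>G. g p (fst z) = snd z) \<longrightarrow> (\<exists>p\<in>G. g p (fst z0) = snd z0))"
  using eventually_order_preserved[of z0]
proof eventually_elim
  case (elim z)
  have "num_above G g (fst z0) (snd z0) \<le> num_above G g (fst z) (snd z)"
    "num_below G g (fst z0) (snd z0) \<le> num_below G g (fst z) (snd z)"
    unfolding num_above_def num_below_def using elim finite_index by (auto intro!: card_mono)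
  moreover have "(\<exists>p\<in>G. g p (fst z) = snd z) \<longrightarrow> (\<exists>p\<in>G. g p (fst z0) = snd z0)"
    using elim by (metis less_irrefl linorder_neqE)
  ultimately show ?case by simp
qed

lemma deck_mem_exterior: "z \<in> exterior k \<Longrightarrow> deck r z \<in> exterior k"
  by (cases z) (auto simp: exterior_def deck_def num_above_shift[OF subset_refl]
    num_below_shift[OF subset_refl])

lemma deck_mem_middle_levels: "z \<in> middle_levels k G g \<Longrightarrow> deck r z \<in> middle_levels k G g"
proof -
  assume "z \<in> middle_levels k G g"
  moreover have "g p (x + of_int r * pi) = deck_sign r * g p x" if "p \<in> G" for p x
    by (rule antiperiodic_shift[OF antiperiodic[OF that]])
  ultimately show ?thesis
    by (cases z) (fastforce simp: middle_levels_def deck_def num_above_shift[OF subset_refl]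
      num_below_shift[OF subset_refl])
qed

lemmas vimage_exterior = vimage_mproj_image_invariant[OF deck_mem_exterior]
  and vimage_middle_levels = vimage_mproj_image_invariant[OF deck_mem_middle_levels]

lemma open_exterior: "open (exterior k)"
proof (rule openI_eventually)
  fix z assume "z \<in> exterior k"
  then show "\<forall>\<^sub>F w in nhds z. w \<in> exterior k"
    using eventually_mono[OF eventually_counts_ge[of z], of "\<lambda>w. w \<in> exterior k"]
    by (fastforce simp: exterior_def)
qed

lemma curves_bounded: obtains M where "M > 0" "\<And>p x. p \<in> G \<Longrightarrow> \<bar>g p x\<bar> < M"
proof -
  have "\<forall>p\<in>G. \<exists>M. \<forall>x. \<bar>g p x\<bar> \<le> M" by (meson antiperiodic antiperiodic_bounded)
  then obtain B where B: "\<And>p x. p \<in> G \<Longrightarrow> \<bar>g p x\<bar> \<le> B p" by metis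
  show thesis
  proof
    show "Max (insert 0 (B ` G)) + 1 > 0" using finite_index by (simp add: add_nonneg_pos)
    fix p x assume "p \<in> G"
    then have "B p \<le> Max (insert 0 (B ` G))" using finite_index by (intro Max_ge) auto
    then show "\<bar>g p x\<bar> < Max (insert 0 (B ` G)) + 1" using B[OF \<open>p \<in> G\<close>, of x] by linarith
  qed
qed

lemma upper_exterior_if_all_below:
  assumes "\<And>p. p \<in> G \<Longrightarrow> g p x < y" shows "(x, y) \<in> upper_exterior k"
proof -
  have "{p \<in> G. g p x < y} = G" using assms by blast
  then show ?thesis by (simp add: upper_exterior_def num_below_def)
qed

lemma upper_exterior_mono: "(x, y) \<in> upper_exterior k \<Longrightarrow> y \<le> y' \<Longrightarrow> (x, y') \<in> upper_exterior k"
proof -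
  assume "(x, y) \<in> upper_exterior k" "y \<le> y'"
  moreover have "num_below G g x y \<le> num_below G g x y'"
    unfolding num_below_def using finite_index \<open>y \<le> y'\<close> by (intro card_mono) auto
  ultimately show ?thesis by (simp add: upper_exterior_def)
qed

lemma mproj_exterior: "mproj ` exterior k = mproj ` upper_exterior k"
proof -
  have "mproj (x, y) \<in> mproj ` upper_exterior k" if "card G \<le> num_above G g x y + k" for x y
  proof -
    have "deck 1 (x, y) \<in> upper_exterior k"
      using that num_below_shift[OF subset_refl, of x 1 y] by (simp add: upper_exterior_def deck_def)
    then show ?thesis by (metis mproj_deck imageI)
  qed
  then show ?thesis by (auto simp: exterior_def upper_exterior_def)
qed

lemma connected_upper_exterior: "connected (upper_exterior k)"
proof -
  obtain M where M: "M > 0" "\<And>p x. p \<in> G \<Longrightarrow> \<bar>g p x\<bar> < M" using curves_bounded by blast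
  define T where "T z = ({fst z} \<times> {snd z..}) \<union> (UNIV \<times> {M..})" for z :: "real \<times> real"
  have "T z \<subseteq> upper_exterior k" if "z \<in> upper_exterior k" for z
  proof -
    have "g p x < y" if "p \<in> G" "M \<le> y" for p x y using M(2)[OF that(1), of x] that(2) by linarith
    then have "UNIV \<times> {M..} \<subseteq> upper_exterior k" by (auto intro: upper_exterior_if_all_below)
    moreover have "{fst z} \<times> {snd z..} \<subseteq> upper_exterior k"
      using upper_exterior_mono[of "fst z" "snd z"] that by auto
    ultimately show ?thesis by (simp add: T_def)
  qed
  moreover have "z \<in> T z" for z by (cases z) (simp add: T_def)
  ultimately have "upper_exterior k = \<Union> (T ` upper_exterior k)" by blast
  moreover have "connected (\<Union> (T ` upper_exterior k))"
  proof (rule connected_Union)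
    fix S assume "S \<in> T ` upper_exterior k"
    then obtain z where "S = T z" by blast
    moreover have "(fst z, max M (snd z)) \<in> ({fst z} \<times> {snd z..}) \<inter> (UNIV \<times> {M..})" by simp
    then have "({fst z} \<times> {snd z..}) \<inter> (UNIV \<times> {M..}) \<noteq> {}" by blast
    then have "connected (T z)" unfolding T_def
      by (intro connected_Un connected_Times) auto
    ultimately show "connected S" by simp
  next
    have "(0, M) \<in> \<Inter> (T ` upper_exterior k)" by (auto simp: T_def)
    then show "\<Inter> (T ` upper_exterior k) \<noteq> {}" by blast
  qed
  ultimately show ?thesis by simp
qed

lemma exterior_if_large:
  obtains M where "M > 0" "\<And>x y. M \<le> \<bar>y\<bar> \<Longrightarrow> (x, y) \<in> exterior k"
proof -
  obtain M where M: "M > 0" "\<And>p x. p \<in> G \<Longrightarrow> \<bar>g p x\<bar> < M" using curves_bounded by blast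
  have "(x, y) \<in> exterior k" if "M \<le> \<bar>y\<bar>" for x y
  proof -
    have "{p \<in> G. g p x < y} = G \<or> {p \<in> G. y < g p x} = G"
      using M(2)[of _ x] that by (cases "y \<ge> 0") force+
    then show ?thesis by (auto simp: exterior_def num_above_def num_below_def)
  qed
  then show thesis using that M(1) by blast
qed

lemma open_complement_middle_levels_exterior:
  assumes "2 * k < card G"
  shows "open (- middle_levels k G g - exterior k)"
proof (rule openI_eventually)
  fix z assume z: "z \<in> - middle_levels k G g - exterior k"
  then have off: "\<not> (\<exists>p\<in>G. g p (fst z) = snd z)"
    and lt: "num_above G g (fst z) (snd z) + k < card G" "num_below G g (fst z) (snd z) + k < card G"
    using assms by (auto simp: middle_levels_def exterior_def split: prod.splits)
  have total: "num_above G g (fst z) (snd z) + num_below G g (fst z) (snd z) = card G"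
    using above_add_through_add_below[OF finite_index, of g "fst z" "snd z"]
      card_through_pos_iff[of "fst z" "snd z"] off by simp
  show "\<forall>\<^sub>F w in nhds z. w \<in> - middle_levels k G g - exterior k"
    using eventually_counts_ge[of z]
  proof eventually_elim
    case (elim w)
    then show ?case
      using off lt total above_add_through_add_below[OF finite_index, of g "fst w" "snd w"]
      by (auto simp: middle_levels_def exterior_def split: prod.splits)
  qed
qed

lemma exterior_mem_components:
  assumes "2 * k < card G"
  shows "mproj ` exterior k \<in> components (- mproj ` middle_levels k G g)"
proof (rule clopen_connected_component)
  show "connected (mproj ` exterior k)" unfolding mproj_exterior
    by (intro connected_continuous_image continuous_on_subset[OF continuous_mproj]
      connected_upper_exterior) simp
  show "mproj ` exterior k \<noteq> {}"
    using exterior_if_large[of k] by (metis abs_ge_self empty_iff image_is_empty)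
  show "open (mproj ` exterior k)" by (intro open_mproj_image open_exterior)
  show "mproj ` exterior k \<subseteq> - mproj ` middle_levels k G g"
  proof (rule image_subsetI)
    fix z assume "z \<in> exterior k"
    then have "z \<notin> middle_levels k G g" by (auto simp: exterior_def middle_levels_def)
    then show "mproj z \<in> - mproj ` middle_levels k G g"
      by (simp only: mproj_mem_image_iff[OF deck_mem_middle_levels] Compl_iff not_False_eq_True)
  qed
  show "open (- mproj ` middle_levels k G g - mproj ` exterior k)"
    using open_complement_middle_levels_exterior[OF assms]
    by (simp add: open_moebius_def vimage_Diff vimage_Compl vimage_exterior vimage_middle_levels)
qed

lemma external_face_middle_levels:
  assumes "2 * k < card G"
  shows "external_face (mproj ` middle_levels k G g) = mproj ` exterior k"
proof -
  let ?K = "mproj ` middle_levels k G g"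
  obtain M where M: "M > 0" "\<And>x y. M \<le> \<bar>y\<bar> \<Longrightarrow> (x, y) \<in> exterior k" using exterior_if_large by blast
  note comp = exterior_mem_components[OF assms]
  have unbounded: "\<not> compact (closure (mproj ` exterior k))"
  proof
    assume "compact (closure (mproj ` exterior k))"
    then obtain B where B: "\<And>x y. mproj (x, y) \<in> mproj ` exterior k \<Longrightarrow> \<bar>y\<bar> \<le> B"
      unfolding compact_closure_moebius_iff by blast
    have "(0, max M (B + 1)) \<in> exterior k" using M by auto
    then show False using B by fastforce
  qed
  have bounded: "compact (closure C)" if "C \<in> components (- ?K)" "C \<noteq> mproj ` exterior k" for C
  proof -
    have "C \<inter> mproj ` exterior k = {}" using components_nonoverlap[OF that(1) comp] that(2) by simp
    then have "\<bar>y\<bar> \<le> M" if "mproj (x, y) \<in> C" for x y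
      using M(2)[of y x] that by (metis IntI empty_iff imageI linear)
    then show ?thesis unfolding compact_closure_moebius_iff by blast
  qed
  have "{C \<in> components (- ?K). \<not> compact (closure C)} = {mproj ` exterior k}"
    using comp unbounded bounded by auto
  then show ?thesis by (simp add: external_face_def)
qed

lemma closure_exterior_iff:
  assumes "(x, y) \<in> middle_levels k G g"
  shows "(x, y) \<in> closure (exterior k) \<longleftrightarrow> num_above G g x y \<le> k \<or> num_below G g x y \<le> k"
proof
  assume closure: "(x, y) \<in> closure (exterior k)"
  show "num_above G g x y \<le> k \<or> num_below G g x y \<le> k"
  proof (rule ccontr)
    assume gt: "\<not> ?thesis"
    have "\<forall>\<^sub>F w in nhds (x, y). w \<notin> exterior k"
      using eventually_counts_ge[of "(x, y)"]
    proof eventually_elim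
      case (elim w)
      then show ?case
        using gt above_add_through_add_below[OF finite_index, of g "fst w" "snd w"]
        by (auto simp: exterior_def split: prod.splits)
    qed
    then obtain U where "open U" "(x, y) \<in> U" "U \<inter> exterior k = {}" by (auto simp: eventually_nhds)
    then show False using closure open_Int_closure_eq_empty[of U "exterior k"] by auto
  qed
next
  assume le: "num_above G g x y \<le> k \<or> num_below G g x y \<le> k"
  show "(x, y) \<in> closure (exterior k)"
    unfolding closure_approachable
  proof (intro allI impI)
    fix e :: real assume "e > 0"
    have "card {p \<in> G. \<not> y < g p x} \<le> num_below G g x (y + e/2)"
      "card {p \<in> G. \<not> g p x < y} \<le> num_above G g x (y - e/2)"
      unfolding num_above_def num_below_def using \<open>e > 0\<close> finite_index by (auto intro!: card_mono)
    then have "(x, y + e/2) \<in> exterior k \<or> (x, y - e/2) \<in> exterior k"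
      using le card_filter_add_card_filter_not[OF finite_index, of "\<lambda>p. y < g p x"]
        card_filter_add_card_filter_not[OF finite_index, of "\<lambda>p. g p x < y"]
      by (auto simp: exterior_def num_above_def num_below_def)
    moreover have "dist (x, y + e/2) (x, y) < e" "dist (x, y - e/2) (x, y) < e"
      using \<open>e > 0\<close> by (auto simp: dist_Pair_Pair dist_real_def)
    ultimately show "\<exists>w\<in>exterior k. dist w (x, y) < e" by blast
  qed
qed

definition strict_middle_levels :: "nat \<Rightarrow> (real \<times> real) set" where
  "strict_middle_levels k = {(x, y). (\<exists>p\<in>G. g p x = y) \<and> k < num_above G g x y \<and> k < num_below G g x y}"

text \<open>At a vertex on the boundary of the next kernel only one of the two germs survives: the upper one if
  enough curves lie above the vertex, the lower one otherwise.\<close>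

lemma eventually_strict_middle_levels_at_vertex:
  assumes pq: "p \<in> G" "q \<in> G" "p \<noteq> q" "g p x = y" "g q x = y"
    and counts:
        "k \<le> num_above G g x y" "k \<le> num_below G g x y" "k < num_above G g x y \<or> k < num_below G g x y"
  shows "\<forall>\<^sub>F t in at x. (t, g p t) \<in> strict_middle_levels k \<or> (t, g q t) \<in> strict_middle_levels k"
proof -
  have germ: "(t, g p t) \<in> strict_middle_levels k \<or> (t, g q t) \<in> strict_middle_levels k"
    if "g q t < g p t" "p \<in> G" "q \<in> G"
      "num_above G g t (g p t) = num_above G g x y" "num_above G g t (g q t) = num_above G g x y + 1"
      "num_below G g t (g p t) = num_below G g x y + 1"
      "num_below G g t (g q t) = num_below G g x y" for p q t
    using that counts by (auto simp: strict_middle_levels_def)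
  show ?thesis
    using eventually_inj_on[of x]
      eventually_counts_near_vertex[OF pq, THEN eventually_nhds_conv_at[THEN iffD1], THEN conjunct1]
      eventually_counts_near_vertex[OF pq(2,1) pq(3)[symmetric] pq(5,4), THEN
          eventually_nhds_conv_at[THEN iffD1],
        THEN conjunct1]
  proof eventually_elim
    case (elim t)
    have "g p t \<noteq> g q t" using inj_onD[OF elim(1), of p q] pq by auto
    then consider "g q t < g p t" | "g p t < g q t" by linarith
    then show ?case
      using elim(2,3) pq germ[of q t p] germ[of p t q] by cases auto
  qed
qed

lemma middle_levels_Suc_subset_closure: "middle_levels (Suc k) G g \<subseteq> closure (strict_middle_levels k)"
proof
  fix z assume z: "z \<in> middle_levels (Suc k) G g"
  obtain x y where xy: "z = (x, y)" by fastforce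
  have total: "num_above G g x y + card {p \<in> G. g p x = y} + num_below G g x y = card G"
    by (rule above_add_through_add_below[OF finite_index])
  have middle: "2 * Suc k < card G" "0 < card {p \<in> G. g p x = y}"
    "num_above G g x y + Suc k < card G" "num_below G g x y + Suc k < card G"
    using z card_through_pos_iff by (auto simp: xy middle_levels_def)
  show "z \<in> closure (strict_middle_levels k)"
  proof (cases "k < num_above G g x y \<and> k < num_below G g x y")
    case True
    then have "z \<in> strict_middle_levels k"
      using z by (simp add: xy strict_middle_levels_def middle_levels_def)
    then show ?thesis by (rule subsetD[OF closure_subset])
  next
    case False
    then have through: "card {p \<in> G. g p x = y} = 2"
      using total middle card_through_le_2[of x y] by linarith
    then have counts: "k \<le> num_above G g x y" "k \<le> num_below G g x y"
      "k < num_above G g x y \<or> k < num_below G g x y"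
      using total middle by auto
    obtain p q where pq: "p \<in> G" "q \<in> G" "p \<noteq> q" "g p x = y" "g q x = y"
      using through by (auto simp: card_2_iff set_eq_iff)
    have "((\<lambda>t. (t, g r t)) \<longlongrightarrow> z) (at x)" if "r \<in> {p, q}" for r
      using antiperiodic_isCont[OF antiperiodic, of r x] pq that unfolding xy isCont_def
      by (intro tendsto_Pair tendsto_ident_at) auto
    then have near: "\<forall>\<^sub>F t in at x. dist (t, g p t) z < e" "\<forall>\<^sub>F t in at x. dist (t, g q t) z < e"
      if "e > 0" for e
      using tendstoD[OF _ that] by blast+
    have "\<exists>w\<in>strict_middle_levels k. dist w z < e" if "e > 0" for e
      using eventually_happens'[OF at_neq_bot eventually_conj[OF
            eventually_strict_middle_levels_at_vertex[OF pq counts]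
                eventually_conj[OF near[OF that]]]] by blast
    then show ?thesis by (simp add: closure_approachable)
  qed
qed

lemma closure_strict_middle_levels:
  assumes "2 * k < card G"
  shows "closure (strict_middle_levels k) = middle_levels (Suc k) G g"
proof
  show "middle_levels (Suc k) G g \<subseteq> closure (strict_middle_levels k)"
    by (rule middle_levels_Suc_subset_closure)
  have sub: "strict_middle_levels k \<subseteq> middle_levels (Suc k) G g"
  proof
    fix z assume "z \<in> strict_middle_levels k"
    moreover obtain x y where "z = (x, y)" by fastforce
    ultimately show "z \<in> middle_levels (Suc k) G g"
      using above_add_through_add_below[OF finite_index, of g x y] card_through_pos_iff[of x y]
      by (auto simp: strict_middle_levels_def middle_levels_def)
  qed
  have "open (- middle_levels (Suc k) G g)"
  proof (rule openI_eventually)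
    fix z assume z: "z \<in> - middle_levels (Suc k) G g"
    show "\<forall>\<^sub>F w in nhds z. w \<in> - middle_levels (Suc k) G g"
      using eventually_counts_ge[of z]
      by eventually_elim (use z in \<open>auto simp: middle_levels_def split: prod.splits\<close>)
  qed
  then show "closure (strict_middle_levels k) \<subseteq> middle_levels (Suc k) G g"
    using sub by (intro closure_minimal) (auto simp: closed_def)
qed

lemma middle_levels_diff_hull:
  assumes "2 * k < card G"
  shows "middle_levels k G g - (closure (exterior k) - exterior k) = strict_middle_levels k"
proof (rule set_eqI)
  fix z :: "real \<times> real"
  obtain x y where z: "z = (x, y)" by fastforce
  show "z \<in> middle_levels k G g - (closure (exterior k) - exterior k) \<longleftrightarrow> z \<in> strict_middle_levels k"
  proof (cases "z \<in> middle_levels k G g")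
    case True
    then have "z \<notin> exterior k" by (auto simp: middle_levels_def exterior_def)
    moreover have "z \<in> strict_middle_levels k \<longleftrightarrow> z \<notin> closure (exterior k)"
      using closure_exterior_iff[of x y k] True
      by (auto simp: z strict_middle_levels_def middle_levels_def)
    ultimately show ?thesis using True by blast
  next
    case False
    then show ?thesis
      using assms above_add_through_add_below[OF finite_index, of g x y]
      by (auto simp: z strict_middle_levels_def middle_levels_def)
  qed
qed

lemma support_eq_middle_levels_0: "support (arrangement_of G g) = mproj ` middle_levels 0 G g"
proof -
  have "(x, y) \<in> middle_levels 0 G g \<longleftrightarrow> (\<exists>p\<in>G. g p x = y)" for x y
    using above_add_through_add_below[OF finite_index, of g x y] card_through_pos_iff[of x y]
    by (auto simp: middle_levels_def)
  then have "mproj (x, y) \<in> support (arrangement_of G g) \<longleftrightarrow>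
      mproj (x, y) \<in> mproj ` middle_levels 0 G g" for x y
    using mproj_mem_image_iff[OF deck_mem_middle_levels] mem_support_iff by metis
  then show ?thesis by (metis mproj_cases set_eqI)
qed

theorem kernel_eq_middle_levels: "kernel (arrangement_of G g) k = mproj ` middle_levels k G g"
proof (induction k)
  case 0
  show ?case using support_eq_middle_levels_0 by simp
next
  case (Suc k)
  show ?case
  proof (cases "2 * k < card G")
    case False
    then have "middle_levels k G g = {}" "middle_levels (Suc k) G g = {}"
      by (auto simp: middle_levels_def)
    then show ?thesis using Suc by simp
  next
    case True
    have "open (mproj ` exterior k)" by (intro open_mproj_image open_exterior)
    then have "mproj -` (kernel (arrangement_of G g) k - external_hull (kernel (arrangement_of G g) k)) =
        middle_levels k G g - (closure (exterior k) - exterior k)"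
      by (simp add: Suc external_hull_def external_face_middle_levels[OF True] frontier_def interior_open
          vimage_Diff vimage_mproj_closure vimage_middle_levels vimage_exterior)
    then have "mproj -` kernel (arrangement_of G g) (Suc k) = middle_levels (Suc k) G g"
      by (simp add: vimage_mproj_closure middle_levels_diff_hull[OF True]
        closure_strict_middle_levels[OF True])
    moreover have "surj mproj" by (metis mproj_cases surj_def)
    ultimately show ?thesis by (metis surj_image_vimage_eq)
  qed
qed

lemma mem_kernel_iff: "mproj z \<in> kernel (arrangement_of G g) k \<longleftrightarrow> z \<in> middle_levels k G g"
  unfolding kernel_eq_middle_levels by (rule mproj_mem_image_iff[OF deck_mem_middle_levels])

end

section \<open>Curves supported by middle levels\<close>

definition follows :: "'i set \<Rightarrow> ('i \<Rightarrow> real \<Rightarrow> real) \<Rightarrow> (real \<Rightarrow> real) \<Rightarrow> bool" where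
  "follows G g h \<longleftrightarrow> antiperiodic h \<and> (\<forall>x. \<exists>p\<in>G. h x = g p x)"

lemma antiperiodic_eq_right_limit:
  "antiperiodic a \<Longrightarrow> antiperiodic b \<Longrightarrow> \<forall>\<^sub>F t in at_right x. a t = b t \<Longrightarrow> a x = b x"
  by (rule antiperiodic_eq_at_limit[OF _ _ trivial_limit_at_right_real])

lemma antiperiodic_eq_left_limit:
  "antiperiodic a \<Longrightarrow> antiperiodic b \<Longrightarrow> \<forall>\<^sub>F t in at_left x. a t = b t \<Longrightarrow> a x = b x"
  by (rule antiperiodic_eq_at_limit[OF _ _ trivial_limit_at_left_real])

context curve_family
begin

lemma follows_right_germ:
  assumes "follows G g h" obtains p where "p \<in> G" "\<forall>\<^sub>F t in at_right x. h t = g p t" "g p x = h x"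
proof -
  have h: "antiperiodic h" "\<forall>x. \<exists>p\<in>G. h x = g p x" using assms by (auto simp: follows_def)
  then obtain p where p: "p \<in> G" "\<forall>\<^sub>F t in at_right x. h t = g p t"
    using right_germ[OF antiperiodic_continuous_on] by fastforce
  then show thesis using that antiperiodic_eq_right_limit[OF h(1) antiperiodic[OF p(1)] p(2)] by simp
qed

lemma follows_left_germ:
  assumes "follows G g h" obtains p where "p \<in> G" "\<forall>\<^sub>F t in at_left x. h t = g p t" "g p x = h x"
proof -
  have h: "antiperiodic h" "\<forall>x. \<exists>p\<in>G. h x = g p x" using assms by (auto simp: follows_def)
  then obtain p where p: "p \<in> G" "\<forall>\<^sub>F t in at_left x. h t = g p t"
    using left_germ[OF antiperiodic_continuous_on] by fastforce
  then show thesis using that antiperiodic_eq_left_limit[OF h(1) antiperiodic[OF p(1)] p(2)] by simp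
qed

lemma distinct_germs:
  assumes "a \<in> G" "b \<in> G" "a \<noteq> b" "at x within S \<noteq> bot"
    and "\<forall>\<^sub>F t in at x within S. g a t = h t" "\<forall>\<^sub>F t in at x within S. g b t = h' t"
  shows "\<not> (\<forall>\<^sub>F t in at x within S. h t = h' t)"
proof
  assume "\<forall>\<^sub>F t in at x within S. h t = h' t"
  with assms(5,6) have "\<forall>\<^sub>F t in at x within S. g a t = g b t" by eventually_elim simp
  then show False using germ_unique[OF assms(1,2,4)] assms(3) by blast
qed

lemma vertex_right_germs:
  assumes H: "curve_family H h" "\<And>p. p \<in> G \<Longrightarrow> follows H h (g p)"
    and pq: "p \<in> G" "q \<in> G" "p \<noteq> q" "g p x = y" "g q x = y"
  obtains p' q' where "p' \<in> H" "q' \<in> H" "p' \<noteq> q'" "h p' x = y" "h q' x = y"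
    "\<forall>\<^sub>F t in at_right x. g p t = h p' t" "\<forall>\<^sub>F t in at_right x. g q t = h q' t"
proof -
  interpret H: curve_family H h by (rule H(1))
  obtain p' where p': "p' \<in> H" "\<forall>\<^sub>F t in at_right x. g p t = h p' t" "h p' x = g p x"
    using H.follows_right_germ[OF H(2)[OF pq(1)]] .
  obtain q' where q': "q' \<in> H" "\<forall>\<^sub>F t in at_right x. g q t = h q' t" "h q' x = g q x"
    using H.follows_right_germ[OF H(2)[OF pq(2)]] .
  have "p' \<noteq> q'"
    using distinct_germs[OF pq(1-3) trivial_limit_at_right_real p'(2) q'(2)] by auto
  then show thesis using that p' q' pq(4,5) by simp
qed

lemma germ_pair_cases:
  assumes pq: "p \<in> G" "q \<in> G" "p \<noteq> q" "g q x = g p x" and h: "follows G g h" "h x = g p x"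
  shows "(\<forall>\<^sub>F t in at_right x. h t = g p t) \<or> (\<forall>\<^sub>F t in at_right x. h t = g q t)"
    and "(\<forall>\<^sub>F t in at_left x. h t = g p t) \<or> (\<forall>\<^sub>F t in at_left x. h t = g q t)"
proof -
  obtain r where "r \<in> G" "\<forall>\<^sub>F t in at_right x. h t = g r t" "g r x = h x"
    using follows_right_germ[OF h(1)] .
  moreover from this have "r = p \<or> r = q" using pair_through[OF pq(1-3) refl pq(4)] h(2) by simp
  ultimately show "(\<forall>\<^sub>F t in at_right x. h t = g p t) \<or> (\<forall>\<^sub>F t in at_right x. h t = g q t)" by blast
  obtain r where "r \<in> G" "\<forall>\<^sub>F t in at_left x. h t = g r t" "g r x = h x"
    using follows_left_germ[OF h(1)] .
  moreover from this have "r = p \<or> r = q" using pair_through[OF pq(1-3) refl pq(4)] h(2) by simp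
  ultimately show "(\<forall>\<^sub>F t in at_left x. h t = g p t) \<or> (\<forall>\<^sub>F t in at_left x. h t = g q t)" by blast
qed

lemma vertices_subset_of_follows:
  assumes "curve_family H h" "\<And>p. p \<in> G \<Longrightarrow> follows H h (g p)"
  shows "vertices G g \<subseteq> vertices H h"
proof (rule subrelI)
  fix x y assume "(x, y) \<in> vertices G g"
  then obtain p q where pq: "p \<in> G" "q \<in> G" "p \<noteq> q" "g p x = y" "g q x = y" by (rule verticesE)
  obtain p' q' where "p' \<in> H" "q' \<in> H" "p' \<noteq> q'" "h p' x = y" "h q' x = y"
    using vertex_right_germs[OF assms pq] .
  then show "(x, y) \<in> vertices H h" by (rule verticesI)
qed

end

locale contact_free_family = curve_family I f for I :: "'a set" and f :: "'a \<Rightarrow> real \<Rightarrow> real" +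
  fixes k :: nat
  assumes meet_crosses: "\<alpha> \<in> I \<Longrightarrow> \<beta> \<in> I \<Longrightarrow> \<alpha> \<noteq> \<beta> \<Longrightarrow> f \<alpha> x = f \<beta> x \<Longrightarrow> crosses (f \<alpha>) (f \<beta>) x"

lemma (in curve_family) contact_free_familyI:
  assumes "contact_points (arrangement_of G g) = {}" shows "contact_free_family G g"
proof
  fix p q x assume pq: "p \<in> G" "q \<in> G" "p \<noteq> q" "g p x = g q x"
  have "(x, g p x) \<notin> contacts G g" using assms mem_contact_points_iff[of "(x, g p x)"] by simp
  then show "crosses (g p) (g q) x" using contactsI[OF pq(1-3)] crosses_iff_not_touches[OF pq] by blast
qed

context contact_free_family
begin

definition covers_kernel :: "'j set \<Rightarrow> ('j \<Rightarrow> real \<Rightarrow> real) \<Rightarrow> bool" where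
  "covers_kernel G g \<longleftrightarrow> curve_family G g \<and> (\<forall>x y. (\<exists>p\<in>G. g p x = y) \<longleftrightarrow> (x, y) \<in> middle_levels k I f)"

lemma covers_kernel_family: "covers_kernel G g \<Longrightarrow> curve_family G g"
  and covers_kernel_iff: "covers_kernel G g \<Longrightarrow> (\<exists>p\<in>G. g p x = y) \<longleftrightarrow> (x, y) \<in> middle_levels k I f"
  by (auto simp: covers_kernel_def)

lemma covers_kernel_antiperiodic: "covers_kernel G g \<Longrightarrow> p \<in> G \<Longrightarrow> antiperiodic (g p)"
  by (rule curve_family.antiperiodic[OF covers_kernel_family])

lemma covers_kernel_follows_lines: assumes "covers_kernel G g" "p \<in> G" shows "follows I f (g p)"
proof -
  have "\<exists>\<alpha>\<in>I. g p x = f \<alpha> x" for x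
  proof -
    have "(x, g p x) \<in> middle_levels k I f" using covers_kernel_iff[OF assms(1)] assms(2) by blast
    then obtain \<alpha> where "\<alpha> \<in> I" "f \<alpha> x = g p x" by (auto simp: middle_levels_def)
    then show ?thesis by (intro bexI[of _ \<alpha>]) simp_all
  qed
  then show ?thesis using covers_kernel_antiperiodic[OF assms] by (simp add: follows_def)
qed

lemma covers_kernel_follows: "covers_kernel G g \<Longrightarrow> covers_kernel G' g' \<Longrightarrow> p \<in> G \<Longrightarrow> follows G' g' (g p)"
  unfolding follows_def using covers_kernel_antiperiodic covers_kernel_iff by metis

lemma covers_kernel_vertices_subset: "covers_kernel G g \<Longrightarrow> vertices G g \<subseteq> vertices I f"
  by (rule curve_family.vertices_subset_of_follows[OF covers_kernel_family curve_family_axioms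
        covers_kernel_follows_lines])

lemma covers_kernel_vertices_eq:
  assumes "covers_kernel G g" "covers_kernel G' g'" shows "vertices G g = vertices G' g'"
  using curve_family.vertices_subset_of_follows covers_kernel_family covers_kernel_follows assms
  by (metis subset_antisym)

lemma covers_kernel_crossings_iff:
  assumes "covers_kernel G g" "covers_kernel G' g'" "z \<in> contacts G g \<longleftrightarrow> z \<in> contacts G' g'"
  shows "z \<in> crossings G g \<longleftrightarrow> z \<in> crossings G' g'"
  using covers_kernel_vertices_eq[OF assms(1,2)] assms(3)
  by (simp add: curve_family.crossings_eq[OF covers_kernel_family] assms(1,2))

lemma crosses_iff_straight:
  assumes G: "covers_kernel G g" and pq: "p \<in> G" "q \<in> G" "p \<noteq> q" "g p x = f \<alpha> x" "g q x = f \<alpha> x"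
    and \<alpha>\<beta>: "\<alpha> \<in> I" "\<beta> \<in> I" "\<alpha> \<noteq> \<beta>" "f \<beta> x = f \<alpha> x"
    and left: "\<forall>\<^sub>F t in at_left x. g p t = f \<alpha> t"
  shows "crosses (g p) (g q) x \<longleftrightarrow> (\<forall>\<^sub>F t in at_right x. g p t = f \<alpha> t)"
proof -
  interpret G: curve_family G g by (rule covers_kernel_family[OF G])
  note germs = germ_pair_cases[OF \<alpha>\<beta> covers_kernel_follows_lines[OF G]]
  have lines: "crosses (f \<alpha>) (f \<beta>) x" using meet_crosses[OF \<alpha>\<beta>(1-3)] \<alpha>\<beta>(4) by simp
  have left_q: "\<forall>\<^sub>F t in at_left x. g q t = f \<beta> t"
    using germs(2)[OF pq(2,5)] G.distinct_germs[OF pq(1-3) trivial_limit_at_left_real left, of "f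
      \<alpha>"] by auto
  from germs(1)[OF pq(1,4)] show ?thesis
  proof
    assume right: "\<forall>\<^sub>F t in at_right x. g p t = f \<alpha> t"
    then have "\<forall>\<^sub>F t in at_right x. g q t = f \<beta> t"
      using germs(1)[OF pq(2,5)] G.distinct_germs[OF pq(1-3) trivial_limit_at_right_real right, of
        "f \<alpha>"] by auto
    with left left_q right have "\<forall>\<^sub>F t in at x. g p t = f \<alpha> t \<and> g q t = f \<beta> t"
      by (simp add: eventually_at_split eventually_conj)
    then have "crosses (g p) (g q) x" using lines crosses_cong pq(4,5) \<alpha>\<beta>(4) by simp
    then show ?thesis using right by simp
  next
    assume right: "\<forall>\<^sub>F t in at_right x. g p t = f \<beta> t"
    then have "\<forall>\<^sub>F t in at_right x. g q t = f \<alpha> t"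
      using germs(1)[OF pq(2,5)] G.distinct_germs[OF pq(1-3) trivial_limit_at_right_real right, of
        "f \<beta>"] by auto
    with left left_q right have "touches (g p) (g q) x"
      by (intro crosses_swap[OF _ _ _ lines] eventually_conj) (simp_all add: pq(4,5))
    moreover have "\<not> (\<forall>\<^sub>F t in at_right x. g p t = f \<alpha> t)"
    proof
      assume "\<forall>\<^sub>F t in at_right x. g p t = f \<alpha> t"
      with right have "\<forall>\<^sub>F t in at_right x. f \<alpha> t = f \<beta> t" by eventually_elim simp
      then show False using germ_unique[OF \<alpha>\<beta>(1,2) trivial_limit_at_right_real] \<alpha>\<beta>(3) by blast
    qed
    ultimately show ?thesis using crosses_not_touches by blast
  qed
qed

lemma middle_levels_near_vertex:
  assumes \<alpha>\<beta>: "\<alpha> \<in> I" "\<beta> \<in> I" "\<alpha> \<noteq> \<beta>" "f \<alpha> x = y" "f \<beta> x = y"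
  shows "\<forall>\<^sub>F t in nhds x. f \<beta> t < f \<alpha> t \<longrightarrow>
    ((t, f \<alpha> t) \<in> middle_levels k I f \<longleftrightarrow>
      2 * k < card I \<and> k \<le> num_above I f x y \<and> k \<le> num_below I f x y + 1) \<and>
    ((t, f \<beta> t) \<in> middle_levels k I f \<longleftrightarrow>
      2 * k < card I \<and> k \<le> num_above I f x y + 1 \<and> k \<le> num_below I f x y)"
proof -
  have "card {\<alpha>, \<beta>} \<le> card {\<gamma> \<in> I. f \<gamma> x = y}"
    using \<alpha>\<beta> finite_index by (intro card_mono) auto
  then have "num_above I f x y + 2 + num_below I f x y = card I"
    using above_add_through_add_below[OF finite_index, of f x y] card_through_le_2[of x y] \<alpha>\<beta>(3) by simp
  then show ?thesis
    using eventually_counts_near_vertex[OF \<alpha>\<beta>]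
  proof (elim eventually_mono, intro impI)
    fix t
    assume total: "num_above I f x y + 2 + num_below I f x y = card I"
      and counts: "f \<beta> t < f \<alpha> t \<longrightarrow> (\<forall>S\<subseteq>I.
        num_above S f t (f \<alpha> t) = num_above S f x y \<and> num_above S f t (f \<beta> t) = num_above S f x y +
            of_bool (\<alpha> \<in> S) \<and>
        num_below S f t (f \<alpha> t) = num_below S f x y + of_bool (\<beta> \<in> S) \<and> num_below S f t (f \<beta> t) =
            num_below S f x y)"
      and gt: "f \<beta> t < f \<alpha> t"
    have "num_above I f t (f \<alpha> t) = num_above I f x y" "num_above I f t (f \<beta> t) = num_above I f x y + 1"
      "num_below I f t (f \<alpha> t) = num_below I f x y + 1" "num_below I f t (f \<beta> t) = num_below I f x y"
      using counts[rule_format, OF gt subset_refl] \<alpha>\<beta>(1,2) by simp_all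
    moreover have "\<exists>\<gamma>\<in>I. f \<gamma> t = f \<alpha> t" "\<exists>\<gamma>\<in>I. f \<gamma> t = f \<beta> t" using \<alpha>\<beta>(1,2) by blast+
    ultimately show "((t, f \<alpha> t) \<in> middle_levels k I f \<longleftrightarrow>
        2 * k < card I \<and> k \<le> num_above I f x y \<and> k \<le> num_below I f x y + 1) \<and>
      ((t, f \<beta> t) \<in> middle_levels k I f \<longleftrightarrow>
        2 * k < card I \<and> k \<le> num_above I f x y + 1 \<and> k \<le> num_below I f x y)"
      unfolding middle_levels_def using total by simp linarith
  qed
qed

lemma line_in_kernel_counts:
  assumes \<alpha>\<beta>: "\<alpha> \<in> I" "\<beta> \<in> I" "\<alpha> \<noteq> \<beta>" "f \<beta> x = f \<alpha> x" and S: "at x within S \<noteq> bot"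
    and kernel: "\<forall>\<^sub>F t in at x within S. (t, f \<alpha> t) \<in> middle_levels k I f"
  shows "\<forall>\<^sub>F t in at x within S. f \<beta> t < f \<alpha> t \<Longrightarrow> 2 * k < card I \<and> k \<le> num_above I f x (f \<alpha> x)"
    and "\<forall>\<^sub>F t in at x within S. f \<alpha> t < f \<beta> t \<Longrightarrow> 2 * k < card I \<and> k \<le> num_below I f x (f \<alpha> x)"
proof -
  have near: "\<forall>\<^sub>F t in at x within S. P t" if "\<forall>\<^sub>F t in nhds x. P t" for P
    using that by (rule filter_leD[OF at_within_le_nhds])
  show "2 * k < card I \<and> k \<le> num_above I f x (f \<alpha> x)" if "\<forall>\<^sub>F t in at x within S. f \<beta> t < f \<alpha> t"
  proof -
    have "\<forall>\<^sub>F t in at x within S. 2 * k < card I \<and> k \<le> num_above I f x (f \<alpha> x)"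
      using near[OF middle_levels_near_vertex[OF \<alpha>\<beta>(1-3) refl \<alpha>\<beta>(4)]] kernel that
      by eventually_elim blast
    then show ?thesis using S by simp
  qed
  show "2 * k < card I \<and> k \<le> num_below I f x (f \<alpha> x)" if "\<forall>\<^sub>F t in at x within S. f \<alpha> t < f \<beta> t"
  proof -
    have "\<forall>\<^sub>F t in at x within S. 2 * k < card I \<and> k \<le> num_below I f x (f \<alpha> x)"
      using near[OF middle_levels_near_vertex[OF \<alpha>\<beta>(2,1) \<alpha>\<beta>(3)[symmetric] \<alpha>\<beta>(4) refl]] kernel that
      by eventually_elim blast
    then show ?thesis using S by simp
  qed
qed

text \<open>On the two sides of the vertex the curve is on the upper and on the lower line. So on either side both
  lines are in the kernel.\<close>

lemma straight_vertex_counts: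
  assumes G: "covers_kernel G g" "p \<in> G"
    and \<alpha>\<beta>: "\<alpha> \<in> I" "\<beta> \<in> I" "\<alpha> \<noteq> \<beta>" "f \<beta> x = f \<alpha> x"
    and straight: "\<forall>\<^sub>F t in at_left x. g p t = f \<alpha> t" "\<forall>\<^sub>F t in at_right x. g p t = f \<alpha> t"
  shows "2 * k < card I \<and> k \<le> num_above I f x (f \<alpha> x) \<and> k \<le> num_below I f x (f \<alpha> x)"
proof -
  have kernel: "\<forall>\<^sub>F t in F. (t, f \<alpha> t) \<in> middle_levels k I f" if "\<forall>\<^sub>F t in F. g p t = f \<alpha> t" for F
    using that by eventually_elim (use covers_kernel_iff[OF G(1)] G(2) in metis)
  note counts_left = line_in_kernel_counts[OF \<alpha>\<beta> trivial_limit_at_left_real kernel[OF straight(1)]]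
    and counts_right = line_in_kernel_counts[OF \<alpha>\<beta> trivial_limit_at_right_real kernel[OF straight(2)]]
  have cross: "crosses (f \<alpha>) (f \<beta>) x" using meet_crosses[OF \<alpha>\<beta>(1-3)] \<alpha>\<beta>(4) by simp
  have "\<forall>\<^sub>F t in at x. f \<alpha> t \<noteq> f \<beta> t"
    using eventually_inj_on[of x] by eventually_elim (use \<alpha>\<beta> in \<open>auto dest: inj_onD\<close>)
  from eventually_neq_imp_less_or_greater(1)[OF continuous[OF \<alpha>\<beta>(1)] continuous[OF \<alpha>\<beta>(2)] this]
  show ?thesis
  proof
    assume left: "\<forall>\<^sub>F t in at_left x. f \<alpha> t < f \<beta> t"
    have "\<forall>\<^sub>F t in at_right x. f \<beta> t < f \<alpha> t"
      using crosses_order_right[OF cross[unfolded crosses_commute[of "f \<alpha>"]] left] .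
    then show ?thesis using counts_left(2)[OF left] counts_right(1) by blast
  next
    assume left: "\<forall>\<^sub>F t in at_left x. f \<beta> t < f \<alpha> t"
    have "\<forall>\<^sub>F t in at_right x. f \<alpha> t < f \<beta> t" by (rule crosses_order_right[OF cross left])
    then show ?thesis using counts_left(1)[OF left] counts_right(2) by blast
  qed
qed

lemma straight_imp_second_curve:
  assumes G: "covers_kernel G g" "p \<in> G"
    and \<alpha>\<beta>: "\<alpha> \<in> I" "\<beta> \<in> I" "\<alpha> \<noteq> \<beta>" "f \<beta> x = f \<alpha> x"
    and straight: "\<forall>\<^sub>F t in at_left x. g p t = f \<alpha> t" "\<forall>\<^sub>F t in at_right x. g p t = f \<alpha> t"
  obtains q where "q \<in> G" "p \<noteq> q" "g q x = f \<alpha> x"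
proof -
  interpret G: curve_family G g by (rule covers_kernel_family[OF G(1)])
  note counts = straight_vertex_counts[OF G \<alpha>\<beta> straight]
  have "\<forall>\<^sub>F t in at x. (f \<beta> t < f \<alpha> t \<longrightarrow> (t, f \<beta> t) \<in> middle_levels k I f) \<and>
      (f \<alpha> t < f \<beta> t \<longrightarrow> (t, f \<beta> t) \<in> middle_levels k I f)"
    using filter_leD[OF at_within_le_nhds middle_levels_near_vertex[OF \<alpha>\<beta>(1-3) refl \<alpha>\<beta>(4)]]
      filter_leD[OF at_within_le_nhds middle_levels_near_vertex[OF \<alpha>\<beta>(2,1) \<alpha>\<beta>(3)[symmetric] \<alpha>\<beta>(4) refl]]
    by eventually_elim (use counts in simp)
  with eventually_inj_on[of x] have "\<forall>\<^sub>F t in at x. \<exists>q\<in>G. f \<beta> t = g q t"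
  proof eventually_elim
    case (elim t)
    have "f \<alpha> t \<noteq> f \<beta> t" using elim(1) \<alpha>\<beta> by (auto dest: inj_onD)
    then have "(t, f \<beta> t) \<in> middle_levels k I f" using elim(2) by (auto simp: neq_iff)
    then show ?case using covers_kernel_iff[OF G(1)] by metis
  qed
  then have "\<forall>\<^sub>F t in at_left x. \<exists>q\<in>G. f \<beta> t = g q t" by (simp add: eventually_at_split)
  then obtain q where q: "q \<in> G" "\<forall>\<^sub>F t in at_left x. f \<beta> t = g q t"
    using G.left_germ[OF continuous[OF \<alpha>\<beta>(2)]] by blast
  have "p \<noteq> q"
    using distinct_germs[OF \<alpha>\<beta>(1-3) trivial_limit_at_left_real _ q(2), of "g p"] straight(1)
    by (auto simp: eq_commute[of "g q _"])
  moreover have "g q x = f \<alpha> x"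
    using antiperiodic_eq_left_limit[OF antiperiodic[OF \<alpha>\<beta>(2)] G.antiperiodic[OF q(1)] q(2)] \<alpha>\<beta>(4)
    by simp
  ultimately show thesis using that q(1) by blast
qed

lemma mem_crossings_iff_straight:
  assumes G: "covers_kernel G g" "p \<in> G"
    and \<alpha>\<beta>: "\<alpha> \<in> I" "\<beta> \<in> I" "\<alpha> \<noteq> \<beta>" "f \<beta> x = f \<alpha> x"
    and left: "\<forall>\<^sub>F t in at_left x. g p t = f \<alpha> t"
  shows "(x, f \<alpha> x) \<in> crossings G g \<longleftrightarrow> (\<forall>\<^sub>F t in at_right x. g p t = f \<alpha> t)"
proof -
  interpret G: curve_family G g by (rule covers_kernel_family[OF G(1)])
  have y: "g p x = f \<alpha> x"
    by (rule antiperiodic_eq_left_limit[OF G.antiperiodic[OF G(2)] antiperiodic[OF \<alpha>\<beta>(1)] left])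
  have pair: "(x, f \<alpha> x) \<in> crossings G g \<longleftrightarrow> (\<forall>\<^sub>F t in at_right x. g p t = f \<alpha> t)"
    if "q \<in> G" "p \<noteq> q" "g q x = f \<alpha> x" for q
    using G.crossings_pair_iff[OF G(2) that(1,2) y that(3)]
      crosses_iff_straight[OF G that(1,2) y that(3) \<alpha>\<beta> left] by simp
  show ?thesis
  proof
    assume cross: "(x, f \<alpha> x) \<in> crossings G g"
    then obtain r s where rs: "r \<in> G" "s \<in> G" "r \<noteq> s" "g r x = f \<alpha> x" "g s x = f \<alpha> x"
      by (rule crossingsE)
    have "p = r \<or> p = s" by (rule G.pair_through[OF rs G(2) y])
    then show "\<forall>\<^sub>F t in at_right x. g p t = f \<alpha> t" using pair[of r] pair[of s] rs cross by auto
  next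
    assume right: "\<forall>\<^sub>F t in at_right x. g p t = f \<alpha> t"
    obtain q where "q \<in> G" "p \<noteq> q" "g q x = f \<alpha> x"
      using straight_imp_second_curve[OF G \<alpha>\<beta> left right] .
    then show "(x, f \<alpha> x) \<in> crossings G g" using pair right by blast
  qed
qed

lemma agree_past_point:
  assumes G: "covers_kernel G g" "p \<in> G" and G': "covers_kernel G' g'" "p' \<in> G'"
    and left: "\<forall>\<^sub>F t in at_left x. g p t = g' p' t"
    and cross: "(x, g p x) \<in> vertices I f \<Longrightarrow> (x, g p x) \<in> crossings G g \<longleftrightarrow> (x, g p x) \<in> crossings G' g'"
  shows "\<forall>\<^sub>F t in at_right x. g p t = g' p' t"
proof -
  note follow = covers_kernel_follows_lines[OF G] and follow' = covers_kernel_follows_lines[OF G']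
  obtain \<alpha> where \<alpha>: "\<alpha> \<in> I" "\<forall>\<^sub>F t in at_left x. g p t = f \<alpha> t" "f \<alpha> x = g p x"
    using follows_left_germ[OF follow] .
  have \<alpha>': "\<forall>\<^sub>F t in at_left x. g' p' t = f \<alpha> t" using left \<alpha>(2) by eventually_elim simp
  have y: "g' p' x = f \<alpha> x"
    by (rule antiperiodic_eq_left_limit[OF covers_kernel_antiperiodic[OF G'] antiperiodic[OF \<alpha>(1)] \<alpha>'])
  show ?thesis
  proof (cases "(x, f \<alpha> x) \<in> vertices I f")
    case False
    have same: "\<forall>\<^sub>F t in at_right x. h t = f \<alpha> t" if h: "follows I f h" "h x = f \<alpha> x" for h
    proof -
      obtain \<gamma> where "\<gamma> \<in> I" "\<forall>\<^sub>F t in at_right x. h t = f \<gamma> t" "f \<gamma> x = h x"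
        using follows_right_germ[OF h(1)] .
      moreover from this have "\<gamma> = \<alpha>" using False \<alpha>(1) h(2) verticesI by metis
      ultimately show ?thesis by simp
    qed
    show ?thesis using same[OF follow \<alpha>(3)[symmetric]] same[OF follow' y] by eventually_elim simp
  next
    case True
    then obtain \<beta> where \<beta>: "\<beta> \<in> I" "\<alpha> \<noteq> \<beta>" "f \<beta> x = f \<alpha> x" using \<alpha>(1) by (metis verticesE)
    have "(\<forall>\<^sub>F t in at_right x. g p t = f \<alpha> t) \<longleftrightarrow> (\<forall>\<^sub>F t in at_right x. g' p' t = f \<alpha> t)"
      using mem_crossings_iff_straight[OF G \<alpha>(1) \<beta> \<alpha>(2)] mem_crossings_iff_straight[OF G' \<alpha>(1) \<beta> \<alpha>']
        cross True \<alpha>(3) by simp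
    then consider "\<forall>\<^sub>F t in at_right x. g p t = f \<alpha> t" "\<forall>\<^sub>F t in at_right x. g' p' t = f \<alpha> t"
      | "\<forall>\<^sub>F t in at_right x. g p t = f \<beta> t" "\<forall>\<^sub>F t in at_right x. g' p' t = f \<beta> t"
      using germ_pair_cases(1)[OF \<alpha>(1) \<beta> follow \<alpha>(3)[symmetric]]
        germ_pair_cases(1)[OF \<alpha>(1) \<beta> follow' y] by blast
    then show ?thesis by cases (auto elim: eventually_elim2)
  qed
qed

lemma agree_along:
  assumes G: "covers_kernel G g" "p \<in> G" and G': "covers_kernel G' g'" "p' \<in> G'"
    and start: "\<forall>\<^sub>F t in at_right a. g p t = g' p' t"
    and cross: "\<And>x. a < x \<Longrightarrow> x < b \<Longrightarrow> (x, g p x) \<in> vertices I f \<Longrightarrow>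
      (x, g p x) \<in> crossings G g \<longleftrightarrow> (x, g p x) \<in> crossings G' g'"
    and t: "a \<le> t" "t \<le> b"
  shows "g p t = g' p' t"
proof (cases "t = a")
  case True
  then show ?thesis
    using antiperiodic_eq_right_limit[OF covers_kernel_antiperiodic[OF G]
      covers_kernel_antiperiodic[OF G'] start] by simp
next
  case False
  show ?thesis
  proof (rule interval_induction_right[OF start])
    show "g p s = g' p' s" if "\<forall>\<^sub>F u in at_left s. g p u = g' p' u" for s
      by (rule antiperiodic_eq_left_limit[OF covers_kernel_antiperiodic[OF G]
        covers_kernel_antiperiodic[OF G'] that])
    show "\<forall>\<^sub>F u in at_right s. g p u = g' p' u"
      if "a < s" "s < b" "\<forall>\<^sub>F u in at_left s. g p u = g' p' u" for s
      by (rule agree_past_point[OF G G' that(3)]) (rule cross[OF that(1,2)])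
  qed (use t False in auto)
qed

end

section \<open>Flips\<close>

locale exchange = curve_family G g for G :: "'i set" and g :: "'i \<Rightarrow> real \<Rightarrow> real" +
  fixes p q :: 'i and xv xw :: real
  assumes pair: "p \<in> G" "q \<in> G" "p \<noteq> q"
    and crossing: "crosses (g p) (g q) xv" and contact: "touches (g p) (g q) xw"
    and between: "xv < xw" "xw < xv + pi"
begin

abbreviation partner :: "'i \<Rightarrow> 'i" where
  "partner \<equiv> Transposition.transpose p q"

definition exchanged :: "'i \<Rightarrow> real \<Rightarrow> real" where
  "exchanged = (SOME g'. \<forall>r\<in>G. antiperiodic (g' r) \<and>
     (\<forall>t\<in>{xv..xw}. g' r t = g (partner r) t) \<and> (\<forall>t\<in>{xw..xv + pi}. g' r t = g r t))"

lemma partner_mem: "r \<in> G \<Longrightarrow> partner r \<in> G"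
  using pair by (auto simp: Transposition.transpose_def)

lemma partner_eq_iff: "partner r = partner s \<longleftrightarrow> r = s"
  by (metis transpose_involutory)

lemma pair_meets: "g p xv = g q xv" "g p xw = g q xw"
  using crossing contact by (auto dest: crosses_imp_eq touches_imp_eq)

lemma
  assumes "r \<in> G"
  shows antiperiodic_exchanged: "antiperiodic (exchanged r)"
    and exchanged_between: "\<And>t. xv \<le> t \<Longrightarrow> t \<le> xw \<Longrightarrow> exchanged r t = g (partner r) t"
    and exchanged_beyond: "\<And>t. xw \<le> t \<Longrightarrow> t \<le> xv + pi \<Longrightarrow> exchanged r t = g r t"
proof -
  have meet: "g (partner r) xv = g r xv" "g (partner r) xw = g r xw" for r
    using pair_meets by (auto simp: Transposition.transpose_def)
  have "\<exists>h. antiperiodic h \<and> (\<forall>t\<in>{xv..xw}. h t = g (partner r) t) \<and> (\<forall>t\<in>{xw..xv + pi}. h t = g r t)"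
    if "r \<in> G" for r
  proof -
    let ?h = "\<lambda>t. if t \<le> xw then g (partner r) t else g r t"
    have "continuous_on {xv..xv + pi} ?h"
      using meet that partner_mem by (intro continuous_on_cases_le continuous continuous_intros) auto
    moreover have "?h (xv + pi) = - ?h xv"
      using between meet antiperiodic_add_pi[OF antiperiodic[OF that]] by auto
    ultimately obtain h where "antiperiodic h" "\<And>t. xv \<le> t \<Longrightarrow> t \<le> xv + pi \<Longrightarrow> h t = ?h t"
      using antiperiodic_extension[of xv ?h] by blast
    then show ?thesis using meet between by (intro exI[of _ h]) auto
  qed
  then have "\<exists>g'. \<forall>r\<in>G. antiperiodic (g' r) \<and>
      (\<forall>t\<in>{xv..xw}. g' r t = g (partner r) t) \<and> (\<forall>t\<in>{xw..xv + pi}. g' r t = g r t)"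
    by metis
  then have "\<forall>r\<in>G. antiperiodic (exchanged r) \<and>
      (\<forall>t\<in>{xv..xw}. exchanged r t = g (partner r) t) \<and> (\<forall>t\<in>{xw..xv + pi}. exchanged r t = g r t)"
    unfolding exchanged_def by (rule someI_ex)
  then show "antiperiodic (exchanged r)"
    "\<And>t. xv \<le> t \<Longrightarrow> t \<le> xw \<Longrightarrow> exchanged r t = g (partner r) t"
    "\<And>t. xw \<le> t \<Longrightarrow> t \<le> xv + pi \<Longrightarrow> exchanged r t = g r t"
    using assms by auto
qed

lemma exchanged_values: "(\<forall>r\<in>G. exchanged r x = g r x) \<or> (\<forall>r\<in>G. exchanged r x = g (partner r) x)"
proof -
  obtain x0 where x0: "[x = x0] (rmod pi)" "xv \<le> x0" "x0 < xv + pi"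
    using rcong_representative[OF pi_gt_zero] .
  have shift: "exchanged r x = g s x \<longleftrightarrow> exchanged r x0 = g s x0" if "r \<in> G" "s \<in> G" for r s
    using antiperiodic_eq_rcong[OF antiperiodic_exchanged[OF that(1)] antiperiodic[OF that(2)] x0(1)] .
  show ?thesis
  proof (cases "x0 \<le> xw")
    case True
    then show ?thesis using exchanged_between x0(2) shift partner_mem by blast
  next
    case False
    then show ?thesis using exchanged_beyond x0(3) shift by (meson less_imp_le not_le)
  qed
qed

lemma exchanged_other:
  assumes "r \<in> G" "r \<noteq> p" "r \<noteq> q" shows "exchanged r = g r"
proof
  fix x show "exchanged r x = g r x"
    using exchanged_values[of x] assms by (auto simp: Transposition.transpose_def)
qed

lemma exchanged_near:
  assumes "xv < x0" "x0 < xv + pi" "x0 \<noteq> xw"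
  obtains \<sigma> where "\<sigma> = id \<or> \<sigma> = partner" "\<forall>\<^sub>F t in nhds x0. \<forall>r\<in>G. exchanged r t = g (\<sigma> r) t"
proof -
  consider "x0 \<in> {xv<..<xw}" | "x0 \<in> {xw<..<xv + pi}" using assms by fastforce
  then show thesis
  proof cases
    case 1
    then have "\<forall>\<^sub>F t in nhds x0. t \<in> {xv<..<xw}" by (intro eventually_nhds_in_open) auto
    then have "\<forall>\<^sub>F t in nhds x0. \<forall>r\<in>G. exchanged r t = g (partner r) t"
      by eventually_elim (auto intro: exchanged_between)
    then show thesis using that by blast
  next
    case 2
    then have "\<forall>\<^sub>F t in nhds x0. t \<in> {xw<..<xv + pi}" by (intro eventually_nhds_in_open) auto
    then have "\<forall>\<^sub>F t in nhds x0. \<forall>r\<in>G. exchanged r t = g (id r) t"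
      by eventually_elim (auto intro: exchanged_beyond)
    then show thesis using that by blast
  qed
qed

lemma exchanged_locally:
  assumes "\<not> [xv = x] (rmod pi)" "\<not> [xw = x] (rmod pi)"
  obtains \<sigma> where "\<sigma> = id \<or> \<sigma> = partner"
    "\<And>r. r \<in> G \<Longrightarrow> exchanged r x = g (\<sigma> r) x"
    "\<And>r s. r \<in> G \<Longrightarrow> s \<in> G \<Longrightarrow> crosses (exchanged r) (exchanged s) x \<longleftrightarrow> crosses (g (\<sigma> r)) (g (\<sigma> s)) x"
    "\<And>r s. r \<in> G \<Longrightarrow> s \<in> G \<Longrightarrow> touches (exchanged r) (exchanged s) x \<longleftrightarrow> touches (g (\<sigma> r)) (g (\<sigma> s)) x"
proof -
  obtain x0 where x0: "[x = x0] (rmod pi)" "xv \<le> x0" "x0 < xv + pi"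
    using rcong_representative[OF pi_gt_zero] .
  have "x0 \<noteq> xv" "x0 \<noteq> xw" using x0(1) assms rcong_sym by blast+
  then have "xv < x0" using x0(2) by simp
  obtain \<sigma> where \<sigma>: "\<sigma> = id \<or> \<sigma> = partner" "\<forall>\<^sub>F t in nhds x0. \<forall>r\<in>G. exchanged r t = g (\<sigma> r) t"
    by (rule exchanged_near[OF \<open>xv < x0\<close> x0(3) \<open>x0 \<noteq> xw\<close>])
  have \<sigma>_mem: "\<sigma> r \<in> G" if "r \<in> G" for r using \<sigma>(1) partner_mem that by auto
  have value0: "exchanged r x0 = g (\<sigma> r) x0" if "r \<in> G" for r
    using eventually_nhds_x_imp_x[OF \<sigma>(2)] that by blast
  have near: "\<forall>\<^sub>F t in at x0. exchanged r t = g (\<sigma> r) t \<and> exchanged s t = g (\<sigma> s) t"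
    if "r \<in> G" "s \<in> G" for r s
    using \<sigma>(2) that by (auto simp: eventually_nhds_conv_at elim: eventually_mono)
  note anti = antiperiodic_exchanged antiperiodic[OF \<sigma>_mem]
  show thesis
  proof (rule that[OF \<sigma>(1)])
    show "exchanged r x = g (\<sigma> r) x" if "r \<in> G" for r
      using antiperiodic_eq_rcong[OF anti(1,2)[OF that] x0(1)] value0[OF that] by simp
    show "crosses (exchanged r) (exchanged s) x \<longleftrightarrow> crosses (g (\<sigma> r)) (g (\<sigma> s)) x"
      if "r \<in> G" "s \<in> G" for r s
      using crosses_rcong[OF anti(1)[OF that(1)] anti(1)[OF that(2)] x0(1)]
        crosses_rcong[OF anti(2)[OF that(1)] anti(2)[OF that(2)] x0(1)]
        crosses_cong[OF near[OF that] value0[OF that(1)] value0[OF that(2)]] by simp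
    show "touches (exchanged r) (exchanged s) x \<longleftrightarrow> touches (g (\<sigma> r)) (g (\<sigma> s)) x"
      if "r \<in> G" "s \<in> G" for r s
      using touches_rcong[OF anti(1)[OF that(1)] anti(1)[OF that(2)] x0(1)]
        touches_rcong[OF anti(2)[OF that(1)] anti(2)[OF that(2)] x0(1)]
        touches_cong[OF near[OF that] value0[OF that(1)] value0[OF that(2)]] by simp
  qed
qed

lemma exchanged_pair_meets:
  assumes "[xv = x] (rmod pi) \<or> [xw = x] (rmod pi)"
  shows "g q x = g p x" "exchanged p x = g p x" "exchanged q x = g p x"
proof -
  show eq: "g q x = g p x"
    using antiperiodic_eq_rcong[OF antiperiodic[OF pair(1)] antiperiodic[OF pair(2)]] pair_meets
      assms by metis
  show "exchanged p x = g p x" "exchanged q x = g p x"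
    using exchanged_values[of x] pair eq by auto
qed

lemma exchanged_touches: "touches (exchanged p) (exchanged q) xv"
proof (rule crosses_swap[OF _ _ _ crossing])
  have "\<forall>\<^sub>F t in at_left xv. exchanged r t = g r t" if "r \<in> G" for r
    unfolding eventually_at_left_field
  proof (intro exI[of _ "xw - pi"] conjI allI impI)
    fix t assume "xw - pi < t" "t < xv"
    then have "exchanged r (t + pi) = g r (t + pi)" using exchanged_beyond[OF that] by simp
    then show "exchanged r t = g r t"
      using antiperiodic_add_pi[OF antiperiodic_exchanged[OF that]]
        antiperiodic_add_pi[OF antiperiodic[OF that]] by simp
  qed (use between in simp)
  then show "\<forall>\<^sub>F t in at_left xv. exchanged p t = g p t \<and> exchanged q t = g q t"
    using pair by (simp add: eventually_conj)
  show "\<forall>\<^sub>F t in at_right xv. exchanged p t = g q t \<and> exchanged q t = g p t"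
    unfolding eventually_at_right_field using between pair exchanged_between by (intro exI[of _ xw]) auto
  show "exchanged p xv = exchanged q xv" using exchanged_pair_meets[of xv] by simp
qed

lemma exchanged_crosses: "crosses (exchanged p) (exchanged q) xw"
proof (rule touches_swap[OF _ _ _ contact[unfolded touches_commute[of "g p"]]])
  show "\<forall>\<^sub>F t in at_left xw. exchanged p t = g q t \<and> exchanged q t = g p t"
    unfolding eventually_at_left_field using between pair exchanged_between by (intro exI[of _ xv]) auto
  show "\<forall>\<^sub>F t in at_right xw. exchanged p t = g p t \<and> exchanged q t = g q t"
    unfolding eventually_at_right_field
    using between pair exchanged_beyond by (intro exI[of _ "xv + pi"]) auto
  show "exchanged p xw = exchanged q xw" using exchanged_pair_meets[of xw] by simp
qed

lemma exchanged_pair_crossing: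
  assumes "crosses (exchanged p) (exchanged q) x" shows "[xw = x] (rmod pi)"
proof (rule ccontr)
  assume not_xw: "\<not> [xw = x] (rmod pi)"
  have not_xv: "\<not> [xv = x] (rmod pi)"
    using assms exchanged_touches crosses_not_touches
      touches_rcong[OF antiperiodic_exchanged[OF pair(1)] antiperiodic_exchanged[OF pair(2)]] by blast
  obtain \<sigma> where "\<sigma> = id \<or> \<sigma> = partner" "crosses (g (\<sigma> p)) (g (\<sigma> q)) x"
    using exchanged_locally[OF not_xv not_xw] assms pair(1,2) by metis
  then have "crosses (g p) (g q) x" by (auto simp: crosses_commute)
  then show False using crossing_unique[OF pair crossing] not_xv by blast
qed

lemma exchanged_mixed_crossing:
  assumes r: "r = p \<or> r = q" and s: "s \<in> G" "s \<noteq> p" "s \<noteq> q"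
    and cross: "crosses (exchanged r) (exchanged s) x"
  shows "crosses (g p) (g s) x \<or> crosses (g q) (g s) x"
proof -
  have "r \<in> G" using r pair by blast
  have "\<not> ([xv = x] (rmod pi) \<or> [xw = x] (rmod pi))"
  proof
    assume orbit: "[xv = x] (rmod pi) \<or> [xw = x] (rmod pi)"
    have "exchanged r x = g s x" using crosses_imp_eq[OF cross] exchanged_other[OF s] by simp
    then have "g p x = g s x" using exchanged_pair_meets[OF orbit] r by auto
    then show False
      using no_triple_point[OF pair(1,2) s(1) pair(3), of x] s exchanged_pair_meets(1)[OF orbit] by auto
  qed
  then obtain \<sigma> where "\<sigma> = id \<or> \<sigma> = partner" "crosses (g (\<sigma> r)) (g (\<sigma> s)) x"
    using exchanged_locally[of x] cross \<open>r \<in> G\<close> s(1) by metis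
  then show ?thesis using r s by auto
qed

lemma sparse_exchanged_meetings:
  assumes "r \<in> G" "s \<in> G" "r \<noteq> s" shows "{t. exchanged r t = exchanged s t} sparse_in UNIV"
proof (rule sparse_in_subset2)
  show "{t. g r t = g s t} \<union> {t. g (partner r) t = g (partner s) t} sparse_in UNIV"
    using assms partner_mem by (intro sparse_in_union' sparse_meetings) (auto simp: partner_eq_iff)
  show "{t. exchanged r t = exchanged s t} \<subseteq> {t. g r t = g s t} \<union> {t. g (partner r) t = g (partner s) t}"
  proof
    fix t assume "t \<in> {t. exchanged r t = exchanged s t}"
    then show "t \<in> {t. g r t = g s t} \<union> {t. g (partner r) t = g (partner s) t}"
      using exchanged_values[of t] assms by auto
  qed
qed

lemma exchanged_no_triple_point:
  assumes "r \<in> G" "s \<in> G" "u \<in> G" "r \<noteq> s" "r \<noteq> u" "s \<noteq> u" "exchanged r x = exchanged s x"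
  shows "exchanged r x \<noteq> exchanged u x"
  using exchanged_values[of x]
proof
  assume "\<forall>r\<in>G. exchanged r x = g r x"
  then show ?thesis using no_triple_point[OF assms(1-6)] assms by simp
next
  assume "\<forall>r\<in>G. exchanged r x = g (partner r) x"
  then show ?thesis
    using no_triple_point[OF partner_mem[OF assms(1)] partner_mem[OF assms(2)] partner_mem[OF assms(3)]]
      partner_eq_iff assms by simp
qed

text \<open>Together the two new curves cross a third one as often as the old ones, that is twice, and each of
  them crosses it at least once by antiperiodicity.\<close>

lemma exchanged_mixed_crossing_unique:
  assumes r: "r = p \<or> r = q" and s: "s \<in> G" "s \<noteq> p" "s \<noteq> q"
    and cross: "crosses (exchanged r) (exchanged s) x1" "crosses (exchanged r) (exchanged s) x2"
  shows "[x1 = x2] (rmod pi)"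
proof -
  have mem: "r \<in> G" "partner r \<in> G" "partner r = p \<or> partner r = q" "r \<noteq> partner r" "partner r \<noteq> s"
    "r \<noteq> s"
    using r s pair by auto
  obtain x3 where x3: "crosses (exchanged (partner r)) (exchanged s) x3"
    using antiperiodic_crossing_exists[OF antiperiodic_exchanged[OF mem(2)]
      antiperiodic_exchanged[OF s(1)]
        sparse_exchanged_meetings[OF mem(2) s(1) mem(5)]] by blast
  have distinct: "\<not> [u = x3] (rmod pi)" if "crosses (exchanged r) (exchanged s) u" for u
  proof
    assume "[u = x3] (rmod pi)"
    then have "exchanged r x3 = exchanged s x3"
      using antiperiodic_eq_rcong[OF antiperiodic_exchanged[OF mem(1)] antiperiodic_exchanged[OF s(1)]]
        crosses_imp_eq[OF that] by blast
    then show False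
      using exchanged_no_triple_point[OF s(1) mem(1,2), of x3] mem crosses_imp_eq[OF x3] by auto
  qed
  have unique: "[a = b] (rmod pi)"
    if "crosses (g p) (g s) a \<and> crosses (g p) (g s) b \<or> crosses (g q) (g s) a \<and>
      crosses (g q) (g s) b" for a b
    using that crossing_unique[OF pair(1) s(1)] crossing_unique[OF pair(2) s(1)] s(2,3) by metis
  from exchanged_mixed_crossing[OF r s cross(1)] exchanged_mixed_crossing[OF r s cross(2)]
    exchanged_mixed_crossing[OF mem(3) s x3] unique distinct[OF cross(1)] distinct[OF cross(2)]
  show ?thesis by blast
qed

lemma curve_family_exchanged: "curve_family G exchanged"
proof
  show "finite G" by (rule finite_index)
  show "antiperiodic (exchanged r)" if "r \<in> G" for r by (rule antiperiodic_exchanged[OF that])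
  show "{t. exchanged r t = exchanged s t} sparse_in UNIV" if "r \<in> G" "s \<in> G" "r \<noteq> s" for r s
    by (rule sparse_exchanged_meetings[OF that])
  show "exchanged r x \<noteq> exchanged u x"
    if "r \<in> G" "s \<in> G" "u \<in> G" "r \<noteq> s" "r \<noteq> u" "s \<noteq> u" "exchanged r x = exchanged s x" for r s u x
    by (rule exchanged_no_triple_point[OF that])
  show "[x = x'] (rmod pi)"
    if rs: "r \<in> G" "s \<in> G" "r \<noteq> s"
      and cross:
          "crosses (exchanged r) (exchanged s) x" "crosses (exchanged r) (exchanged s) x'" for r s x x'
  proof -
    consider (pair) "r = p \<and> s = q \<or> r = q \<and> s = p" | (first) "r = p \<or> r = q" "s \<noteq> p" "s \<noteq> q"
      | (second) "s = p \<or> s = q" "r \<noteq> p" "r \<noteq> q" | (other) "r \<noteq> p" "r \<noteq> q" "s \<noteq> p" "s \<noteq> q"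
        using rs(3) by blast
    then show ?thesis
    proof cases
      case pair
      then have "[xw = x] (rmod pi)" "[xw = x'] (rmod pi)"
        using exchanged_pair_crossing cross crosses_commute by metis+
      then show ?thesis using rcong_sym rcong_trans by blast
    next
      case first
      then show ?thesis using exchanged_mixed_crossing_unique rs(2) cross by blast
    next
      case second
      then show ?thesis using exchanged_mixed_crossing_unique rs(1) cross crosses_commute by metis
    next
      case other
      then show ?thesis using crossing_unique[OF rs] cross exchanged_other rs by simp
    qed
  qed
qed

sublocale exchanged: curve_family G exchanged
  by (rule curve_family_exchanged)

lemma exchanged_support_iff: "(\<exists>r\<in>G. exchanged r x = y) \<longleftrightarrow> (\<exists>r\<in>G. g r x = y)"
  using exchanged_values[of x] partner_mem transpose_involutory by metis

lemma contacts_exchanged_off_orbit: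
  assumes "\<not> [xv = x] (rmod pi)" "\<not> [xw = x] (rmod pi)"
  shows "(x, y) \<in> contacts G exchanged \<longleftrightarrow> (x, y) \<in> contacts G g"
proof -
  obtain \<sigma> where \<sigma>: "\<sigma> = id \<or> \<sigma> = partner" "\<And>r. r \<in> G \<Longrightarrow> exchanged r x = g (\<sigma> r) x"
    "\<And>r s. r \<in> G \<Longrightarrow> s \<in> G \<Longrightarrow> touches (exchanged r) (exchanged s) x \<longleftrightarrow> touches (g (\<sigma> r)) (g (\<sigma> s)) x"
    by (rule exchanged_locally[OF assms]) (rule that)
  have \<sigma>_mem: "\<sigma> r \<in> G" "\<sigma> (\<sigma> r) = r" if "r \<in> G" for r using \<sigma>(1) partner_mem that by auto
  have \<sigma>_inj: "\<sigma> r = \<sigma> s \<longleftrightarrow> r = s" for r s using \<sigma>(1) partner_eq_iff by auto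
  show ?thesis
  proof
    assume "(x, y) \<in> contacts G exchanged"
    then obtain r s where "r \<in> G" "s \<in> G" "r \<noteq> s" "exchanged r x = y"
        "touches (exchanged r) (exchanged s) x"
      by (rule contactsE)
    then show "(x, y) \<in> contacts G g"
      using contactsI[of "\<sigma> r" G "\<sigma> s" g x] \<sigma> \<sigma>_mem \<sigma>_inj by auto
  next
    assume "(x, y) \<in> contacts G g"
    then obtain r s where "r \<in> G" "s \<in> G" "r \<noteq> s" "g r x = y" "touches (g r) (g s) x"
      by (rule contactsE)
    then show "(x, y) \<in> contacts G exchanged"
      using contactsI[of "\<sigma> r" G "\<sigma> s" exchanged x] \<sigma> \<sigma>_mem \<sigma>_inj by auto
  qed
qed

lemma contacts_exchanged_off_pair:
  assumes orbit: "[xv = x] (rmod pi) \<or> [xw = x] (rmod pi)" and "y \<noteq> g p x"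
  shows "(x, y) \<in> contacts G exchanged \<longleftrightarrow> (x, y) \<in> contacts G g"
proof -
  have "(x, y) \<in> contacts G h \<longleftrightarrow>
      (\<exists>r\<in>G - {p, q}. \<exists>s\<in>G - {p, q}. r \<noteq> s \<and> g r x = y \<and> touches (g r) (g s) x)"
    if h: "h p x = g p x" "h q x = g p x" "\<And>r. r \<in> G - {p, q} \<Longrightarrow> h r = g r" for h
  proof
    assume "(x, y) \<in> contacts G h"
    then obtain r s where "r \<in> G" "s \<in> G" "r \<noteq> s" "h r x = y" "h s x = y" "touches (h r) (h s) x"
      by (rule contactsE)
    moreover from this have "r \<in> G - {p, q}" "s \<in> G - {p, q}" using h(1,2) assms(2) by auto
    ultimately show "\<exists>r\<in>G - {p, q}. \<exists>s\<in>G - {p, q}. r \<noteq> s \<and> g r x = y \<and> touches (g r) (g s) x"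
      using h(3) by metis
  next
    assume "\<exists>r\<in>G - {p, q}. \<exists>s\<in>G - {p, q}. r \<noteq> s \<and> g r x = y \<and> touches (g r) (g s) x"
    then obtain r s where "r \<in> G - {p, q}" "s \<in> G - {p, q}" "r \<noteq> s" "g r x = y"
        "touches (g r) (g s) x" by blast
    then show "(x, y) \<in> contacts G h" using contactsI[of r G s h x] h(3)[of r] h(3)[of s] by auto
  qed
  from this[of g] this[of exchanged] show ?thesis
    using exchanged_pair_meets[OF orbit] exchanged_other by auto
qed

lemma contacts_iff_contacts_exchanged:
  "(x, y) \<in> contacts G g \<longleftrightarrow>
    (x, y) \<in> contacts G exchanged \<and> \<not> ([xv = x] (rmod pi) \<and> y = g p x) \<or> [xw = x] (rmod pi) \<and> y = g p x"
proof (cases "[xv = x] (rmod pi) \<or> [xw = x] (rmod pi)")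
  case False
  then show ?thesis using contacts_exchanged_off_orbit by blast
next
  case True
  show ?thesis
  proof (cases "y = g p x")
    case False
    then show ?thesis using contacts_exchanged_off_pair[OF True] by blast
  next
    case y: True
    have pair_iff: "(x, y) \<in> contacts G g \<longleftrightarrow> touches (g p) (g q) x"
      using contacts_pair_iff[OF pair, of x y] exchanged_pair_meets(1)[OF True] y by simp
    have "[xw = x] (rmod pi) \<Longrightarrow> touches (g p) (g q) x"
      using touches_rcong[OF antiperiodic[OF pair(1)] antiperiodic[OF pair(2)]] contact by blast
    moreover have "[xv = x] (rmod pi) \<Longrightarrow> \<not> touches (g p) (g q) x"
      using crosses_rcong[OF antiperiodic[OF pair(1)] antiperiodic[OF pair(2)]] crossing
        crosses_not_touches by blast
    ultimately show ?thesis using pair_iff True y by blast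
  qed
qed

theorem flip_exchanged:
  "flip (arrangement_of G exchanged) (arrangement_of G g) (mproj (xv, g p xv)) (mproj (xw, g p xw))"
  unfolding flip_def
proof (intro conjI)
  let ?P = "proj_graph (exchanged p)" and ?Q = "proj_graph (exchanged q)"
  have "?P \<in> arrangement_of G exchanged" "?Q \<in> arrangement_of G exchanged"
    using pair by (simp_all add: arrangement_of_def)
  moreover have "?P \<noteq> ?Q" using inj_onD[OF exchanged.inj_on_proj_graph, of p q] pair by blast
  moreover have "contact_point ?P ?Q (mproj (xv, g p xv))"
    using exchanged.contact_point_curves_iff[OF pair(1,2)] exchanged_touches
      exchanged_pair_meets(2)[of xv] by simp
  moreover have "crossing_point ?P ?Q (mproj (xw, g p xw))"
    using exchanged.crossing_point_curves_iff[OF pair(1,2)] exchanged_crosses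
      exchanged_pair_meets(2)[of xw] by simp
  ultimately show "\<exists>P\<in>arrangement_of G exchanged. \<exists>Q\<in>arrangement_of G exchanged. P \<noteq> Q \<and>
      contact_point P Q (mproj (xv, g p xv)) \<and> crossing_point P Q (mproj (xw, g p xw))" by blast
  have "mproj (x, y) \<in> support (arrangement_of G g) \<longleftrightarrow>
      mproj (x, y) \<in> support (arrangement_of G exchanged)" for x y
    using mem_support_iff exchanged.mem_support_iff exchanged_support_iff by simp
  then show "support (arrangement_of G g) = support (arrangement_of G exchanged)"
    by (metis mproj_cases set_eqI)
  have "mproj (x, y) \<in> contact_points (arrangement_of G g) \<longleftrightarrow> mproj (x, y) \<in>
      contact_points (arrangement_of G exchanged) - {mproj (xv, g p xv)} \<union> {mproj (xw, g p xw)}" for x y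
    unfolding Un_iff Diff_iff singleton_iff mem_contact_points_iff exchanged.mem_contact_points_iff
      mproj_eq_graph_iff[OF antiperiodic[OF pair(1)]] by (rule contacts_iff_contacts_exchanged)
  then show "contact_points (arrangement_of G g) =
      contact_points (arrangement_of G exchanged) - {mproj (xv, g p xv)} \<union> {mproj (xw, g p xw)}"
    by (metis mproj_cases set_eqI)
qed

end

section \<open>Uniqueness of the source\<close>

locale cut_window = contact_free_family I f k for I :: "'a set" and f :: "'a \<Rightarrow> real \<Rightarrow> real"
  and k :: nat +
  fixes W :: "(real \<times> real) set"
  assumes W_subset: "W \<subseteq> vertices I f"
    and W_meets_orbit: "z \<in> vertices I f \<Longrightarrow> \<exists>r. deck r z \<in> W"
    and finite_W: "finite W"
    and W_convex: "follows I f h \<Longrightarrow> (x1, h x1) \<in> W \<Longrightarrow> (x3, h x3) \<in> W \<Longrightarrow> x1 < x2 \<Longrightarrow> x2 < x3 \<Longrightarrow>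
      (x2, h x2) \<in> vertices I f \<Longrightarrow> (x2, h x2) \<in> W"
    and W_width: "follows I f h \<Longrightarrow> (x1, h x1) \<in> W \<Longrightarrow> (x3, h x3) \<in> W \<Longrightarrow> x3 < x1 + pi"
begin

definition contacts_precede_crossings :: "'j set \<Rightarrow> ('j \<Rightarrow> real \<Rightarrow> real) \<Rightarrow> bool" where
  "contacts_precede_crossings G g \<longleftrightarrow> (\<forall>p\<in>G. \<forall>q\<in>G. \<forall>x x'. p \<noteq> q \<longrightarrow> (x, g p x) \<in> W \<longrightarrow> (x', g p x') \<in> W \<longrightarrow>
     touches (g p) (g q) x \<longrightarrow> crosses (g p) (g q) x' \<longrightarrow> x < x')"

lemma vertex_in_W_along:
  assumes "follows I f h" "(x, h x) \<in> vertices I f"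
  obtains x0 where "[x = x0] (rmod pi)" "(x0, h x0) \<in> W"
proof -
  have anti: "antiperiodic h" using assms(1) by (simp add: follows_def)
  obtain r where "deck r (x, h x) \<in> W" using W_meets_orbit[OF assms(2)] by blast
  then show thesis by (intro that[of "x + of_int r * pi"]) (auto simp: deck_graph[OF anti] rcong_altdef)
qed

lemma vertex_in_W_along_pair:
  assumes "covers_kernel G g" "p \<in> G" "q \<in> G" "p \<noteq> q" "g p x = g q x"
  obtains x0 where "[x = x0] (rmod pi)" "(x0, g p x0) \<in> W"
proof -
  have "(x, g p x) \<in> vertices G g" by (rule verticesI[OF assms(2-4)]) (simp_all add: assms(5))
  then have "(x, g p x) \<in> vertices I f" using covers_kernel_vertices_subset[OF assms(1)] by blast
  then show thesis using vertex_in_W_along[OF covers_kernel_follows_lines[OF assms(1,2)]] that by blast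
qed

definition meeting :: "'a \<Rightarrow> 'a \<Rightarrow> real" where
  "meeting \<alpha> \<beta> = (THE x. (x, f \<alpha> x) \<in> W \<and> f \<alpha> x = f \<beta> x)"

lemma follows_line: "\<alpha> \<in> I \<Longrightarrow> follows I f (f \<alpha>)"
  using antiperiodic by (auto simp: follows_def)

lemma line_meetings_rcong:
  assumes "\<alpha> \<in> I" "\<beta> \<in> I" "\<alpha> \<noteq> \<beta>" "f \<alpha> x = f \<beta> x" "f \<alpha> x' = f \<beta> x'"
  shows "[x = x'] (rmod pi)"
  by (rule crossing_unique[OF assms(1-3) meet_crosses[OF assms(1-4)] meet_crosses[OF assms(1-3,5)]])

lemma ex1_meeting_in_W:
  assumes \<alpha>\<beta>: "\<alpha> \<in> I" "\<beta> \<in> I" "\<alpha> \<noteq> \<beta>" shows "\<exists>!x. (x, f \<alpha> x) \<in> W \<and> f \<alpha> x = f \<beta> x"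
proof -
  note line = follows_line[OF \<alpha>\<beta>(1)]
  obtain x where "crosses (f \<alpha>) (f \<beta>) x" using crossing_exists[OF \<alpha>\<beta>] .
  then have x: "f \<alpha> x = f \<beta> x" by (rule crosses_imp_eq)
  then have "(x, f \<alpha> x) \<in> vertices I f" by (intro verticesI[OF \<alpha>\<beta>]) simp_all
  then obtain x0 where x0: "[x = x0] (rmod pi)" "(x0, f \<alpha> x0) \<in> W"
    using vertex_in_W_along[OF line] by blast
  show ?thesis
  proof (intro ex1I[of _ x0] conjI x0(2))
    show "f \<alpha> x0 = f \<beta> x0"
      using antiperiodic_eq_rcong[OF antiperiodic[OF \<alpha>\<beta>(1)] antiperiodic[OF \<alpha>\<beta>(2)] x0(1)] x by simp
    fix x' assume x': "(x', f \<alpha> x') \<in> W \<and> f \<alpha> x' = f \<beta> x'"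
    then have "[x' = x0] (rmod pi)" using line_meetings_rcong[OF \<alpha>\<beta> _ \<open>f \<alpha> x0 = f \<beta> x0\<close>] by blast
    moreover have "x' < x0 + pi" "x0 < x' + pi" using W_width[OF line] x' x0(2) by blast+
    ultimately show "x' = x0" by (intro rcong_imp_eq[of x' _ pi]) (auto simp: abs_if)
  qed
qed

lemma
  assumes "\<alpha> \<in> I" "\<beta> \<in> I" "\<alpha> \<noteq> \<beta>"
  shows meeting_in_W: "(meeting \<alpha> \<beta>, f \<alpha> (meeting \<alpha> \<beta>)) \<in> W"
    and meeting_eq: "f \<alpha> (meeting \<alpha> \<beta>) = f \<beta> (meeting \<alpha> \<beta>)"
    and meeting_unique: "(x, f \<alpha> x) \<in> W \<Longrightarrow> f \<alpha> x = f \<beta> x \<Longrightarrow> x = meeting \<alpha> \<beta>"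
  using theI'[OF ex1_meeting_in_W[OF assms]] the1_equality[OF ex1_meeting_in_W[OF assms], of x]
  by (auto simp: meeting_def)

lemma meeting_commute:
  assumes "\<alpha> \<in> I" "\<beta> \<in> I" "\<alpha> \<noteq> \<beta>" shows "meeting \<alpha> \<beta> = meeting \<beta> \<alpha>"
  by (rule meeting_unique[OF assms(2,1) assms(3)[symmetric]])
    (use meeting_in_W[OF assms] meeting_eq[OF assms] in simp_all)

lemma pair_crossing_in_W:
  assumes "covers_kernel G g" "p \<in> G" "q \<in> G" "p \<noteq> q"
  obtains x where "(x, g p x) \<in> W" "crosses (g p) (g q) x"
proof -
  interpret G: curve_family G g by (rule covers_kernel_family[OF assms(1)])
  obtain x0 where x0: "crosses (g p) (g q) x0" using G.crossing_exists[OF assms(2-4)] .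
  obtain x where "[x0 = x] (rmod pi)" "(x, g p x) \<in> W"
    using vertex_in_W_along_pair[OF assms crosses_imp_eq[OF x0]] .
  then show thesis
    using that x0 crosses_rcong[OF G.antiperiodic[OF assms(2)] G.antiperiodic[OF assms(3)]] by blast
qed

lemma agree_in_W:
  assumes G: "covers_kernel G g" "p \<in> G" and G': "covers_kernel G' g'" "p' \<in> G'"
    and start: "\<forall>\<^sub>F t in at_right x1. g p t = g' p' t"
    and W: "(x1, g p x1) \<in> W" "(x3, g p x3) \<in> W" "x1 < x3"
    and cross: "\<And>x y. (x, y) \<in> W \<Longrightarrow> x1 < x \<Longrightarrow> x < x3 \<Longrightarrow> (x, y) \<in> crossings G g \<longleftrightarrow> (x, y) \<in> crossings G' g'"
  shows "g p x3 = g' p' x3"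
proof (rule agree_along[OF G G' start, of x3])
  fix x assume "x1 < x" "x < x3" "(x, g p x) \<in> vertices I f"
  then show "(x, g p x) \<in> crossings G g \<longleftrightarrow> (x, g p x) \<in> crossings G' g'"
    using W_convex[OF covers_kernel_follows_lines[OF G] W(1,2)] cross by blast
qed (use W(3) in auto)

text \<open>Follow the two curves of \<open>G'\<close> that touch at \<open>(x, y)\<close> up to their crossing. As there is no later
  difference, the two curves of \<open>G\<close> that cross at \<open>(x, y)\<close> run along with them and cross again.\<close>

lemma no_last_difference:
  assumes G: "covers_kernel G g" and G': "covers_kernel G' g'" "contacts_precede_crossings G' g'"
    and W: "(x, y) \<in> W" and cross: "(x, y) \<in> crossings G g" "(x, y) \<notin> crossings G' g'"
    and same: "\<And>x' y'. (x', y') \<in> W \<Longrightarrow> x < x' \<Longrightarrow> (x', y') \<in> crossings G g \<longleftrightarrow> (x', y') \<in> crossings G' g'"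
  shows False
proof -
  interpret G: curve_family G g by (rule covers_kernel_family[OF G])
  interpret G': curve_family G' g' by (rule covers_kernel_family[OF G'(1)])
  obtain p q where pq: "p \<in> G" "q \<in> G" "p \<noteq> q" "g p x = y" "g q x = y" "crosses (g p) (g q) x"
    using cross(1) by (rule crossingsE)
  obtain p' q' where pq': "p' \<in> G'" "q' \<in> G'" "p' \<noteq> q'" "g' p' x = y" "g' q' x = y"
    "\<forall>\<^sub>F t in at_right x. g p t = g' p' t" "\<forall>\<^sub>F t in at_right x. g q t = g' q' t"
    using G.vertex_right_germs[OF G'.curve_family_axioms covers_kernel_follows[OF G G'(1)] pq(1-5)] .
  have contact: "touches (g' p') (g' q') x"
    using G'.crossings_pair_iff[OF pq'(1-5)] G'.crosses_iff_not_touches[OF pq'(1-3)] cross(2)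
      pq'(4,5) by simp
  obtain x' where x': "(x', g' p' x') \<in> W" "crosses (g' p') (g' q') x'"
    using pair_crossing_in_W[OF G'(1) pq'(1-3)] .
  have meet: "g' q' x' = g' p' x'" using crosses_imp_eq[OF x'(2)] by simp
  have Wx: "(x, g' p' x) \<in> W" "(x, g' q' x) \<in> W" using W pq'(4,5) by simp_all
  have "x < x'" using G'(2) x' Wx(1) contact pq'(1-3) unfolding contacts_precede_crossings_def by blast
  have start: "\<forall>\<^sub>F t in at_right x. g' p' t = g p t" "\<forall>\<^sub>F t in at_right x. g' q' t = g q t"
    using pq'(6,7) by (auto elim: eventually_mono)
  have same': "(u, v) \<in> crossings G' g' \<longleftrightarrow> (u, v) \<in> crossings G g"
    if "(u, v) \<in> W" "x < u" "u < x'" for u v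
    using same[OF that(1,2)] by blast
  have p_meets: "g p x' = g' p' x'"
    by (rule agree_in_W[OF G'(1) pq'(1) G pq(1) start(1) Wx(1) x'(1) \<open>x < x'\<close> same', symmetric])
  have "g' q' x' = g q x'"
    by (rule agree_in_W[OF G'(1) pq'(2) G pq(2) start(2) Wx(2) _ \<open>x < x'\<close> same'])
      (use x'(1) meet in simp)
  then have q_meets: "g q x' = g' p' x'" using meet by simp
  have "(x', g' p' x') \<in> crossings G g"
    using same[OF x'(1) \<open>x < x'\<close>] crossingsI[OF pq'(1-3) x'(2)] by blast
  then have "crosses (g p) (g q) x'" unfolding G.crossings_pair_iff[OF pq(1-3) p_meets q_meets] .
  then have "x + pi \<le> x'"
    using G.crossing_unique[OF pq(1-3,6)] rcong_less_imp_add_le \<open>x < x'\<close> by simp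
  moreover have "x' < x + pi"
    by (rule W_width[OF covers_kernel_follows_lines[OF G'(1) pq'(1)] Wx(1) x'(1)])
  ultimately show False by simp
qed

lemma crossings_in_W_unique:
  assumes G: "covers_kernel G g" "contacts_precede_crossings G g"
    and G': "covers_kernel G' g'" "contacts_precede_crossings G' g'" and "z \<in> W"
  shows "z \<in> crossings G g \<longleftrightarrow> z \<in> crossings G' g'"
proof (rule ccontr)
  assume diff: "\<not> ?thesis"
  define B where "B = {z \<in> W. \<not> (z \<in> crossings G g \<longleftrightarrow> z \<in> crossings G' g')}"
  have B: "finite B" "z \<in> B" using finite_W \<open>z \<in> W\<close> diff by (auto simp: B_def)
  then have "Max (fst ` B) \<in> fst ` B" by (intro Max_in) auto
  then obtain x y where xy: "(x, y) \<in> B" "x = Max (fst ` B)" by force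
  have same: "z' \<in> crossings G g \<longleftrightarrow> z' \<in> crossings G' g'" if "z' \<in> W" "x < fst z'" for z'
  proof (rule ccontr)
    assume "\<not> ?thesis"
    then have "z' \<in> B" using that(1) by (simp add: B_def)
    then have "fst z' \<le> x" unfolding xy(2) using B(1) by simp
    then show False using that(2) by simp
  qed
  have "(x, y) \<in> W" using xy(1) by (simp add: B_def)
  consider "(x, y) \<in> crossings G g" "(x, y) \<notin> crossings G' g'" | "(x, y) \<in> crossings G' g'"
      "(x, y) \<notin> crossings G g"
    using xy(1) by (auto simp: B_def)
  then show False
    using no_last_difference[OF G(1) G' \<open>(x, y) \<in> W\<close>] no_last_difference[OF G'(1) G \<open>(x, y) \<in> W\<close>] same
    by cases auto
qed

theorem covering_curves_unique:
  assumes G: "covers_kernel G g" "contacts_precede_crossings G g"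
    and G': "covers_kernel G' g'" "contacts_precede_crossings G' g'" and p: "p \<in> G"
  shows "\<exists>p'\<in>G'. g p = g' p'"
proof -
  interpret G: curve_family G g by (rule covers_kernel_family[OF G(1)])
  interpret G': curve_family G' g' by (rule covers_kernel_family[OF G'(1)])
  have cross: "z \<in> crossings G g \<longleftrightarrow> z \<in> crossings G' g'" if vertex: "z \<in> vertices I f" for z
  proof -
    obtain r where "deck r z \<in> W" using W_meets_orbit[OF vertex] by blast
    then show ?thesis
      using crossings_in_W_unique[OF G G'] by (metis G.deck_mem_crossings_iff G'.deck_mem_crossings_iff)
  qed
  obtain p' where p': "p' \<in> G'" "\<forall>\<^sub>F t in at_right 0. g p t = g' p' t"
    using G'.follows_right_germ[OF covers_kernel_follows[OF G(1) G'(1) p]] by metis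
  have "g p x = g' p' x" for x
  proof -
    obtain x0 where x0: "[x = x0] (rmod pi)" "0 \<le> x0" "x0 < 0 + pi"
      using rcong_representative[OF pi_gt_zero] .
    have "g p x0 = g' p' x0"
      by (rule agree_along[OF G(1) p G'(1) p'(1,2), of pi]) (use cross x0 in auto)
    then show ?thesis
      using antiperiodic_eq_rcong[OF G.antiperiodic[OF p] G'.antiperiodic[OF p'(1)] x0(1)] by simp
  qed
  then show ?thesis using p'(1) by blast
qed

text \<open>In the arrangement before the flip the pair touches first, so following it shows that the corresponding
  pair after the flip crosses first.\<close>

lemma no_increasing_flip_to_source:
  assumes G: "covers_kernel G g" and G': "covers_kernel G' g'" "contacts_precede_crossings G' g'"
    and pq: "p \<in> G" "q \<in> G" "p \<noteq> q"
    and v: "touches (g p) (g q) xv" "(xv, g p xv) \<in> W" and w: "crosses (g p) (g q) xw" "(xw, g p xw) \<in> W"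
    and contact: "(xv, g p xv) \<notin> contacts G' g'" "(xw, g p xw) \<in> contacts G' g'"
      "\<And>x y. \<not> [xv = x] (rmod pi) \<Longrightarrow> \<not> [xw = x] (rmod pi) \<Longrightarrow> (x, y) \<in> contacts G g \<longleftrightarrow>
        (x, y) \<in> contacts G' g'"
  shows "xw < xv"
proof (rule ccontr)
  assume "\<not> xw < xv"
  moreover have "xv \<noteq> xw" using v(1) w(1) crosses_not_touches by blast
  ultimately have "xv < xw" by simp
  interpret G: curve_family G g by (rule covers_kernel_family[OF G])
  interpret G': curve_family G' g' by (rule covers_kernel_family[OF G'(1)])
  note meet = touches_imp_eq[OF v(1), symmetric] crosses_imp_eq[OF w(1), symmetric]
  obtain p' q' where pq': "p' \<in> G'" "q' \<in> G'" "p' \<noteq> q'" "g' p' xv = g p xv" "g' q' xv = g p xv"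
    "\<forall>\<^sub>F t in at_right xv. g p t = g' p' t" "\<forall>\<^sub>F t in at_right xv. g q t = g' q' t"
    using G.vertex_right_germs[OF G'.curve_family_axioms covers_kernel_follows[OF G G'(1)] pq refl
      meet(1)] .
  have cross_v: "crosses (g' p') (g' q') xv"
    using G'.contacts_pair_iff[OF pq'(1-5)] G'.crosses_iff_not_touches[OF pq'(1-3)] contact(1)
      pq'(4,5) by simp
  have width: "xw < xv + pi" by (rule W_width[OF covers_kernel_follows_lines[OF G pq(1)] v(2) w(2)])
  have same: "(x, y) \<in> crossings G g \<longleftrightarrow> (x, y) \<in> crossings G' g'" if "xv < x" "x < xw" for x y
  proof (rule covers_kernel_crossings_iff[OF G G'(1)], rule contact(3))
    show "\<not> [xv = x] (rmod pi)" using rcong_less_imp_add_le[of xv x pi] that width by auto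
    show "\<not> [xw = x] (rmod pi)" using rcong_less_imp_add_le[OF rcong_sym, of xw x pi] that width by auto
  qed
  have p_agrees: "g p xw = g' p' xw"
    by (rule agree_in_W[OF G pq(1) G'(1) pq'(1,6) v(2) w(2) \<open>xv < xw\<close> same])
  have "g q xw = g' q' xw"
    by (rule agree_in_W[OF G pq(2) G'(1) pq'(2,7) _ _ \<open>xv < xw\<close> same]) (use v(2) w(2) meet in simp_all)
  then have "g' q' xw = g p xw" using meet(2) by simp
  then have "touches (g' p') (g' q') xw"
    using G'.contacts_pair_iff[OF pq'(1-3) p_agrees[symmetric]] contact(2) by blast
  then have "xw < xv"
    using G'(2) cross_v pq'(1-4) v(2) w(2) p_agrees unfolding contacts_precede_crossings_def by metis
  then show False using \<open>xv < xw\<close> by simp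
qed

end

section \<open>Greedy counts\<close>

lemma ex_between_notin_finite:
  fixes u v :: real
  assumes "finite V" "u < v" obtains w where "u < w" "w < v" "w \<notin> V"
proof -
  have "infinite ({u<..<v} - V)" using assms by (simp add: infinite_Ioo)
  then obtain w where "w \<in> {u<..<v} - V" using infinite_imp_nonempty by blast
  then show thesis using that by auto
qed

lemma antimono_off_finite:
  fixes \<phi> :: "real \<Rightarrow> 'a::order"
  assumes V: "finite V"
    and step: "\<And>u v. u \<notin> V \<Longrightarrow> v \<notin> V \<Longrightarrow> u \<le> v \<Longrightarrow> card (V \<inter> {u<..<v}) \<le> 1 \<Longrightarrow> \<phi> v \<le> \<phi> u"
    and "u \<notin> V" "v \<notin> V" "u \<le> v"
  shows "\<phi> v \<le> \<phi> u"
  using assms(3-5)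
proof (induction "card (V \<inter> {u<..<v})" arbitrary: u v rule: less_induct)
  case less
  show ?case
  proof (cases "card (V \<inter> {u<..<v}) \<le> Suc 0")
    case True
    then show ?thesis using step less.prems by simp
  next
    case False
    have "finite (V \<inter> {u<..<v})" using V by simp
    then have "\<not> (\<forall>a\<in>V \<inter> {u<..<v}. \<forall>b\<in>V \<inter> {u<..<v}. a = b)"
      using card_le_Suc0_iff_eq[of "V \<inter> {u<..<v}"] False by argo
    then obtain p q where "p \<in> V \<inter> {u<..<v}" "q \<in> V \<inter> {u<..<v}" "p \<noteq> q" by blast
    then have ab: "min p q \<in> V \<inter> {u<..<v}" "max p q \<in> V \<inter> {u<..<v}" "min p q < max p q"
      by (auto simp: min_def max_def)
    obtain w where w: "min p q < w" "w < max p q" "w \<notin> V" using ex_between_notin_finite[OF V ab(3)] .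
    have "max p q \<notin> {u<..<w}" "min p q \<notin> {w<..<v}" "V \<inter> {u<..<w} \<subseteq> V \<inter> {u<..<v}"
      "V \<inter> {w<..<v} \<subseteq> V \<inter> {u<..<v}"
      using ab w by auto
    then have "V \<inter> {u<..<w} \<subset> V \<inter> {u<..<v}" "V \<inter> {w<..<v} \<subset> V \<inter> {u<..<v}" using ab(1,2) by blast+
    then have "card (V \<inter> {u<..<w}) < card (V \<inter> {u<..<v})" "card (V \<inter> {w<..<v}) < card (V \<inter> {u<..<v})"
      using V by (auto intro: psubset_card_mono)
    then have "\<phi> v \<le> \<phi> w" "\<phi> w \<le> \<phi> u" using less ab w by auto
    then show ?thesis by (rule order_trans)
  qed
qed

locale descending_curves = curve_family "{1..n}" f for n :: nat and f :: "nat \<Rightarrow> real \<Rightarrow> real" +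
  fixes k :: nat and X :: "nat \<Rightarrow> nat \<Rightarrow> real" and c :: "nat \<Rightarrow> real"
  assumes kernel_nonempty: "2 * k < n"
    and cut_range: "\<alpha> \<in> {1..n} \<Longrightarrow> \<beta> \<in> {1..n} \<Longrightarrow> \<alpha> < \<beta> \<Longrightarrow>
       X \<alpha> \<beta> - pi < c \<alpha> \<and> c \<alpha> < X \<alpha> \<beta> \<and> X \<alpha> \<beta> - pi < c \<beta> \<and> c \<beta> < X \<alpha> \<beta>"
    and descending: "\<alpha> \<in> {1..n} \<Longrightarrow> \<beta> \<in> {1..n} \<Longrightarrow> \<alpha> < \<beta> \<Longrightarrow> X \<alpha> \<beta> - pi < x \<Longrightarrow> x < X \<alpha> \<beta> \<Longrightarrow> f \<beta> x < f \<alpha> x"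
    and vertex_meet: "\<alpha> \<in> {1..n} \<Longrightarrow> \<beta> \<in> {1..n} \<Longrightarrow> \<alpha> < \<beta> \<Longrightarrow> f \<alpha> (X \<alpha> \<beta>) = f \<beta> (X \<alpha> \<beta>)"
begin

text \<open>Relative to a threshold \<open>t\<close>, the curves with index \<open>> t\<close> are ones and the others are zeros. The
  curves cross the cut at the abscissas \<open>c\<close>, hence the window of the cut is not a vertical strip. Near the
  cut every curve is inside this window or inside the preceding one: \<open>count_after\<close> applies to points of the
  window, \<open>count_before\<close> to points of the preceding one, and \<open>before_cut\<close> tells which is the case.\<close>

abbreviation ones_above :: "nat \<Rightarrow> real \<Rightarrow> real \<Rightarrow> nat" where
  "ones_above t \<equiv> num_above {t<..n} f"

abbreviation zeros_below :: "nat \<Rightarrow> real \<Rightarrow> real \<Rightarrow> nat" where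
  "zeros_below t \<equiv> num_below {1..t} f"

abbreviation height :: "real \<Rightarrow> real \<Rightarrow> nat" where
  "height \<equiv> num_above {1..n} f"

definition off_curves :: "real \<Rightarrow> real \<Rightarrow> bool" where
  "off_curves x y \<longleftrightarrow> (\<forall>\<gamma>\<in>{1..n}. f \<gamma> x \<noteq> y)"

definition near_cut :: "real \<Rightarrow> bool" where
  "near_cut x \<longleftrightarrow> (\<forall>\<alpha>\<in>{1..n}. c \<alpha> - pi < x \<and> x < c \<alpha> + pi)"

definition excess :: "nat \<Rightarrow> nat \<Rightarrow> int" where
  "excess a b = int a - int (min a (min b k))"

definition count_after :: "nat \<Rightarrow> real \<Rightarrow> real \<Rightarrow> int" where
  "count_after t x y = excess (ones_above t x y) (zeros_below t x y)"

definition count_before :: "nat \<Rightarrow> real \<Rightarrow> real \<Rightarrow> int" where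
  "count_before t x y = int n - int k - int t - count_after t (x + pi) (- y)"

definition before_cut :: "nat \<Rightarrow> real \<Rightarrow> real \<Rightarrow> bool" where
  "before_cut t x y \<longleftrightarrow> (\<exists>\<gamma>\<in>{t<..n}. y < f \<gamma> x \<and> x < c \<gamma>)"

definition greedy_count :: "nat \<Rightarrow> real \<Rightarrow> real \<Rightarrow> int" where
  "greedy_count t x y = (if height x y \<le> k then 0 else if n - k \<le> height x y then int n - int k - int t
     else if before_cut t x y then count_before t x y else count_after t x y)"

lemma ascending_after:
  assumes "\<alpha> \<in> {1..n}" "\<beta> \<in> {1..n}" "\<alpha> < \<beta>" "X \<alpha> \<beta> < x" "x < X \<alpha> \<beta> + pi" shows "f \<alpha> x < f \<beta> x"
  using descending[OF assms(1-3), of "x - pi"] assms antiperiodic_diff_pi[OF antiperiodic[OF assms(1)]]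
    antiperiodic_diff_pi[OF antiperiodic[OF assms(2)]] by simp

lemma less_iff_after_vertex:
  assumes \<alpha>\<beta>: "\<alpha> \<in> {1..n}" "\<beta> \<in> {1..n}" "\<alpha> < \<beta>" and x: "\<bar>x - X \<alpha> \<beta>\<bar> < pi"
  shows "f \<alpha> x < f \<beta> x \<longleftrightarrow> X \<alpha> \<beta> < x"
proof -
  consider "x < X \<alpha> \<beta>" | "x = X \<alpha> \<beta>" | "X \<alpha> \<beta> < x" by linarith
  then show ?thesis
  proof cases
    case 1
    then show ?thesis using descending[OF \<alpha>\<beta>, of x] x by simp
  next
    case 2
    then show ?thesis using vertex_meet[OF \<alpha>\<beta>] by simp
  next
    case 3
    then show ?thesis using ascending_after[OF \<alpha>\<beta>, of x] x by simp
  qed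
qed

lemma curve_add_pi: "\<alpha> \<in> {1..n} \<Longrightarrow> f \<alpha> (x + pi) = - f \<alpha> x"
  by (rule antiperiodic_add_pi[OF antiperiodic])

lemma ones_subset: "{t<..n} \<subseteq> {1..n}"
  and zeros_subset: "t \<le> n \<Longrightarrow> {1..t} \<subseteq> {1..n}"
  by auto

lemma off_curves_total:
  assumes "off_curves x y" "S \<subseteq> {1..n}" shows "num_above S f x y + num_below S f x y = card S"
proof -
  have "{\<gamma> \<in> S. f \<gamma> x = y} = {}" using assms by (auto simp: off_curves_def)
  then show ?thesis
    using above_add_through_add_below[of S f x y] assms(2) finite_subset
    by (auto simp del: Collect_empty_eq)
qed

lemma num_above_add_pi: "S \<subseteq> {1..n} \<Longrightarrow> num_above S f (x + pi) (- y) = num_below S f x y"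
  and num_below_add_pi: "S \<subseteq> {1..n} \<Longrightarrow> num_below S f (x + pi) (- y) = num_above S f x y"
  using num_above_shift[of S x 1 y] num_below_shift[of S x 1 y] by simp_all

lemma ones_above_add_threshold:
  assumes "off_curves x y" "t \<le> n" shows "ones_above t x y + t = height x y + zeros_below t x y"
proof -
  have "{\<gamma> \<in> {1..n}. y < f \<gamma> x} = {\<gamma> \<in> {t<..n}. y < f \<gamma> x} \<union> {\<gamma> \<in> {1..t}. y < f \<gamma> x}"
    using assms(2) by auto
  then have "height x y = ones_above t x y + num_above {1..t} f x y"
    unfolding num_above_def by (simp add: card_Un_disjoint disjoint_iff)
  then show ?thesis using off_curves_total[OF assms(1), of "{1..t}"] assms(2) by simp
qed

lemma count_before_cases:
  assumes "off_curves x y" "t \<le> n"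
  obtains A' B' where "A' + ones_above t x y + t = n" "B' + zeros_below t x y = t"
    "count_before t x y = int n - int k - int t - excess A' B'"
    "ones_above t x y + t = height x y + zeros_below t x y"
proof (rule that)
  show "num_below {t<..n} f x y + ones_above t x y + t = n"
    "num_above {1..t} f x y + zeros_below t x y = t"
    using off_curves_total[OF assms(1) ones_subset, of t]
      off_curves_total[OF assms(1) zeros_subset[OF assms(2)]]
      assms(2) by auto
  show "count_before t x y = int n - int k - int t - excess (num_below {t<..n} f x y)
      (num_above {1..t} f x y)"
    by (simp only: count_before_def count_after_def num_above_add_pi[OF ones_subset]
        num_below_add_pi[OF zeros_subset[OF assms(2)]])
qed (rule ones_above_add_threshold[OF assms])

lemma count_before_eq_count_after:
  assumes "off_curves x y" "k \<le> height x y" "height x y \<le> n - k" "k \<le> t" "t \<le> n - k"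
    and "ones_above t x y = 0 \<or> zeros_below t x y = 0"
  shows "count_before t x y = count_after t x y"
proof -
  have "t \<le> n" using assms(5) by simp
  obtain A' B' where counts: "A' + ones_above t x y + t = n" "B' + zeros_below t x y = t"
    "count_before t x y = int n - int k - int t - excess A' B'"
    "ones_above t x y + t = height x y + zeros_below t x y"
    by (rule count_before_cases[OF assms(1) \<open>t \<le> n\<close>])
  have "k \<le> A'" "k \<le> B'" using counts assms kernel_nonempty by linarith+
  then show ?thesis
    using counts assms(6) unfolding count_after_def counts(3) excess_def by (auto simp: min_def)
qed

lemma counts_at_lower_boundary:
  assumes "off_curves x y" "k \<le> t" "t \<le> n - k" "height x y = k"
  shows "count_after t x y = 0 \<and> count_before t x y = 0"
proof -
  have "t \<le> n" "t + k \<le> n" using assms(3) kernel_nonempty by simp_all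
  obtain A' B' where counts: "A' + ones_above t x y + t = n" "B' + zeros_below t x y = t"
    "count_before t x y = int n - int k - int t - excess A' B'"
    "ones_above t x y + t = height x y + zeros_below t x y"
    by (rule count_before_cases[OF assms(1) \<open>t \<le> n\<close>])
  have "ones_above t x y \<le> zeros_below t x y" "ones_above t x y \<le> k" "B' \<le> A'" "B' \<le> k"
    "int A' - int B' = int n - int k - int t"
    using counts \<open>t + k \<le> n\<close> assms(2,4) by linarith+
  then show ?thesis unfolding count_after_def counts(3) excess_def by (simp add: min_def)
qed

lemma counts_at_upper_boundary:
  assumes "off_curves x y" "k \<le> t" "t \<le> n - k" "height x y = n - k"
  shows "count_after t x y = int n - int k - int t \<and> count_before t x y = int n - int k - int t"
proof -
  have "t \<le> n" "t + k \<le> n" using assms(3) kernel_nonempty by simp_all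
  obtain A' B' where counts: "A' + ones_above t x y + t = n" "B' + zeros_below t x y = t"
    "count_before t x y = int n - int k - int t - excess A' B'"
    "ones_above t x y + t = height x y + zeros_below t x y"
    by (rule count_before_cases[OF assms(1) \<open>t \<le> n\<close>])
  have "zeros_below t x y \<le> ones_above t x y" "zeros_below t x y \<le> k" "A' \<le> B'" "A' \<le> k"
    "int (ones_above t x y) - int (zeros_below t x y) = int n - int k - int t"
    using counts \<open>t + k \<le> n\<close> assms(2,4) kernel_nonempty by linarith+
  then show ?thesis unfolding count_after_def counts(3) excess_def by (simp add: min_def)
qed

lemma greedy_count_inside:
  assumes "off_curves x y" "k \<le> t" "t \<le> n - k" "k \<le> height x y" "height x y \<le> n - k"
  shows "greedy_count t x y = (if before_cut t x y then count_before t x y else count_after t x y)"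
  using counts_at_lower_boundary[OF assms(1-3)] counts_at_upper_boundary[OF assms(1-3)] assms(4,5)
    kernel_nonempty
  by (auto simp: greedy_count_def)

text \<open>All ones above a point are inverted with all zeros below it, so these curves are all on the same side
  of the cut: \<open>before_cut\<close> does not depend on the choice of \<open>\<gamma>\<close>.\<close>

lemma inverted_same_side:
  assumes "near_cut x" "\<gamma> \<in> {1..n}" "\<delta> \<in> {1..n}" "\<delta> < \<gamma>" "f \<delta> x < f \<gamma> x"
  shows "c \<gamma> < x \<and> c \<delta> < x \<or> x < c \<gamma> \<and> x < c \<delta>"
proof -
  note vertex = vertex_meet[OF assms(3,2,4)]
  have "\<not> (X \<delta> \<gamma> - pi < x \<and> x < X \<delta> \<gamma>)" using descending[OF assms(3,2,4), of x] assms(5) by auto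
  moreover have "x \<noteq> X \<delta> \<gamma>" using vertex assms(5) by auto
  moreover have "x \<noteq> X \<delta> \<gamma> - pi"
    using vertex assms antiperiodic_diff_pi[OF antiperiodic, of \<delta> "X \<delta> \<gamma>"]
      antiperiodic_diff_pi[OF antiperiodic, of \<gamma> "X \<delta> \<gamma>"] by auto
  ultimately have "x < X \<delta> \<gamma> - pi \<or> X \<delta> \<gamma> < x" by linarith
  then show ?thesis using cut_range[OF assms(3,2,4)] by auto
qed

lemma greedy_count_cong:
  assumes off: "off_curves x y" "off_curves x0 y0" and near: "near_cut x" "near_cut x0"
    and t: "k \<le> t" "t \<le> n - k"
    and same_above: "\<And>\<gamma>. \<gamma> \<in> {1..n} \<Longrightarrow> y < f \<gamma> x \<longleftrightarrow> y0 < f \<gamma> x0"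
    and same_side: "\<And>\<gamma>. \<gamma> \<in> {1..n} \<Longrightarrow> c \<gamma> \<noteq> x0 \<Longrightarrow> x < c \<gamma> \<longleftrightarrow> x0 < c \<gamma>"
  shows "greedy_count t x y = greedy_count t x0 y0"
proof -
  have same_below: "f \<gamma> x < y \<longleftrightarrow> f \<gamma> x0 < y0" if "\<gamma> \<in> {1..n}" for \<gamma>
    using same_above[OF that] off that unfolding off_curves_def by (metis less_asym linorder_neqE)
  have same: "num_above S f x y = num_above S f x0 y0" "num_below S f x y = num_below S f x0 y0"
    if "S \<subseteq> {1..n}" for S
    unfolding num_above_def num_below_def using same_above same_below that
    by (auto intro!: arg_cong[where f = card])
  have "t \<le> n" using t by simp
  have after: "count_after t x y = count_after t x0 y0"
    unfolding count_after_def by (simp only: same[OF ones_subset] same[OF zeros_subset[OF \<open>t \<le> n\<close>]])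
  have before: "count_before t x y = count_before t x0 y0"
    unfolding count_before_def count_after_def
    by (simp only: num_above_add_pi[OF ones_subset] num_below_add_pi[OF zeros_subset[OF \<open>t \<le> n\<close>]]
        same[OF ones_subset] same[OF zeros_subset[OF \<open>t \<le> n\<close>]])
  show ?thesis
  proof (cases "k < height x y \<and> height x y < n - k \<and> ones_above t x0 y0 \<noteq> 0 \<and> zeros_below t x0 y0 \<noteq> 0")
    case False
    then show ?thesis
      using count_before_eq_count_after[OF off(2), of t] t same[OF subset_refl]
      by (auto simp: greedy_count_def after before)
  next
    case True
    then obtain \<delta> where \<delta>: "\<delta> \<in> {1..t}" "f \<delta> x0 < y0" unfolding num_below_def
      by (metis (mono_tags, lifting) card.empty empty_Collect_eq)
    have "c \<gamma> \<noteq> x0" if "\<gamma> \<in> {t<..n}" "y0 < f \<gamma> x0" for \<gamma>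
      using inverted_same_side[OF near(2), of \<gamma> \<delta>] that \<delta> \<open>t \<le> n\<close> by auto
    then have "before_cut t x y \<longleftrightarrow> before_cut t x0 y0" unfolding before_cut_def
      using same_above same_side by force
    then show ?thesis using same[OF subset_refl] by (simp add: greedy_count_def after before)
  qed
qed

definition adjacent :: "nat \<Rightarrow> real \<Rightarrow> real \<Rightarrow> bool" where
  "adjacent \<alpha> x y \<longleftrightarrow> (\<forall>\<gamma>\<in>{1..n}. \<gamma> \<noteq> \<alpha> \<longrightarrow> (y < f \<gamma> x \<longleftrightarrow> f \<alpha> x < f \<gamma> x) \<and> (f \<gamma> x < y \<longleftrightarrow> f \<gamma> x < f \<alpha> x))"

lemma greedy_count_adjacent:
  assumes off: "off_curves x y" and near: "near_cut x" and t: "k \<le> t" "t \<le> n - k"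
    and height: "k \<le> height x y" "height x y \<le> n - k"
    and \<alpha>: "\<alpha> \<in> {1..n}" and adj: "adjacent \<alpha> x y"
  shows "greedy_count t x y = (if c \<alpha> \<le> x then count_after t x y else count_before t x y)"
proof (cases "ones_above t x y = 0 \<or> zeros_below t x y = 0")
  case True
  then show ?thesis
    using count_before_eq_count_after[OF off height t] greedy_count_inside[OF off t height] by auto
next
  case False
  then obtain \<delta> \<gamma> where \<delta>: "\<delta> \<in> {1..t}" "f \<delta> x < y" and \<gamma>: "\<gamma> \<in> {t<..n}" "y < f \<gamma> x"
    unfolding num_above_def num_below_def by (metis (mono_tags, lifting) card.empty empty_Collect_eq)
  have "t \<le> n" using t by simp
  then have "\<delta> \<in> {1..n}" using \<delta> by simp
  have side_\<delta>: "c \<gamma>' < x \<and> c \<delta> < x \<or> x < c \<gamma>' \<and> x < c \<delta>" if "\<gamma>' \<in> {t<..n}" "y < f \<gamma>' x" for \<gamma>'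
    using inverted_same_side[OF near _ \<open>\<delta> \<in> {1..n}\<close>, of \<gamma>'] that \<delta> by force
  have "before_cut t x y \<longleftrightarrow> \<not> c \<alpha> \<le> x"
  proof (cases "t < \<alpha>")
    case True
    then have "f \<delta> x < f \<alpha> x" using bspec[OF adj[unfolded adjacent_def] \<open>\<delta> \<in> {1..n}\<close>] \<delta> by auto
    then have "c \<alpha> < x \<and> c \<delta> < x \<or> x < c \<alpha> \<and> x < c \<delta>"
      using inverted_same_side[OF near \<alpha> \<open>\<delta> \<in> {1..n}\<close>] \<delta> True by auto
    then show ?thesis using side_\<delta> \<gamma> unfolding before_cut_def by (metis less_asym not_less)
  next
    case False
    have "c \<gamma>' < x \<and> c \<alpha> < x \<or> x < c \<gamma>' \<and> x < c \<alpha>" if "\<gamma>' \<in> {t<..n}" "y < f \<gamma>' x" for \<gamma>'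
      using inverted_same_side[OF near, of \<gamma>' \<alpha>] bspec[OF adj[unfolded adjacent_def], of \<gamma>'] that \<alpha>
        False by auto
    then show ?thesis using \<gamma> unfolding before_cut_def by (metis less_asym not_less)
  qed
  then show ?thesis using greedy_count_inside[OF off t height] by auto
qed

text \<open>A curve carries a greedy curve with index \<open>> t - k\<close> iff the count increases by one on passing below
  it. As this property is antitone in \<open>t\<close>, it encodes the index of the greedy curve.\<close>

definition carries_after :: "nat \<Rightarrow> nat \<Rightarrow> real \<Rightarrow> bool" where
  "carries_after \<alpha> t x \<longleftrightarrow> t < \<alpha> \<and> min (zeros_below t x (f \<alpha> x)) k \<le> ones_above t x (f \<alpha> x) \<or>
     \<alpha> \<le> t \<and> zeros_below t x (f \<alpha> x) < min (ones_above t x (f \<alpha> x)) k"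

definition carries :: "nat \<Rightarrow> nat \<Rightarrow> real \<Rightarrow> bool" where
  "carries \<alpha> t x \<longleftrightarrow> (if c \<alpha> \<le> x then carries_after \<alpha> t x else carries_after \<alpha> t (x + pi))"

definition in_kernel :: "nat \<Rightarrow> real \<Rightarrow> bool" where
  "in_kernel \<alpha> x \<longleftrightarrow> k \<le> height x (f \<alpha> x) \<and> height x (f \<alpha> x) < n - k"

lemma counts_around_curve:
  assumes \<alpha>: "\<alpha> \<in> {1..n}" and y: "y2 < f \<alpha> x" "f \<alpha> x < y1" and adj: "adjacent \<alpha> x y1" "adjacent \<alpha> x y2"
    and S: "S \<subseteq> {1..n}"
  shows "num_above S f x y1 = num_above S f x (f \<alpha> x)"
    "num_above S f x y2 = num_above S f x (f \<alpha> x) + of_bool (\<alpha> \<in> S)"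
    "num_below S f x y2 = num_below S f x (f \<alpha> x)"
    "num_below S f x y1 = num_below S f x (f \<alpha> x) + of_bool (\<alpha> \<in> S)"
proof -
  have order: "y1 < f \<gamma> x \<longleftrightarrow> f \<alpha> x < f \<gamma> x" "y2 < f \<gamma> x \<longleftrightarrow> f \<alpha> x < f \<gamma> x \<or> \<gamma> = \<alpha>"
    "f \<gamma> x < y2 \<longleftrightarrow> f \<gamma> x < f \<alpha> x" "f \<gamma> x < y1 \<longleftrightarrow> f \<gamma> x < f \<alpha> x \<or> \<gamma> = \<alpha>" if "\<gamma> \<in> S" for \<gamma>
    using bspec[OF adj(1)[unfolded adjacent_def], of \<gamma>]
      bspec[OF adj(2)[unfolded adjacent_def], of \<gamma>] y subsetD[OF S that]
    by (cases "\<gamma> = \<alpha>"; auto)+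
  have finS: "finite S" using S finite_subset by blast
  have "{\<gamma> \<in> S. y2 < f \<gamma> x} = (if \<alpha> \<in> S then {\<alpha>} else {}) \<union> {\<gamma> \<in> S. f \<alpha> x < f \<gamma> x}"
    "{\<gamma> \<in> S. f \<gamma> x < y1} = (if \<alpha> \<in> S then {\<alpha>} else {}) \<union> {\<gamma> \<in> S. f \<gamma> x < f \<alpha> x}"
    using order by (auto split: if_splits)
  then show "num_above S f x y2 = num_above S f x (f \<alpha> x) + of_bool (\<alpha> \<in> S)"
    "num_below S f x y1 = num_below S f x (f \<alpha> x) + of_bool (\<alpha> \<in> S)"
    unfolding num_above_def num_below_def using finS by auto
  show "num_above S f x y1 = num_above S f x (f \<alpha> x)" "num_below S f x y2 = num_below S f x (f \<alpha> x)"
    unfolding num_above_def num_below_def using order by (auto intro!: arg_cong[where f = card])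
qed

lemma adjacent_off_curves:
  assumes "adjacent \<alpha> x y" "f \<alpha> x \<noteq> y" shows "off_curves x y"
  using assms unfolding adjacent_def off_curves_def by (metis less_irrefl linorder_neqE)

lemma count_after_step:
  assumes "\<alpha> \<in> {1..n}" "y2 < f \<alpha> x" "f \<alpha> x < y1" "t \<le> n" "adjacent \<alpha> x y1" "adjacent \<alpha> x y2"
  shows "count_after t x y2 - count_after t x y1 = of_bool (carries_after \<alpha> t x)"
proof -
  have excess_step: "excess (a + 1) b - excess a b = of_bool (min b k \<le> a)"
    "excess a b - excess a (b + 1) = of_bool (b < min a k)" for a b
    by (auto simp: excess_def min_def)
  have "{t<..n} \<subseteq> {1..n}" "{1..t} \<subseteq> {1..n}" "\<alpha> \<in> {t<..n} \<longleftrightarrow> t < \<alpha>" "\<alpha> \<in> {1..t} \<longleftrightarrow> \<not> t < \<alpha>"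
    using assms(1,4) by auto
  then show ?thesis
    using excess_step counts_around_curve[OF assms(1-3,5,6), of "{t<..n}"]
      counts_around_curve[OF assms(1-3,5,6), of "{1..t}"]
    by (cases "t < \<alpha>") (simp_all add: count_after_def carries_after_def)
qed

lemma count_before_step:
  assumes "\<alpha> \<in> {1..n}" "y2 < f \<alpha> x" "f \<alpha> x < y1" "t \<le> n" and adj: "adjacent \<alpha> x y1" "adjacent \<alpha> x y2"
  shows "count_before t x y2 - count_before t x y1 = of_bool (carries_after \<alpha> t (x + pi))"
proof -
  have "count_after t (x + pi) (- y1) - count_after t (x + pi) (- y2) =
      of_bool (carries_after \<alpha> t (x + pi))"
  proof (rule count_after_step)
    show "adjacent \<alpha> (x + pi) (- y2)" "adjacent \<alpha> (x + pi) (- y1)"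
      using adj assms(1) unfolding adjacent_def by (auto simp: curve_add_pi)
  qed (use assms in \<open>auto simp: curve_add_pi\<close>)
  then show ?thesis by (simp add: count_before_def)
qed

lemma greedy_count_step:
  assumes "\<alpha> \<in> {1..n}" "y2 < f \<alpha> x" "f \<alpha> x < y1" "near_cut x" "k \<le> t" "t \<le> n - k"
    and adj: "adjacent \<alpha> x y1" "adjacent \<alpha> x y2"
  shows "greedy_count t x y2 - greedy_count t x y1 = of_bool (in_kernel \<alpha> x \<and> carries \<alpha> t x)"
proof -
  have t: "t \<le> n" using assms by simp
  have heights: "height x y1 = height x (f \<alpha> x)" "height x y2 = height x (f \<alpha> x) + 1"
    using counts_around_curve(1,2)[OF assms(1-3) adj subset_refl] assms(1) by simp_all
  show ?thesis
  proof (cases "in_kernel \<alpha> x")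
    case True
    then have "greedy_count t x y = (if c \<alpha> \<le> x then count_after t x y else count_before t x y)"
      if "y \<in> {y1, y2}" for y
      using that assms adj heights adjacent_off_curves[of \<alpha> x y]
      by (intro greedy_count_adjacent) (auto simp: in_kernel_def)
    then show ?thesis
      using count_after_step[OF assms(1-3) t adj] count_before_step[OF assms(1-3) t adj] True
      by (simp add: carries_def)
  next
    case False
    then consider "height x y1 \<le> k" "height x y2 \<le> k" | "n - k \<le> height x y1" "n - k \<le> height x y2"
        "\<not> height x y1 \<le> k" "\<not> height x y2 \<le> k"
      using heights kernel_nonempty unfolding in_kernel_def by linarith
    then have "greedy_count t x y2 = greedy_count t x y1" by cases (simp_all add: greedy_count_def)
    then show ?thesis using False by simp
  qed
qed

lemma carries_after_Suc:
  assumes "carries_after \<alpha> (Suc t) x" "Suc t \<le> n" shows "carries_after \<alpha> t x"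
proof -
  let ?y = "f \<alpha> x"
  have "{t<..n} = insert (Suc t) {Suc t<..n}" using assms(2) by auto
  then have "{\<gamma> \<in> {t<..n}. ?y < f \<gamma> x} =
      {\<gamma> \<in> {Suc t<..n}. ?y < f \<gamma> x} \<union> (if ?y < f (Suc t) x then {Suc t} else {})"
    by auto
  then have ones: "ones_above t x ?y = ones_above (Suc t) x ?y + (if ?y < f (Suc t) x then 1 else 0)"
    by (simp add: num_above_def)
  have "{\<delta> \<in> {1..Suc t}. f \<delta> x < ?y} =
      {\<delta> \<in> {1..t}. f \<delta> x < ?y} \<union> (if f (Suc t) x < ?y then {Suc t} else {})"
    by (auto simp: le_Suc_eq)
  then have zeros: "zeros_below (Suc t) x ?y = zeros_below t x ?y + (if f (Suc t) x < ?y then 1 else 0)"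
    by (simp add: num_below_def)
  show ?thesis
  proof (cases "\<alpha> = Suc t")
    case True
    then show ?thesis
      using assms(1) ones zeros by (auto simp: carries_after_def min_def split: if_splits)
  next
    case False
    then have "t < \<alpha> \<longleftrightarrow> Suc t < \<alpha>" "\<alpha> \<le> t \<longleftrightarrow> \<alpha> \<le> Suc t" by auto
    then show ?thesis
      using assms(1) ones zeros by (auto simp: carries_after_def min_def split: if_splits)
  qed
qed

lemma carries_after_antimono:
  assumes "carries_after \<alpha> t' x" "t \<le> t'" "t' \<le> n" shows "carries_after \<alpha> t x"
  using assms(2,1,3) by (induction t' rule: dec_induct) (auto intro: carries_after_Suc)

lemma carries_antimono: "carries \<alpha> t' x \<Longrightarrow> t \<le> t' \<Longrightarrow> t' \<le> n \<Longrightarrow> carries \<alpha> t x"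
  using carries_after_antimono unfolding carries_def by presburger

definition clamp_level :: "nat \<Rightarrow> nat" where
  "clamp_level i = min (max i k) (n - k)"

lemma greedy_count_first:
  assumes "off_curves x y" shows "greedy_count k x y = int (clamp_level (height x y)) - int k"
proof (cases "k < height x y \<and> height x y < n - k")
  case True
  have k: "k \<le> n" "k \<le> k" "k \<le> n - k" using kernel_nonempty by simp_all
  obtain A' B' where counts: "A' + ones_above k x y + k = n" "B' + zeros_below k x y = k"
    "count_before k x y = int n - int k - int k - excess A' B'"
    "ones_above k x y + k = height x y + zeros_below k x y" by (rule count_before_cases[OF assms k(1)])
  have "zeros_below k x y \<le> ones_above k x y" "zeros_below k x y \<le> k" "B' \<le> A'" "B' \<le> k"
    using counts True by linarith+
  then have "count_after k x y = int (ones_above k x y) - int (zeros_below k x y)"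
    "count_before k x y = int n - int k - int k - int A' + int B'"
    unfolding count_after_def counts(3) excess_def by simp_all
  then have "count_after k x y = int (height x y) - int k"
    "count_before k x y = int (height x y) - int k"
    using counts by linarith+
  then show ?thesis using greedy_count_inside[OF assms k(2,3)] True by (simp add: clamp_level_def)
qed (use kernel_nonempty in \<open>auto simp: greedy_count_def clamp_level_def of_nat_diff\<close>)

lemma greedy_count_last:
  assumes "off_curves x y" shows "greedy_count (n - k) x y = 0"
proof (cases "k < height x y \<and> height x y < n - k")
  case True
  let ?t = "n - k"
  have t: "?t \<le> n" "k \<le> ?t" "?t \<le> n - k" using kernel_nonempty by simp_all
  obtain A' B' where counts: "A' + ones_above ?t x y + ?t = n" "B' + zeros_below ?t x y = ?t"
    "count_before ?t x y = int n - int k - int ?t - excess A' B'"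
    "ones_above ?t x y + ?t = height x y + zeros_below ?t x y"
      by (rule count_before_cases[OF assms t(1)])
  have "ones_above ?t x y \<le> zeros_below ?t x y" "ones_above ?t x y \<le> k" "A' \<le> B'" "A' \<le> k"
    using counts True kernel_nonempty by linarith+
  then have "count_after ?t x y = 0" "count_before ?t x y = 0"
    unfolding count_after_def counts(3) excess_def using kernel_nonempty by simp_all
  then show ?thesis using greedy_count_inside[OF assms t(2,3)] True by simp
qed (use kernel_nonempty in \<open>auto simp: greedy_count_def of_nat_diff\<close>)

lemma greedy_count_add_pi:
  assumes off: "off_curves x y" and near: "near_cut x" "near_cut (x + pi)" and t: "k \<le> t" "t \<le> n - k"
  shows "greedy_count t (x + pi) (- y) = int n - int k - int t - greedy_count t x y"
proof -
  have c: "c \<gamma> < x + pi" "x < c \<gamma>" if "\<gamma> \<in> {t<..n}" for \<gamma>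
  proof -
    have "\<gamma> \<in> {1..n}" using that by auto
    then show "c \<gamma> < x + pi" "x < c \<gamma>" using near unfolding near_cut_def by (auto dest!: bspec[of _ _ \<gamma>])
  qed
  have "height (x + pi) (- y) + height x y = n"
    using off_curves_total[OF off subset_refl] by (simp add: num_above_add_pi)
  then consider "height x y \<le> k" "n - k \<le> height (x + pi) (- y)" "\<not> height (x + pi) (- y) \<le> k"
    | "n - k \<le> height x y" "height (x + pi) (- y) \<le> k" "\<not> height x y \<le> k"
    | "k < height x y" "height x y < n - k" "k < height (x + pi) (- y)" "height (x + pi) (- y) < n - k"
    using kernel_nonempty by linarith
  moreover have "\<not> before_cut t (x + pi) (- y)" using c by (force simp: before_cut_def)
  moreover have "before_cut t x y \<longleftrightarrow> ones_above t x y \<noteq> 0"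
  proof -
    have "before_cut t x y \<longleftrightarrow> {\<gamma> \<in> {t<..n}. y < f \<gamma> x} \<noteq> {}" unfolding before_cut_def using c(2) by blast
    then show ?thesis unfolding num_above_def by (subst card_0_eq) simp_all
  qed
  moreover have "count_after t (x + pi) (- y) = int n - int k - int t - count_before t x y"
    by (simp add: count_before_def)
  moreover have "k < height x y \<Longrightarrow> height x y < n - k \<Longrightarrow> ones_above t x y = 0 \<Longrightarrow>
      count_before t x y = count_after t x y"
    using count_before_eq_count_after[OF off _ _ t] by simp
  ultimately show ?thesis by cases (auto simp: greedy_count_def)
qed

lemma eventually_same_side_of_cut:
  assumes "near_cut x0"
  shows "\<forall>\<^sub>F x in nhds x0. near_cut x \<and> (\<forall>\<gamma>\<in>{1..n}. c \<gamma> \<noteq> x0 \<longrightarrow> (x < c \<gamma> \<longleftrightarrow> x0 < c \<gamma>))"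
proof -
  have lim: "((\<lambda>x. x) \<longlongrightarrow> x0) (nhds x0)" by (rule filterlim_ident)
  have "\<forall>\<^sub>F x in nhds x0. \<forall>\<gamma>\<in>{1..n}. (x0 < c \<gamma> \<longrightarrow> x < c \<gamma>) \<and> (c \<gamma> < x0 \<longrightarrow> c \<gamma> < x) \<and>
      c \<gamma> - pi < x \<and> x < c \<gamma> + pi"
  proof (intro eventually_ball_finite ballI eventually_conj)
    fix \<gamma> assume \<gamma>: "\<gamma> \<in> {1..n}"
    show "\<forall>\<^sub>F x in nhds x0. x0 < c \<gamma> \<longrightarrow> x < c \<gamma>"
      using order_tendstoD(2)[OF lim, of "c \<gamma>"] by (cases "x0 < c \<gamma>") auto
    show "\<forall>\<^sub>F x in nhds x0. c \<gamma> < x0 \<longrightarrow> c \<gamma> < x"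
      using order_tendstoD(1)[OF lim, of "c \<gamma>"] by (cases "c \<gamma> < x0") auto
    show "\<forall>\<^sub>F x in nhds x0. c \<gamma> - pi < x" "\<forall>\<^sub>F x in nhds x0. x < c \<gamma> + pi"
      using order_tendstoD[OF lim] assms \<gamma> unfolding near_cut_def by blast+
  qed simp
  then show ?thesis
  proof eventually_elim
    case (elim x)
    have "x < c \<gamma> \<longleftrightarrow> x0 < c \<gamma>" if "\<gamma> \<in> {1..n}" "c \<gamma> \<noteq> x0" for \<gamma>
      using bspec[OF elim that(1)] that(2) by linarith
    then show ?case using elim by (auto simp: near_cut_def)
  qed
qed

lemma greedy_count_locally_constant:
  assumes off: "off_curves x0 y0" and near: "near_cut x0"
  shows "\<forall>\<^sub>F z in nhds (x0, y0). near_cut (fst z) \<and> off_curves (fst z) (snd z) \<and>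
    (\<forall>t\<in>{k..n - k}. greedy_count t (fst z) (snd z) = greedy_count t x0 y0)"
proof -
  have "filterlim fst (nhds x0) (nhds (x0, y0))"
    using tendsto_fst[OF filterlim_ident, of "(x0, y0)"] by simp
  from eventually_order_preserved[of "(x0, y0)"]
      eventually_compose_filterlim[OF eventually_same_side_of_cut[OF near] this]
  show ?thesis
  proof eventually_elim
    case (elim z)
    have same_above: "snd z < f \<gamma> (fst z) \<longleftrightarrow> y0 < f \<gamma> x0" and "f \<gamma> (fst z) \<noteq> snd z" if "\<gamma> \<in> {1..n}" for \<gamma>
      using elim(1) off that
      unfolding off_curves_def fst_conv snd_conv by (metis less_asym less_irrefl linorder_neqE)+
    then have off_z: "off_curves (fst z) (snd z)" by (simp add: off_curves_def)
    have "greedy_count t (fst z) (snd z) = greedy_count t x0 y0" if "t \<in> {k..n - k}" for t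
      by (rule greedy_count_cong[OF off_z off _ near _ _ same_above]) (use elim(2) that in auto)
    then show ?case using off_z elim(2) by blast
  qed
qed

end

section \<open>Greedy curves\<close>

context descending_curves
begin

text \<open>The greedy curve with index \<open>p\<close> is counted by the threshold \<open>k + p - 1\<close> but not by \<open>k + p\<close>.\<close>

definition curve_above :: "nat \<Rightarrow> real \<Rightarrow> real \<Rightarrow> int" where
  "curve_above p x y = greedy_count (k + p - 1) x y - greedy_count (k + p) x y"

definition wire :: "nat \<Rightarrow> real \<Rightarrow> real" where
  "wire p x = Sup {y. off_curves x y \<and> curve_above p x y = 1}"

lemma thresholds:
  assumes "p \<in> {1..n - 2 * k}"
  shows "k \<le> k + p - 1" "k + p - 1 \<le> n - k" "k \<le> k + p" "k + p \<le> n - k" "k + p - 1 \<le> n" "k + p \<le> n"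
  using assms kernel_nonempty by auto

lemma curve_above_locally_constant:
  assumes "off_curves x y" "near_cut x" "p \<in> {1..n - 2 * k}"
  shows "\<forall>\<^sub>F z in nhds (x, y). near_cut (fst z) \<and> off_curves (fst z) (snd z) \<and>
    curve_above p (fst z) (snd z) = curve_above p x y"
  using greedy_count_locally_constant[OF assms(1,2)]
  by eventually_elim (use thresholds[OF assms(3)] in \<open>simp add: curve_above_def\<close>)

lemma curve_above_eventually_fst:
  assumes "off_curves x y" "near_cut x" "p \<in> {1..n - 2 * k}"
  shows "\<forall>\<^sub>F x' in nhds x. near_cut x' \<and> off_curves x' y \<and> curve_above p x' y = curve_above p x y"
proof -
  have "filterlim (\<lambda>x'. (x', y)) (nhds (x, y)) (nhds x)"
    by (intro tendsto_Pair filterlim_ident tendsto_const)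
  from eventually_compose_filterlim[OF curve_above_locally_constant[OF assms] this] show ?thesis by simp
qed

lemma curve_above_eventually_snd:
  assumes "off_curves x y" "near_cut x" "p \<in> {1..n - 2 * k}"
  shows "\<forall>\<^sub>F y' in nhds y. off_curves x y' \<and> curve_above p x y' = curve_above p x y"
proof -
  have "filterlim (\<lambda>y'. (x, y')) (nhds (x, y)) (nhds y)"
    by (intro tendsto_Pair filterlim_ident tendsto_const)
  from eventually_compose_filterlim[OF curve_above_locally_constant[OF assms] this] show ?thesis
    by (rule eventually_mono) simp
qed

lemma curve_above_step:
  assumes "\<alpha> \<in> {1..n}" "y2 < f \<alpha> x" "f \<alpha> x < y1" "near_cut x" "p \<in> {1..n - 2 * k}" "adjacent \<alpha> x y1"
    "adjacent \<alpha> x y2"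
  shows "curve_above p x y2 - curve_above p x y1 =
    of_bool (in_kernel \<alpha> x \<and> carries \<alpha> (k + p - 1) x \<and> \<not> carries \<alpha> (k + p) x)"
proof -
  note t = thresholds[OF assms(5)]
  have "carries \<alpha> (k + p) x \<Longrightarrow> carries \<alpha> (k + p - 1) x"
    using carries_antimono[of \<alpha> "k + p" x "k + p - 1"] t by simp
  then show ?thesis
    using greedy_count_step[OF assms(1-4) t(1,2) assms(6,7)]
      greedy_count_step[OF assms(1-4) t(3,4) assms(6,7)]
    by (cases "in_kernel \<alpha> x"; cases "carries \<alpha> (k + p - 1) x"; cases "carries \<alpha> (k + p) x")
      (simp_all add: curve_above_def)
qed

lemma curve_above_antimono_generic:
  assumes inj: "inj_on (\<lambda>\<alpha>. f \<alpha> x) {1..n}" and near: "near_cut x" and p: "p \<in> {1..n - 2 * k}"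
    and "off_curves x u" "off_curves x v" "u \<le> v"
  shows "curve_above p x v \<le> curve_above p x u"
proof (rule antimono_off_finite[of "(\<lambda>\<gamma>. f \<gamma> x) ` {1..n}"])
  have off_iff: "off_curves x y \<longleftrightarrow> y \<notin> (\<lambda>\<gamma>. f \<gamma> x) ` {1..n}" for y by (auto simp: off_curves_def)
  then show "u \<notin> (\<lambda>\<gamma>. f \<gamma> x) ` {1..n}" "v \<notin> (\<lambda>\<gamma>. f \<gamma> x) ` {1..n}" using assms(4,5) by blast+
  fix u v assume "u \<notin> (\<lambda>\<gamma>. f \<gamma> x) ` {1..n}" "v \<notin> (\<lambda>\<gamma>. f \<gamma> x) ` {1..n}" "u \<le> v"
    and few: "card ((\<lambda>\<gamma>. f \<gamma> x) ` {1..n} \<inter> {u<..<v}) \<le> 1"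
  then have off: "off_curves x u" "off_curves x v" using off_iff by blast+
  show "curve_above p x v \<le> curve_above p x u"
  proof (cases "\<exists>\<alpha>\<in>{1..n}. u < f \<alpha> x \<and> f \<alpha> x < v")
    case False
    have same: "v < f \<gamma> x \<longleftrightarrow> u < f \<gamma> x" if "\<gamma> \<in> {1..n}" for \<gamma>
    proof -
      have "\<not> (u < f \<gamma> x \<and> f \<gamma> x < v)" "f \<gamma> x \<noteq> u" "f \<gamma> x \<noteq> v"
        using False off that unfolding off_curves_def by blast+
      then show ?thesis using \<open>u \<le> v\<close> by linarith
    qed
    have "greedy_count t x v = greedy_count t x u" if "k \<le> t" "t \<le> n - k" for t
      by (rule greedy_count_cong[OF off(2,1) near near that same]) auto
    then show ?thesis using thresholds[OF p] by (simp add: curve_above_def)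
  next
    case True
    then obtain \<alpha> where \<alpha>: "\<alpha> \<in> {1..n}" "u < f \<alpha> x" "f \<alpha> x < v" by blast
    have "f \<gamma> x < u \<or> v < f \<gamma> x" if "\<gamma> \<in> {1..n}" "\<gamma> \<noteq> \<alpha>" for \<gamma>
    proof (rule ccontr)
      assume "\<not> ?thesis"
      moreover have "f \<gamma> x \<noteq> u" "f \<gamma> x \<noteq> v" using off that(1) unfolding off_curves_def by blast+
      ultimately have "f \<gamma> x \<in> {u<..<v}" by simp
      then have "{f \<gamma> x, f \<alpha> x} \<subseteq> (\<lambda>\<gamma>. f \<gamma> x) ` {1..n} \<inter> {u<..<v}" using that(1) \<alpha> by simp
      from card_mono[OF _ this] few have "card {f \<gamma> x, f \<alpha> x} \<le> 1" by simp
      moreover have "f \<gamma> x \<noteq> f \<alpha> x" using inj_onD[OF inj, of \<gamma> \<alpha>] that \<alpha>(1) by auto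
      ultimately show False by simp
    qed
    then have "(v < f \<gamma> x \<longleftrightarrow> f \<alpha> x < f \<gamma> x) \<and> (f \<gamma> x < v \<longleftrightarrow> f \<gamma> x < f \<alpha> x)"
      "(u < f \<gamma> x \<longleftrightarrow> f \<alpha> x < f \<gamma> x) \<and> (f \<gamma> x < u \<longleftrightarrow> f \<gamma> x < f \<alpha> x)" if "\<gamma> \<in> {1..n}" "\<gamma> \<noteq> \<alpha>" for \<gamma>
      using that \<alpha>(2,3) \<open>u \<le> v\<close> by (metis order.asym order.strict_trans)+
    then have "adjacent \<alpha> x v" "adjacent \<alpha> x u" unfolding adjacent_def by blast+
    from curve_above_step[OF \<alpha> near p this] show ?thesis by (auto simp: of_bool_def split: if_splits)
  qed
qed (use assms in auto)

lemma curve_above_antimono: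
  assumes near: "near_cut x" and p: "p \<in> {1..n - 2 * k}" and off: "off_curves x u" "off_curves x v"
    and "u \<le> v"
  shows "curve_above p x v \<le> curve_above p x u"
proof -
  have "\<forall>\<^sub>F x' in at x. near_cut x' \<and> off_curves x' u \<and> curve_above p x' u = curve_above p x u"
    "\<forall>\<^sub>F x' in at x. near_cut x' \<and> off_curves x' v \<and> curve_above p x' v = curve_above p x v"
    using curve_above_eventually_fst[OF off(1) near p] curve_above_eventually_fst[OF off(2) near p]
    by (auto simp: eventually_nhds_conv_at)
  with eventually_inj_on[of x]
  have "\<forall>\<^sub>F x' in at x. curve_above p x v \<le> curve_above p x u"
    by eventually_elim (metis curve_above_antimono_generic[OF _ _ p _ _ \<open>u \<le> v\<close>])
  then show ?thesis by simp
qed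

lemma curve_above_low: "p \<in> {1..n - 2 * k} \<Longrightarrow> n - k \<le> height x y \<Longrightarrow> curve_above p x y = 1"
  using kernel_nonempty by (auto simp: curve_above_def greedy_count_def of_nat_diff)

lemma curve_above_high: "height x y \<le> k \<Longrightarrow> curve_above p x y = 0"
  by (simp add: curve_above_def greedy_count_def)

lemma off_curves_between:
  assumes "u < v" obtains y where "u < y" "y < v" "off_curves x y"
proof -
  obtain y where "u < y" "y < v" "y \<notin> (\<lambda>\<gamma>. f \<gamma> x) ` {1..n}"
    using ex_between_notin_finite[OF _ assms, of "(\<lambda>\<gamma>. f \<gamma> x) ` {1..n}"] by auto
  then show thesis by (intro that[of y]) (auto simp: off_curves_def)
qed

lemma off_curves_extremes:
  obtains l h where "off_curves x l" "height x l = n" "off_curves x h" "height x h = 0"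
proof -
  obtain M where M: "M > 0" "\<And>\<gamma> x. \<gamma> \<in> {1..n} \<Longrightarrow> \<bar>f \<gamma> x\<bar> < M" using curves_bounded by blast
  have "- M < f \<gamma> x" "f \<gamma> x < M" if "\<gamma> \<in> {1..n}" for \<gamma> using M(2)[OF that, of x] by linarith+
  then have "{\<gamma> \<in> {1..n}. - M < f \<gamma> x} = {1..n}" "{\<gamma> \<in> {1..n}. M < f \<gamma> x} = {}"
    "off_curves x (- M)" "off_curves x M" by (fastforce simp: off_curves_def)+
  then show thesis by (intro that[of "- M" M]) (simp_all add: num_above_def)
qed

lemma height_antimono: "u \<le> v \<Longrightarrow> height x v \<le> height x u"
  by (auto simp: num_above_def intro!: card_mono)

lemma curve_above_01:
  assumes "near_cut x" "p \<in> {1..n - 2 * k}" "off_curves x y"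
  shows "curve_above p x y = 0 \<or> curve_above p x y = 1"
proof -
  obtain l h where lh: "off_curves x l" "height x l = n" "off_curves x h" "height x h = 0"
    by (rule off_curves_extremes)
  have "curve_above p x y \<le> 1"
  proof (cases "l \<le> y")
    case True
    then show ?thesis
      using curve_above_antimono[OF assms(1,2) lh(1) assms(3)] curve_above_low[OF assms(2), of x l]
        lh(2) by simp
  next
    case False
    then have "n - k \<le> height x y" using height_antimono[of y l x] lh by simp
    then show ?thesis using curve_above_low[OF assms(2)] by simp
  qed
  moreover have "0 \<le> curve_above p x y"
  proof (cases "y \<le> h")
    case True
    then show ?thesis
      using curve_above_antimono[OF assms(1,2,3) lh(3)] curve_above_high[of x h p] lh(4) by simp
  next
    case False
    then have "height x y \<le> k" using height_antimono[of h y x] lh by simp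
    then show ?thesis using curve_above_high by simp
  qed
  ultimately show ?thesis by linarith
qed

lemma curve_above_iff_wire:
  assumes "near_cut x" "p \<in> {1..n - 2 * k}" "off_curves x y"
  shows "y < wire p x \<Longrightarrow> curve_above p x y = 1" "wire p x < y \<Longrightarrow> curve_above p x y = 0"
proof -
  let ?S = "{y. off_curves x y \<and> curve_above p x y = 1}"
  obtain l h where lh: "off_curves x l" "height x l = n" "off_curves x h" "height x h = 0"
    by (rule off_curves_extremes)
  have ne: "l \<in> ?S" using lh curve_above_low[OF assms(2)] by simp
  have bdd: "bdd_above ?S"
  proof (rule bdd_aboveI[of _ h])
    fix y assume y: "y \<in> ?S"
    show "y \<le> h"
    proof (rule ccontr)
      assume "\<not> y \<le> h"
      then have "height x y \<le> k" using height_antimono[of h y x] lh by simp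
      then show False using y curve_above_high[of x y p] by simp
    qed
  qed
  show "curve_above p x y = 1" if below: "y < wire p x"
  proof -
    obtain y' where "y' \<in> ?S" "y < y'" using below less_cSup_iff[OF _ bdd] ne unfolding wire_def by blast
    then have "1 \<le> curve_above p x y" using curve_above_antimono[OF assms, of y'] by simp
    then show ?thesis using curve_above_01[OF assms] by auto
  qed
  show "curve_above p x y = 0" if "wire p x < y"
  proof -
    have "y \<notin> ?S" using that cSup_upper[OF _ bdd, of y] unfolding wire_def by auto
    then show ?thesis using curve_above_01[OF assms] assms(3) by auto
  qed
qed

lemma wire_unique:
  assumes "near_cut x" "p \<in> {1..n - 2 * k}"
    and "\<And>y. off_curves x y \<Longrightarrow> y < v \<Longrightarrow> curve_above p x y = 1"
      "\<And>y. off_curves x y \<Longrightarrow> v < y \<Longrightarrow> curve_above p x y = 0"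
  shows "wire p x = v"
proof (rule ccontr)
  assume "wire p x \<noteq> v"
  then consider "wire p x < v" | "v < wire p x" by linarith
  then show False
  proof cases
    case 1
    obtain y where "wire p x < y" "y < v" "off_curves x y" using off_curves_between[OF 1] .
    then show False using assms curve_above_iff_wire(2)[OF assms(1,2)] by force
  next
    case 2
    obtain y where "v < y" "y < wire p x" "off_curves x y" using off_curves_between[OF 2] .
    then show False using assms curve_above_iff_wire(1)[OF assms(1,2)] by force
  qed
qed

lemma wire_on_curve:
  assumes "near_cut x" "p \<in> {1..n - 2 * k}" shows "\<exists>\<gamma>\<in>{1..n}. f \<gamma> x = wire p x"
proof (rule ccontr)
  assume "\<not> ?thesis"
  then have off: "off_curves x (wire p x)" by (auto simp: off_curves_def)
  obtain e where e: "e > 0"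
    "\<And>y. dist y (wire p x) < e \<Longrightarrow> off_curves x y \<and> curve_above p x y = curve_above p x (wire p x)"
    using curve_above_eventually_snd[OF off assms] unfolding eventually_nhds_metric by blast
  have "off_curves x (wire p x + e/2) \<and> curve_above p x (wire p x + e/2) = curve_above p x (wire p x)"
    "off_curves x (wire p x - e/2) \<and> curve_above p x (wire p x - e/2) = curve_above p x (wire p x)"
    using e(1) by (intro e(2), simp add: dist_real_def)+
  then show False
    using curve_above_iff_wire[OF assms, of "wire p x + e/2"]
      curve_above_iff_wire[OF assms, of "wire p x - e/2"] e(1)
    by auto
qed

lemma isCont_wire:
  assumes "near_cut x" "p \<in> {1..n - 2 * k}" shows "isCont (wire p) x"
  unfolding isCont_def tendsto_iff
proof (intro allI impI)
  fix e :: real assume "e > 0"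
  obtain y1 where y1: "wire p x - e < y1" "y1 < wire p x" "off_curves x y1"
    using off_curves_between[of "wire p x - e" "wire p x"] \<open>e > 0\<close> by auto
  obtain y2 where y2: "wire p x < y2" "y2 < wire p x + e" "off_curves x y2"
    using off_curves_between[of "wire p x" "wire p x + e"] \<open>e > 0\<close> by auto
  have "\<forall>\<^sub>F x' in nhds x. dist (wire p x') (wire p x) < e"
    using curve_above_eventually_fst[OF y1(3) assms] curve_above_eventually_fst[OF y2(3) assms]
  proof eventually_elim
    case (elim x')
    have "curve_above p x' y1 = 1" "curve_above p x' y2 = 0"
      using elim curve_above_iff_wire(1)[OF assms y1(3,2)] curve_above_iff_wire(2)[OF assms y2(3,1)]
      by auto
    then have "y1 \<le> wire p x'" "wire p x' \<le> y2"
      using curve_above_iff_wire[of x' p y1] curve_above_iff_wire[of x' p y2] elim assms(2) by force+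
    then show ?case using y1 y2 by (auto simp: dist_real_def)
  qed
  then show "\<forall>\<^sub>F x' in at x. dist (wire p x') (wire p x) < e"
    by (simp add: eventually_nhds_conv_at)
qed

lemma wire_add_pi:
  assumes "near_cut x" "near_cut (x + pi)" "p \<in> {1..n - 2 * k}" shows "wire p (x + pi) = - wire p x"
proof (rule wire_unique[OF assms(2,3)])
  fix y assume "off_curves (x + pi) y"
  then have off: "off_curves x (- y)" by (auto simp: off_curves_def curve_add_pi)
  note t = thresholds[OF assms(3)]
  have "curve_above p (x + pi) y = 1 - curve_above p x (- y)"
    using greedy_count_add_pi[OF off assms(1,2) t(1,2)]
      greedy_count_add_pi[OF off assms(1,2) t(3,4)] assms(3)
    by (simp add: curve_above_def of_nat_diff)
  then show "y < - wire p x \<Longrightarrow> curve_above p (x + pi) y = 1"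
    "- wire p x < y \<Longrightarrow> curve_above p (x + pi) y = 0"
    using curve_above_iff_wire[OF assms(1,3) off] by auto
qed

lemma curves_isolated_from:
  obtains d where "d > 0" "\<And>\<gamma>. \<gamma> \<in> {1..n} \<Longrightarrow> f \<gamma> x \<noteq> y \<Longrightarrow> d < \<bar>f \<gamma> x - y\<bar>"
proof -
  obtain d where d: "d > 0" "\<forall>v\<in>(\<lambda>\<gamma>. f \<gamma> x) ` {1..n}. v \<noteq> y \<longrightarrow> d \<le> dist y v"
    using finite_set_avoid[of "(\<lambda>\<gamma>. f \<gamma> x) ` {1..n}" y] by auto
  show thesis
  proof
    show "d/2 > 0" using d by simp
    show "d/2 < \<bar>f \<gamma> x - y\<bar>" if "\<gamma> \<in> {1..n}" "f \<gamma> x \<noteq> y" for \<gamma>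
    proof -
      have "d \<le> dist y (f \<gamma> x)" using d(2) that by blast
      then show ?thesis using d(1) by (simp add: dist_real_def abs_minus_commute)
    qed
  qed
qed

lemma curve_above_jump:
  assumes near: "near_cut x" and p: "p \<in> {1..n - 2 * k}"
    and off: "off_curves x (y - d)" "off_curves x (y + d)"
    and d: "d > 0" "\<And>\<gamma>. \<gamma> \<in> {1..n} \<Longrightarrow> f \<gamma> x \<noteq> y \<Longrightarrow> d < \<bar>f \<gamma> x - y\<bar>"
  shows "curve_above p x (y - d) - curve_above p x (y + d) = of_bool (wire p x = y)"
proof -
  obtain \<gamma> where \<gamma>: "\<gamma> \<in> {1..n}" "f \<gamma> x = wire p x" using wire_on_curve[OF near p] by blast
  consider "wire p x = y" | "wire p x < y - d" | "wire p x > y + d"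
    using d(2)[OF \<gamma>(1)] \<gamma>(2) by fastforce
  then show ?thesis
    using curve_above_iff_wire[OF near p off(1)] curve_above_iff_wire[OF near p off(2)] d(1)
    by cases auto
qed

lemma sum_curve_above:
  assumes "off_curves x y"
  shows "(\<Sum>p = 1..n - 2 * k. curve_above p x y) = int (clamp_level (height x y)) - int k"
proof -
  have "(\<Sum>p = 1..j. curve_above p x y) = greedy_count k x y - greedy_count (k + j) x y" for j
    by (induction j) (auto simp: curve_above_def)
  moreover have "k + (n - 2 * k) = n - k" using kernel_nonempty by simp
  ultimately show ?thesis using greedy_count_first[OF assms] greedy_count_last[OF assms] by simp
qed

lemma card_wires_through:
  assumes near: "near_cut x"
  shows "card {p \<in> {1..n - 2 * k}. wire p x = y} =
    clamp_level (n - num_below {1..n} f x y) - clamp_level (height x y)"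
proof -
  obtain d where d: "d > 0" "\<And>\<gamma>. \<gamma> \<in> {1..n} \<Longrightarrow> f \<gamma> x \<noteq> y \<Longrightarrow> d < \<bar>f \<gamma> x - y\<bar>"
    using curves_isolated_from[of x y] by blast
  have order: "y - d < f \<gamma> x \<longleftrightarrow> \<not> f \<gamma> x < y" "y + d < f \<gamma> x \<longleftrightarrow> y < f \<gamma> x" "f \<gamma> x \<noteq> y - d" "f \<gamma> x \<noteq> y + d"
    if "\<gamma> \<in> {1..n}" for \<gamma>
    using d(2)[OF that] d(1) by (cases "f \<gamma> x = y"; auto)+
  have off: "off_curves x (y - d)" "off_curves x (y + d)" using order by (auto simp: off_curves_def)
  have "height x (y - d) = card {\<gamma> \<in> {1..n}. \<not> f \<gamma> x < y}" "height x (y + d) = height x y"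
    unfolding num_above_def using order by (auto intro!: arg_cong[where f = card])
  then have heights: "height x (y - d) = n - num_below {1..n} f x y" "height x (y + d) = height x y"
    using card_filter_add_card_filter_not[of "{1..n}" "\<lambda>\<gamma>. f \<gamma> x < y"] by (simp_all add: num_below_def)
  have "(\<Sum>p = 1..n - 2 * k. curve_above p x (y - d)) - (\<Sum>p = 1..n - 2 * k. curve_above p x (y + d)) =
      (\<Sum>p = 1..n - 2 * k. of_bool (wire p x = y))"
    unfolding sum_subtractf[symmetric] by (intro sum.cong refl curve_above_jump[OF near _ off d])
  also have "\<dots> = int (card {p \<in> {1..n - 2 * k}. wire p x = y})"
    by (simp add: of_bool_def sum.If_cases Int_def)
  finally have "int (card {p \<in> {1..n - 2 * k}. wire p x = y}) =
      int (clamp_level (height x (y - d))) - int (clamp_level (height x (y + d)))"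
    unfolding sum_curve_above[OF off(1)] sum_curve_above[OF off(2)] by simp
  then show ?thesis using heights by simp
qed

lemma wire_eq_curve_iff:
  assumes near: "near_cut x" and inj: "inj_on (\<lambda>\<alpha>. f \<alpha> x) {1..n}" and \<alpha>: "\<alpha> \<in> {1..n}"
    and p: "p \<in> {1..n - 2 * k}"
  shows "wire p x = f \<alpha> x \<longleftrightarrow> in_kernel \<alpha> x \<and> carries \<alpha> (k + p - 1) x \<and> \<not> carries \<alpha> (k + p) x"
proof -
  let ?y = "f \<alpha> x"
  obtain d where d: "d > 0" "\<And>\<gamma>. \<gamma> \<in> {1..n} \<Longrightarrow> f \<gamma> x \<noteq> ?y \<Longrightarrow> d < \<bar>f \<gamma> x - ?y\<bar>"
    using curves_isolated_from[of x ?y] by blast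
  have "d < \<bar>f \<gamma> x - ?y\<bar>" if "\<gamma> \<in> {1..n}" "\<gamma> \<noteq> \<alpha>" for \<gamma>
    using d(2)[OF that(1)] inj_onD[OF inj, of \<gamma> \<alpha>] that \<alpha> by auto
  then have adj: "adjacent \<alpha> x (?y + d)" "adjacent \<alpha> x (?y - d)"
    using d(1) unfolding adjacent_def by fastforce+
  have off: "off_curves x (?y - d)" "off_curves x (?y + d)" using adj d(1) adjacent_off_curves by auto
  have "of_bool (wire p x = ?y) = (of_bool (in_kernel \<alpha> x \<and> carries \<alpha> (k + p - 1) x \<and>
      \<not> carries \<alpha> (k + p) x) :: int)"
    using curve_above_jump[OF near p off d] curve_above_step[OF \<alpha> _ _ near p adj] d(1) by simp
  then show ?thesis by (simp only: of_bool_eq_iff)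
qed

lemma cut_abscissas_dist:
  assumes "\<alpha> \<in> {1..n}" "\<beta> \<in> {1..n}" shows "\<bar>c \<alpha> - c \<beta>\<bar> < pi"
proof -
  consider "\<alpha> < \<beta>" | "\<beta> < \<alpha>" | "\<alpha> = \<beta>" by linarith
  then show ?thesis
    by cases (use cut_range[OF assms] cut_range[OF assms(2,1)] in \<open>auto simp: abs_if\<close>)
qed

lemma near_cut_interval: obtains a where "\<And>x. a \<le> x \<Longrightarrow> x \<le> a + pi \<Longrightarrow> near_cut x"
proof -
  let ?C = "c ` {1..n}"
  have C: "finite ?C" "?C \<noteq> {}" using kernel_nonempty by auto
  obtain \<alpha> \<beta> where "\<alpha> \<in> {1..n}" "Min ?C = c \<alpha>" "\<beta> \<in> {1..n}" "Max ?C = c \<beta>"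
    using Min_in[OF C] Max_in[OF C] by auto
  then have spread: "Max ?C - pi < Min ?C"
    using cut_abscissas_dist[of \<alpha> \<beta>] by (auto simp: abs_if split: if_splits)
  define a where "a = (Max ?C - pi + Min ?C) / 2"
  have "c \<gamma> - pi < a \<and> a < c \<gamma>" if "\<gamma> \<in> {1..n}" for \<gamma>
  proof -
    have "Min ?C \<le> c \<gamma>" "c \<gamma> \<le> Max ?C" using that by simp_all
    then show ?thesis using spread by (auto simp: a_def field_simps)
  qed
  then show thesis by (intro that[of a]) (force simp: near_cut_def)
qed

lemma ex_antiperiodic_wire:
  assumes p: "p \<in> {1..n - 2 * k}"
  shows "\<exists>g. antiperiodic g \<and> (\<forall>x. near_cut x \<longrightarrow> g x = wire p x)"
proof -
  obtain a where a: "\<And>x. a \<le> x \<Longrightarrow> x \<le> a + pi \<Longrightarrow> near_cut x" using near_cut_interval by blast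
  have "continuous_on {a..a + pi} (wire p)"
    using isCont_wire[OF a p] by (intro continuous_at_imp_continuous_on) auto
  moreover have "wire p (a + pi) = - wire p a" by (intro wire_add_pi p a) auto
  ultimately obtain g where g: "antiperiodic g" "\<And>x. a \<le> x \<Longrightarrow> x \<le> a + pi \<Longrightarrow> g x = wire p x"
    using antiperiodic_extension by blast
  have "g x = wire p x" if "near_cut x" for x
  proof -
    obtain \<gamma> where "\<gamma> \<in> {1..n}" using kernel_nonempty by fastforce
    then have x: "a - pi < x" "x < a + pi + pi"
      using that a[of a] a[of "a + pi"] unfolding near_cut_def by force+
    consider "x < a" | "a \<le> x" "x \<le> a + pi" | "a + pi < x" by linarith
    then show ?thesis
    proof cases
      case 1
      then have "near_cut (x + pi)" "g (x + pi) = wire p (x + pi)" using x by (auto intro: a g)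
      then show ?thesis using wire_add_pi[OF that _ p] antiperiodic_add_pi[OF g(1), of x] by simp
    next
      case 3
      then have "near_cut (x - pi)" "g (x - pi) = wire p (x - pi)" using x by (auto intro: a g)
      then show ?thesis
        using wire_add_pi[of "x - pi", OF _ _ p] that antiperiodic_diff_pi[OF g(1), of x] by simp
    qed (rule g)
  qed
  then show ?thesis using g(1) by blast
qed

definition greedy_curve :: "nat \<Rightarrow> real \<Rightarrow> real" where
  "greedy_curve p = (SOME g. antiperiodic g \<and> (\<forall>x. near_cut x \<longrightarrow> g x = wire p x))"

lemma
  assumes "p \<in> {1..n - 2 * k}"
  shows antiperiodic_greedy_curve: "antiperiodic (greedy_curve p)"
    and greedy_curve_near_cut: "near_cut x \<Longrightarrow> greedy_curve p x = wire p x"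
  using someI_ex[OF ex_antiperiodic_wire[OF assms]] by (auto simp: greedy_curve_def)

lemma clamp_level_complement: "i \<le> n \<Longrightarrow> clamp_level (n - i) = n - clamp_level i"
  using kernel_nonempty by (auto simp: clamp_level_def min_def max_def)

lemma clamp_level_less_iff: "clamp_level i < clamp_level j \<longleftrightarrow> i < j \<and> i + k < n \<and> k < j"
  using kernel_nonempty by (auto simp: clamp_level_def)

lemma card_greedy_curves_through:
  "card {p \<in> {1..n - 2 * k}. greedy_curve p x = y} =
    clamp_level (n - num_below {1..n} f x y) - clamp_level (height x y)"
proof -
  obtain a where a: "\<And>x. a \<le> x \<Longrightarrow> x \<le> a + pi \<Longrightarrow> near_cut x" using near_cut_interval by blast
  obtain x0 where x0: "[x0 = x] (rmod pi)" "a \<le> x0" "x0 < a + pi"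
    using rcong_representative[of pi x a] by (metis pi_gt_zero rcong_sym)
  then have near: "near_cut x0" using a by simp
  obtain r where x: "x = x0 + of_int r * pi" using x0(1) by (auto simp: rcong_altdef)
  define y0 where "y0 = deck_sign r * y"
  have y: "y = deck_sign r * y0" by (simp add: y0_def)
  have "greedy_curve p x = y \<longleftrightarrow> wire p x0 = y0" if "p \<in> {1..n - 2 * k}" for p
    unfolding x y using antiperiodic_shift[OF antiperiodic_greedy_curve[OF that]]
      greedy_curve_near_cut[OF that near] by simp
  then have "{p \<in> {1..n - 2 * k}. greedy_curve p x = y} = {p \<in> {1..n - 2 * k}. wire p x0 = y0}" by blast
  then have card: "card {p \<in> {1..n - 2 * k}. greedy_curve p x = y} =
      clamp_level (n - num_below {1..n} f x0 y0) - clamp_level (height x0 y0)"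
    by (simp only: card_wires_through[OF near])
  have bounds: "height x0 y0 \<le> n" "num_below {1..n} f x0 y0 \<le> n"
    using above_add_through_add_below[of "{1..n}" f x0 y0] by simp_all
  have counts: "height x y = (if even r then height x0 y0 else num_below {1..n} f x0 y0)"
    "num_below {1..n} f x y = (if even r then num_below {1..n} f x0 y0 else height x0 y0)"
    unfolding x y by (rule num_above_shift[OF subset_refl], rule num_below_shift[OF subset_refl])
  show ?thesis
  proof (cases "even r")
    case True
    then show ?thesis unfolding card counts by simp
  next
    case False
    have "clamp_level (height x0 y0) \<le> n" "clamp_level (num_below {1..n} f x0 y0) \<le> n"
      using bounds by (auto simp: clamp_level_def)
    then show ?thesis unfolding card counts using False bounds by (simp add: clamp_level_complement)
  qed
qed

lemma greedy_curves_cover: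
  "(\<exists>p\<in>{1..n - 2 * k}. greedy_curve p x = y) \<longleftrightarrow> (x, y) \<in> middle_levels k {1..n} f"
proof -
  have "(\<exists>p\<in>{1..n - 2 * k}. greedy_curve p x = y) \<longleftrightarrow> 0 < card {p \<in> {1..n - 2 * k}. greedy_curve p x = y}"
    by (auto simp: card_gt_0_iff)
  also have "\<dots> \<longleftrightarrow> clamp_level (height x y) < clamp_level (n - num_below {1..n} f x y)"
    by (simp only: card_greedy_curves_through zero_less_diff)
  also have "\<dots> \<longleftrightarrow> 0 < card {p \<in> {1..n}. f p x = y} \<and> height x y + k < n \<and> num_below {1..n} f x y + k < n"
    unfolding clamp_level_less_iff using above_add_through_add_below[of "{1..n}" f x y] by auto
  also have "\<dots> \<longleftrightarrow> (x, y) \<in> middle_levels k {1..n} f"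
    unfolding card_through_pos_iff using kernel_nonempty by (simp add: middle_levels_def)
  finally show ?thesis .
qed

lemma card_greedy_curves_le:
  "card {p \<in> {1..n - 2 * k}. greedy_curve p x = y} \<le> card {\<gamma> \<in> {1..n}. f \<gamma> x = y}"
  using above_add_through_add_below[of "{1..n}" f x y]
  unfolding card_greedy_curves_through clamp_level_def by auto

lemma greedy_curve_follows:
  assumes "p \<in> {1..n - 2 * k}" shows "follows {1..n} f (greedy_curve p)"
proof -
  have "\<exists>\<gamma>\<in>{1..n}. greedy_curve p x = f \<gamma> x" for x
  proof -
    have "(x, greedy_curve p x) \<in> middle_levels k {1..n} f" using greedy_curves_cover assms by blast
    then obtain \<gamma> where "\<gamma> \<in> {1..n}" "f \<gamma> x = greedy_curve p x" by (auto simp: middle_levels_def)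
    then show ?thesis by (intro bexI[of _ \<gamma>]) simp_all
  qed
  then show ?thesis using antiperiodic_greedy_curve[OF assms] by (simp add: follows_def)
qed

end

context descending_curves
begin

lemma in_kernel_diff_pi:
  assumes inj: "inj_on (\<lambda>\<alpha>. f \<alpha> x) {1..n}" and \<alpha>: "\<alpha> \<in> {1..n}"
  shows "in_kernel \<alpha> (x - pi) \<longleftrightarrow> in_kernel \<alpha> x"
proof -
  have "{\<gamma> \<in> {1..n}. f \<gamma> x = f \<alpha> x} = {\<alpha>}" using inj_onD[OF inj, of _ \<alpha>] \<alpha> by auto
  then have "height x (f \<alpha> x) + 1 + num_below {1..n} f x (f \<alpha> x) = n"
    using above_add_through_add_below[of "{1..n}" f x "f \<alpha> x"] by simp
  moreover have "height (x - pi) (f \<alpha> (x - pi)) = num_below {1..n} f x (f \<alpha> x)"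
    using num_below_add_pi[of "{1..n}" "x - pi" "- f \<alpha> x"]
      antiperiodic_diff_pi[OF antiperiodic[OF \<alpha>]] by simp
  ultimately show ?thesis unfolding in_kernel_def by auto
qed

lemma greedy_curve_eq_iff:
  assumes inj: "inj_on (\<lambda>\<alpha>. f \<alpha> x) {1..n}" and \<alpha>: "\<alpha> \<in> {1..n}" and p: "p \<in> {1..n - 2 * k}"
    and x: "c \<alpha> \<le> x" "x < c \<alpha> + pi"
  shows "greedy_curve p x = f \<alpha> x \<longleftrightarrow>
    in_kernel \<alpha> x \<and> carries_after \<alpha> (k + p - 1) x \<and> \<not> carries_after \<alpha> (k + p) x"
proof (cases "near_cut x")
  case True
  then show ?thesis
    using wire_eq_curve_iff[OF True inj \<alpha> p] greedy_curve_near_cut[OF p True] x(1)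
    by (simp add: carries_def)
next
  case False
  then obtain \<gamma> where \<gamma>: "\<gamma> \<in> {1..n}" "\<not> (c \<gamma> - pi < x \<and> x < c \<gamma> + pi)" by (auto simp: near_cut_def)
  have "c \<gamma> \<le> x - pi" using cut_abscissas_dist[OF \<alpha> \<gamma>(1)] \<gamma>(2) x by (auto simp: abs_if split: if_splits)
  then have "c \<delta> - pi < x - pi \<and> x - pi < c \<delta> + pi" if "\<delta> \<in> {1..n}" for \<delta>
    using cut_abscissas_dist[OF \<gamma>(1) that] cut_abscissas_dist[OF \<alpha> that] x
    by (auto simp: abs_if split: if_splits)
  then have near: "near_cut (x - pi)" by (simp add: near_cut_def)
  note diff_pi = antiperiodic_diff_pi[OF antiperiodic]
  have "inj_on (\<lambda>\<alpha>. f \<alpha> (x - pi)) {1..n}"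
  proof (rule inj_onI)
    fix \<gamma> \<delta> assume "\<gamma> \<in> {1..n}" "\<delta> \<in> {1..n}" "f \<gamma> (x - pi) = f \<delta> (x - pi)"
    then show "\<gamma> = \<delta>" using inj_onD[OF inj, of \<gamma> \<delta>] diff_pi[of \<gamma> x] diff_pi[of \<delta> x] by simp
  qed
  note wire_eq_curve_iff[OF near this \<alpha> p]
  moreover have "carries \<alpha> t (x - pi) \<longleftrightarrow> carries_after \<alpha> t x" for t using x(2) by (simp add: carries_def)
  ultimately have "wire p (x - pi) = f \<alpha> (x - pi) \<longleftrightarrow>
      in_kernel \<alpha> x \<and> carries_after \<alpha> (k + p - 1) x \<and> \<not> carries_after \<alpha> (k + p) x"
    by (simp only: in_kernel_diff_pi[OF inj \<alpha>])
  moreover have "wire p (x - pi) = - greedy_curve p x"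
    using greedy_curve_near_cut[OF p near] antiperiodic_diff_pi[OF antiperiodic_greedy_curve[OF p],
      of x] by simp
  ultimately show ?thesis using diff_pi[OF \<alpha>, of x] by simp
qed

definition saturated_at :: "nat \<Rightarrow> nat \<Rightarrow> nat \<Rightarrow> bool" where
  "saturated_at t \<alpha> \<beta> \<longleftrightarrow> \<alpha> \<le> t \<and> t < \<beta> \<and> k \<le> ones_above t (X \<alpha> \<beta>) (f \<alpha> (X \<alpha> \<beta>)) \<and>
     k \<le> zeros_below t (X \<alpha> \<beta>) (f \<alpha> (X \<alpha> \<beta>))"

definition saturated :: "nat \<Rightarrow> nat \<Rightarrow> bool" where
  "saturated \<alpha> \<beta> \<longleftrightarrow> (\<exists>t. saturated_at t \<alpha> \<beta>)"

lemma carries_after_near_vertex: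
  assumes \<alpha>\<beta>: "\<alpha> \<in> {1..n}" "\<beta> \<in> {1..n}" "\<alpha> < \<beta>"
  shows "\<forall>\<^sub>F x in nhds (X \<alpha> \<beta>). \<forall>t\<le>n.
    (f \<beta> x < f \<alpha> x \<longrightarrow> carries_after \<alpha> t x \<longrightarrow> carries_after \<beta> t x) \<and>
    (f \<alpha> x < f \<beta> x \<longrightarrow> (carries_after \<beta> t x \<and> \<not> carries_after \<alpha> t x \<longleftrightarrow> saturated_at t \<alpha> \<beta>))"
proof -
  have neq: "\<alpha> \<noteq> \<beta>" "\<beta> \<noteq> \<alpha>" using \<alpha>\<beta>(3) by simp_all
  have meet: "f \<beta> (X \<alpha> \<beta>) = f \<alpha> (X \<alpha> \<beta>)" using vertex_meet[OF \<alpha>\<beta>] by simp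
  show ?thesis
    using eventually_counts_near_vertex[OF \<alpha>\<beta>(1,2) neq(1) refl meet]
      eventually_counts_near_vertex[OF \<alpha>\<beta>(2,1) neq(2) meet refl]
  proof eventually_elim
    case (elim x)
    show ?case
    proof (intro allI impI conjI)
      fix t assume t: "t \<le> n"
      have mem: "\<gamma> \<in> {t<..n} \<longleftrightarrow> t < \<gamma>" "\<gamma> \<in> {1..t} \<longleftrightarrow> \<gamma> \<le> t" if "\<gamma> \<in> {1..n}" for \<gamma> using that by auto
      show "carries_after \<beta> t x" if order: "f \<beta> x < f \<alpha> x" and carries: "carries_after \<alpha> t x"
        using elim(1)[THEN mp, OF order, rule_format, OF ones_subset[of t]]
          elim(1)[THEN mp, OF order, rule_format, OF zeros_subset[OF t]] carries \<alpha>\<beta>(3)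
        unfolding carries_after_def mem[OF \<alpha>\<beta>(1)] mem[OF \<alpha>\<beta>(2)] by (auto simp: min_def split: if_splits)
      show "carries_after \<beta> t x \<and> \<not> carries_after \<alpha> t x \<longleftrightarrow> saturated_at t \<alpha> \<beta>" if order: "f \<alpha> x < f \<beta> x"
        using elim(2)[THEN mp, OF order, rule_format, OF ones_subset[of t]]
          elim(2)[THEN mp, OF order, rule_format, OF zeros_subset[OF t]] \<alpha>\<beta>(3)
        unfolding carries_after_def saturated_at_def mem[OF \<alpha>\<beta>(1)] mem[OF \<alpha>\<beta>(2)]
        by (auto simp: min_def split: if_splits)
    qed
  qed
qed

lemma greedy_curve_carried_near_vertex:
  assumes \<alpha>\<beta>: "\<alpha> \<in> {1..n}" "\<beta> \<in> {1..n}" "\<alpha> < \<beta>"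
    and p: "p \<in> {1..n - 2 * k}" "greedy_curve p (X \<alpha> \<beta>) = f \<alpha> (X \<alpha> \<beta>)"
  shows "\<forall>\<^sub>F x in at (X \<alpha> \<beta>). \<exists>\<gamma>\<in>{\<alpha>, \<beta>}. greedy_curve p x = f \<gamma> x \<and>
    carries_after \<gamma> (k + p - 1) x \<and> \<not> carries_after \<gamma> (k + p) x"
proof -
  let ?x = "X \<alpha> \<beta>"
  have meet: "f \<beta> ?x = f \<alpha> ?x" using vertex_meet[OF \<alpha>\<beta>] by simp
  have neq: "\<alpha> \<noteq> \<beta>" using \<alpha>\<beta>(3) by simp
  have on_line: "\<forall>\<^sub>F x in F. \<exists>\<gamma>\<in>{\<alpha>, \<beta>}. greedy_curve p x = f \<gamma> x"
    if "(\<forall>\<^sub>F x in F. greedy_curve p x = f \<alpha> x) \<or> (\<forall>\<^sub>F x in F. greedy_curve p x = f \<beta> x)" for F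
    using that by (auto elim!: eventually_mono)
  have "\<forall>\<^sub>F x in at ?x. \<exists>\<gamma>\<in>{\<alpha>, \<beta>}. greedy_curve p x = f \<gamma> x"
    unfolding eventually_at_split
    by (intro conjI on_line germ_pair_cases[OF \<alpha>\<beta>(1,2) neq meet greedy_curve_follows p(2)] p(1))
  moreover have "\<forall>\<^sub>F x in at ?x. \<forall>\<gamma>\<in>{\<alpha>, \<beta>}. c \<gamma> \<le> x \<and> x < c \<gamma> + pi"
  proof (intro eventually_ball_finite ballI)
    fix \<gamma> assume "\<gamma> \<in> {\<alpha>, \<beta>}"
    then have "c \<gamma> < ?x" "?x < c \<gamma> + pi" using cut_range[OF \<alpha>\<beta>] by auto
    from order_tendstoD(1)[OF tendsto_ident_at this(1)] order_tendstoD(2)[OF tendsto_ident_at this(2)]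
    show "\<forall>\<^sub>F x in at ?x. c \<gamma> \<le> x \<and> x < c \<gamma> + pi" by eventually_elim simp
  qed simp
  ultimately show ?thesis using eventually_inj_on[of ?x]
  proof eventually_elim
    case (elim x)
    then obtain \<gamma> where \<gamma>: "\<gamma> \<in> {\<alpha>, \<beta>}" "greedy_curve p x = f \<gamma> x" by blast
    then have "\<gamma> \<in> {1..n}" using \<alpha>\<beta> by auto
    then show ?case using greedy_curve_eq_iff[OF elim(3) _ p(1), of \<gamma>] elim(2) \<gamma> by blast
  qed
qed

text \<open>Before a vertex the upper greedy curve has the smaller index, whether or not the two cross there. So
  greedy curves that have crossed cannot meet again inside the window.\<close>

lemma greedy_curves_near_vertex:
  assumes \<alpha>\<beta>: "\<alpha> \<in> {1..n}" "\<beta> \<in> {1..n}" "\<alpha> < \<beta>"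
    and pq: "p \<in> {1..n - 2 * k}" "q \<in> {1..n - 2 * k}" "p < q"
      "greedy_curve p (X \<alpha> \<beta>) = f \<alpha> (X \<alpha> \<beta>)" "greedy_curve q (X \<alpha> \<beta>) = f \<alpha> (X \<alpha> \<beta>)"
  shows "\<forall>\<^sub>F x in at (X \<alpha> \<beta>).
    (f \<beta> x < f \<alpha> x \<longrightarrow> greedy_curve p x = f \<alpha> x \<and> greedy_curve q x = f \<beta> x) \<and>
    (f \<alpha> x < f \<beta> x \<longrightarrow> greedy_curve p x = f (if saturated \<alpha> \<beta> then \<alpha> else \<beta>) x \<and>
      greedy_curve q x = f (if saturated \<alpha> \<beta> then \<beta> else \<alpha>) x)"
proof -
  have bounds: "k + p \<le> k + q - 1" "k + q - 1 \<le> n" "k + p \<le> n" using pq kernel_nonempty by auto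
  note antimono = carries_after_antimono[OF _ _ bounds(2)]
  have "\<forall>\<^sub>F x in at (X \<alpha> \<beta>). \<forall>t\<le>n.
    (f \<beta> x < f \<alpha> x \<longrightarrow> carries_after \<alpha> t x \<longrightarrow> carries_after \<beta> t x) \<and>
    (f \<alpha> x < f \<beta> x \<longrightarrow> (carries_after \<beta> t x \<and> \<not> carries_after \<alpha> t x \<longleftrightarrow> saturated_at t \<alpha> \<beta>))"
    using carries_after_near_vertex[OF \<alpha>\<beta>] by (simp add: eventually_nhds_conv_at)
  with greedy_curve_carried_near_vertex[OF \<alpha>\<beta> pq(1,4)] greedy_curve_carried_near_vertex[OF \<alpha>\<beta> pq(2,5)]
  show ?thesis
  proof eventually_elim
    case (elim x)
    obtain \<gamma> where \<gamma>: "\<gamma> \<in> {\<alpha>, \<beta>}" "greedy_curve p x = f \<gamma> x" "\<not> carries_after \<gamma> (k + p) x"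
      using elim(1) by blast
    obtain \<delta> where \<delta>: "\<delta> \<in> {\<alpha>, \<beta>}" "greedy_curve q x = f \<delta> x" "carries_after \<delta> (k + q - 1) x"
      using elim(2) by blast
    have \<delta>_carries: "carries_after \<delta> (k + p) x" using antimono[OF \<delta>(3) bounds(1)] .
    then consider "\<gamma> = \<alpha>" "\<delta> = \<beta>" | "\<gamma> = \<beta>" "\<delta> = \<alpha>" using \<gamma>(1,3) \<delta>(1) by blast
    then show ?case
    proof cases
      case 1
      then have "f \<alpha> x < f \<beta> x \<Longrightarrow> saturated_at (k + p) \<alpha> \<beta>"
        using elim(3) \<gamma>(3) \<delta>_carries bounds(3) by blast
      then show ?thesis using 1 \<gamma>(2) \<delta>(2) by (auto simp: saturated_def)
    next
      case 2
      have "\<not> f \<beta> x < f \<alpha> x" using elim(3) \<gamma>(3) \<delta>_carries bounds(3) 2 by blast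
      moreover have "\<not> saturated \<alpha> \<beta>" if order: "f \<alpha> x < f \<beta> x"
      proof
        assume "saturated \<alpha> \<beta>"
        then obtain t where t: "saturated_at t \<alpha> \<beta>" by (auto simp: saturated_def)
        then have "t \<le> n" using \<alpha>\<beta>(2) by (auto simp: saturated_at_def)
        then have carries: "carries_after \<beta> t x" "\<not> carries_after \<alpha> t x" using elim(3) order t by blast+
        have "t < k + p" using carries_after_antimono[OF carries(1) _ \<open>t \<le> n\<close>, of "k + p"] \<gamma>(3) 2
          by force
        then have "carries_after \<alpha> t x" using antimono[of \<alpha> x t] \<delta>(3) 2 bounds(1) by simp
        then show False using carries(2) by blast
      qed
      ultimately show ?thesis using 2 \<gamma>(2) \<delta>(2) by auto
    qed
  qed
qed

lemma
  assumes \<alpha>\<beta>: "\<alpha> \<in> {1..n}" "\<beta> \<in> {1..n}" "\<alpha> < \<beta>"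
    and pq: "p \<in> {1..n - 2 * k}" "q \<in> {1..n - 2 * k}" "p < q"
      "greedy_curve p (X \<alpha> \<beta>) = f \<alpha> (X \<alpha> \<beta>)" "greedy_curve q (X \<alpha> \<beta>) = f \<alpha> (X \<alpha> \<beta>)"
  shows greedy_curves_descending: "\<forall>\<^sub>F x in at_left (X \<alpha> \<beta>). greedy_curve q x < greedy_curve p x"
    and greedy_curves_cross_iff: "crosses (greedy_curve p) (greedy_curve q) (X \<alpha> \<beta>) \<longleftrightarrow> saturated \<alpha> \<beta>"
proof -
  let ?x = "X \<alpha> \<beta>"
  have meet: "greedy_curve p ?x = greedy_curve q ?x" using pq(4,5) by simp
  have left: "\<forall>\<^sub>F x in at_left ?x. f \<beta> x < f \<alpha> x"
    unfolding eventually_at_left_field using descending[OF \<alpha>\<beta>] by (intro exI[of _ "?x - pi"]) auto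
  have right: "\<forall>\<^sub>F x in at_right ?x. f \<alpha> x < f \<beta> x"
    unfolding eventually_at_right_field using ascending_after[OF \<alpha>\<beta>] by (intro exI[of _ "?x + pi"]) auto
  note near = greedy_curves_near_vertex[OF \<alpha>\<beta> pq, unfolded eventually_at_split]
  show descending: "\<forall>\<^sub>F x in at_left ?x. greedy_curve q x < greedy_curve p x"
    using near[THEN conjunct1] left by eventually_elim simp
  have "crosses (greedy_curve p) (greedy_curve q) ?x" if "saturated \<alpha> \<beta>"
  proof (rule crossesI[OF meet descending])
    show "\<forall>\<^sub>F x in at_right ?x. greedy_curve p x < greedy_curve q x"
      using near[THEN conjunct2] right by eventually_elim (simp add: that)
  qed
  moreover have "touches (greedy_curve p) (greedy_curve q) ?x" if "\<not> saturated \<alpha> \<beta>"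
  proof (rule touchesI[OF meet descending])
    show "\<forall>\<^sub>F x in at_right ?x. greedy_curve q x < greedy_curve p x"
      using near[THEN conjunct2] right by eventually_elim (simp add: that)
  qed
  ultimately show "crosses (greedy_curve p) (greedy_curve q) ?x \<longleftrightarrow> saturated \<alpha> \<beta>"
    using crosses_not_touches by blast
qed

lemma greedy_curves_meet_at_vertex:
  assumes "p \<in> {1..n - 2 * k}" "q \<in> {1..n - 2 * k}" "p \<noteq> q" "greedy_curve p x = y" "greedy_curve q x = y"
  obtains \<alpha> \<beta> where "\<alpha> \<in> {1..n}" "\<beta> \<in> {1..n}" "\<alpha> < \<beta>" "f \<alpha> x = y" "f \<beta> x = y"
proof -
  have "card {p, q} \<le> card {p \<in> {1..n - 2 * k}. greedy_curve p x = y}"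
    using assms by (intro card_mono) auto
  then have "\<not> card {\<gamma> \<in> {1..n}. f \<gamma> x = y} \<le> Suc 0" using card_greedy_curves_le[of x y] assms(3) by simp
  then obtain \<alpha> \<beta> where "\<alpha> \<in> {1..n}" "\<beta> \<in> {1..n}" "\<alpha> \<noteq> \<beta>" "f \<alpha> x = y" "f \<beta> x = y"
    by (subst (asm) card_le_Suc0_iff_eq) auto
  then show thesis using that by (cases "\<alpha> < \<beta>") auto
qed

lemma greedy_curves_through_saturated:
  assumes \<alpha>\<beta>: "\<alpha> \<in> {1..n}" "\<beta> \<in> {1..n}" "\<alpha> < \<beta>" and "saturated \<alpha> \<beta>"
  obtains p q where "p \<in> {1..n - 2 * k}" "q \<in> {1..n - 2 * k}" "p < q"
    "greedy_curve p (X \<alpha> \<beta>) = f \<alpha> (X \<alpha> \<beta>)" "greedy_curve q (X \<alpha> \<beta>) = f \<alpha> (X \<alpha> \<beta>)"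
proof -
  let ?x = "X \<alpha> \<beta>" and ?y = "f \<alpha> (X \<alpha> \<beta>)"
  obtain t where t: "t < \<beta>" "k \<le> ones_above t ?x ?y" "k \<le> zeros_below t ?x ?y"
    using assms(4) by (auto simp: saturated_def saturated_at_def)
  have "ones_above t ?x ?y \<le> height ?x ?y" "zeros_below t ?x ?y \<le> num_below {1..n} f ?x ?y"
    unfolding num_above_def num_below_def using t(1) \<alpha>\<beta>(2) by (intro card_mono; auto)+
  moreover have "card {\<alpha>, \<beta>} \<le> card {\<gamma> \<in> {1..n}. f \<gamma> ?x = ?y}"
    using \<alpha>\<beta> vertex_meet[OF \<alpha>\<beta>] by (intro card_mono) auto
  ultimately have "2 \<le> card {p \<in> {1..n - 2 * k}. greedy_curve p ?x = ?y}"
    using t(2,3) \<alpha>\<beta>(3) above_add_through_add_below[of "{1..n}" f ?x ?y]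
    unfolding card_greedy_curves_through by (simp add: clamp_level_def)
  then have "\<not> card {p \<in> {1..n - 2 * k}. greedy_curve p ?x = ?y} \<le> Suc 0" by simp
  then obtain p q where "p \<in> {1..n - 2 * k}" "q \<in> {1..n - 2 * k}" "p \<noteq> q" "greedy_curve p ?x = ?y"
      "greedy_curve q ?x = ?y"
    by (subst (asm) card_le_Suc0_iff_eq) auto
  then show thesis using that by (cases "p < q") auto
qed

end

locale greedy_window = cut_window "{1..n}" f k W + descending_curves n f k X c
  for n :: nat and f :: "nat \<Rightarrow> real \<Rightarrow> real" and k :: nat and W :: "(real \<times> real) set"
    and X :: "nat \<Rightarrow> nat \<Rightarrow> real" and c :: "nat \<Rightarrow> real" +
  assumes vertex_in_W: "\<alpha> \<in> {1..n} \<Longrightarrow> \<beta> \<in> {1..n} \<Longrightarrow> \<alpha> < \<beta> \<Longrightarrow> (X \<alpha> \<beta>, f \<alpha> (X \<alpha> \<beta>)) \<in> W"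
begin

lemma greedy_vertex_in_W:
  assumes "p \<in> {1..n - 2 * k}" "q \<in> {1..n - 2 * k}" "p \<noteq> q" "greedy_curve p x = greedy_curve q x"
    "(x, greedy_curve p x) \<in> W"
  obtains \<alpha> \<beta> where "\<alpha> \<in> {1..n}" "\<beta> \<in> {1..n}" "\<alpha> < \<beta>" "x = X \<alpha> \<beta>"
    "greedy_curve p (X \<alpha> \<beta>) = f \<alpha> (X \<alpha> \<beta>)" "greedy_curve q (X \<alpha> \<beta>) = f \<alpha> (X \<alpha> \<beta>)"
proof -
  obtain \<alpha> \<beta> where \<alpha>\<beta>: "\<alpha> \<in> {1..n}" "\<beta> \<in> {1..n}" "\<alpha> < \<beta>" "f \<alpha> x = greedy_curve p x"
      "f \<beta> x = greedy_curve p x"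
    using greedy_curves_meet_at_vertex[OF assms(1-3) refl assms(4)[symmetric]] .
  moreover have neq: "\<alpha> \<noteq> \<beta>" using \<alpha>\<beta>(3) by simp
  moreover have "x = meeting \<alpha> \<beta>"
    by (rule meeting_unique[OF \<alpha>\<beta>(1,2) neq]) (use \<alpha>\<beta>(4,5) assms(5) in simp_all)
  moreover have "X \<alpha> \<beta> = meeting \<alpha> \<beta>"
    by (rule meeting_unique[OF \<alpha>\<beta>(1,2) neq vertex_in_W[OF \<alpha>\<beta>(1-3)] vertex_meet[OF \<alpha>\<beta>(1-3)]])
  ultimately show thesis using that[of \<alpha> \<beta>] assms(4) by simp
qed

lemma greedy_meeting_is_vertex:
  assumes "p \<in> {1..n - 2 * k}" "q \<in> {1..n - 2 * k}" "p \<noteq> q" "greedy_curve p x = greedy_curve q x"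
  shows "(x, greedy_curve p x) \<in> vertices {1..n} f"
proof -
  obtain \<alpha> \<beta> where "\<alpha> \<in> {1..n}" "\<beta> \<in> {1..n}" "\<alpha> < \<beta>" "f \<alpha> x = greedy_curve p x"
      "f \<beta> x = greedy_curve p x"
    using greedy_curves_meet_at_vertex[OF assms(1-3) refl assms(4)[symmetric]] .
  then show ?thesis by (intro verticesI[of \<alpha> _ \<beta>]) auto
qed

lemma sparse_greedy_meetings:
  assumes "p \<in> {1..n - 2 * k}" "q \<in> {1..n - 2 * k}" "p \<noteq> q"
  shows "{t. greedy_curve p t = greedy_curve q t} sparse_in UNIV"
  by (rule sparse_in_subset2[OF sparse_fst_vertices]) (use greedy_meeting_is_vertex[OF assms] in force)

lemma no_meeting_after_crossing_ordered:
  assumes pq: "p \<in> {1..n - 2 * k}" "q \<in> {1..n - 2 * k}" "p < q"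
    and W: "(x1, greedy_curve p x1) \<in> W" "(x2, greedy_curve p x2) \<in> W"
    and cross: "crosses (greedy_curve p) (greedy_curve q) x1" and "x1 < x2"
  shows "greedy_curve p x2 \<noteq> greedy_curve q x2"
proof
  assume meet: "greedy_curve p x2 = greedy_curve q x2"
  have neq: "p \<noteq> q" using pq(3) by simp
  have descending: "\<forall>\<^sub>F t in at_left x. greedy_curve q t < greedy_curve p t"
    if vertex: "greedy_curve p x = greedy_curve q x" "(x, greedy_curve p x) \<in> W" for x
  proof -
    obtain \<alpha> \<beta> where "\<alpha> \<in> {1..n}" "\<beta> \<in> {1..n}" "\<alpha> < \<beta>" and x: "x = X \<alpha> \<beta>"
      and "greedy_curve p (X \<alpha> \<beta>) = f \<alpha> (X \<alpha> \<beta>)" "greedy_curve q (X \<alpha> \<beta>) = f \<alpha> (X \<alpha> \<beta>)"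
      using greedy_vertex_in_W[OF pq(1,2) neq vertex] .
    then show ?thesis unfolding x by (intro greedy_curves_descending pq)
  qed
  note continuous = antiperiodic_continuous_on[OF antiperiodic_greedy_curve]
  have right: "\<forall>\<^sub>F t in at_right x1. greedy_curve p t < greedy_curve q t"
    by (rule crosses_order_right[OF cross descending[OF crosses_imp_eq[OF cross] W(1)]])
  obtain u where u: "x1 < u" "u \<le> x2" "greedy_curve p u = greedy_curve q u"
    "\<forall>\<^sub>F t in at_left u. greedy_curve p t < greedy_curve q t"
    using order_until_next_meeting[OF continuous[OF pq(1)] continuous[OF pq(2)] right \<open>x1 < x2\<close> meet] .
  have "(u, greedy_curve p u) \<in> W"
  proof (cases "u = x2")
    case False
    then show ?thesis
      using W_convex[OF greedy_curve_follows[OF pq(1)] W u(1) _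
        greedy_meeting_is_vertex[OF pq(1,2) neq u(3)]] u(2) by simp
  qed (use W(2) in simp)
  from descending[OF u(3) this] u(4) have "\<forall>\<^sub>F t in at_left u. False" by eventually_elim simp
  then show False by simp
qed

lemma no_meeting_after_crossing:
  assumes pq: "p \<in> {1..n - 2 * k}" "q \<in> {1..n - 2 * k}" "p \<noteq> q"
    and W: "(x1, greedy_curve p x1) \<in> W" "(x2, greedy_curve p x2) \<in> W"
    and cross: "crosses (greedy_curve p) (greedy_curve q) x1" and "x1 < x2"
  shows "greedy_curve p x2 \<noteq> greedy_curve q x2"
proof (cases "p < q")
  case True
  then show ?thesis using no_meeting_after_crossing_ordered[OF pq(1,2) _ W cross \<open>x1 < x2\<close>] by blast
next
  case False
  then have "q < p" using pq(3) by simp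
  have cross': "crosses (greedy_curve q) (greedy_curve p) x1" using cross crosses_commute by blast
  show ?thesis
  proof
    assume "greedy_curve p x2 = greedy_curve q x2"
    then show False
      using no_meeting_after_crossing_ordered[OF pq(2,1) \<open>q < p\<close> _ _ cross' \<open>x1 < x2\<close>] W
        crosses_imp_eq[OF cross] by simp
  qed
qed

lemma greedy_crossing_unique:
  assumes pq: "p \<in> {1..n - 2 * k}" "q \<in> {1..n - 2 * k}" "p \<noteq> q"
    and cross:
        "crosses (greedy_curve p) (greedy_curve q) x" "crosses (greedy_curve p) (greedy_curve q) x'"
  shows "[x = x'] (rmod pi)"
proof -
  have in_W: "\<exists>x0. [u = x0] (rmod pi) \<and> (x0, greedy_curve p x0) \<in> W \<and>
      crosses (greedy_curve p) (greedy_curve q) x0"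
    if cross_u: "crosses (greedy_curve p) (greedy_curve q) u" for u
  proof -
    obtain x0 where "[u = x0] (rmod pi)" "(x0, greedy_curve p x0) \<in> W"
      using vertex_in_W_along[OF greedy_curve_follows[OF pq(1)]
        greedy_meeting_is_vertex[OF pq crosses_imp_eq[OF cross_u]]] .
    then show ?thesis
      using cross_u crosses_rcong[OF antiperiodic_greedy_curve[OF pq(1)]
        antiperiodic_greedy_curve[OF pq(2)]] by blast
  qed
  obtain x1 where x1: "[x = x1] (rmod pi)" "(x1, greedy_curve p x1) \<in> W"
      "crosses (greedy_curve p) (greedy_curve q) x1"
    using in_W[OF cross(1)] by blast
  obtain x2 where x2: "[x' = x2] (rmod pi)" "(x2, greedy_curve p x2) \<in> W"
      "crosses (greedy_curve p) (greedy_curve q) x2"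
    using in_W[OF cross(2)] by blast
  have "\<not> x1 < x2" "\<not> x2 < x1"
    using no_meeting_after_crossing[OF pq x1(2) x2(2) x1(3)]
      no_meeting_after_crossing[OF pq x2(2) x1(2) x2(3)]
      crosses_imp_eq[OF x1(3)] crosses_imp_eq[OF x2(3)] by blast+
  then have "x1 = x2" by simp
  then show ?thesis using rcong_trans[OF x1(1)] rcong_sym[OF x2(1)] by simp
qed

lemma curve_family_greedy_curve: "curve_family {1..n - 2 * k} greedy_curve"
proof
  show "greedy_curve p x \<noteq> greedy_curve r x"
    if "p \<in> {1..n - 2 * k}" "q \<in> {1..n - 2 * k}" "r \<in> {1..n - 2 * k}" "p \<noteq> q" "p \<noteq> r" "q \<noteq> r"
      and meet: "greedy_curve p x = greedy_curve q x" for p q r x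
  proof
    assume "greedy_curve p x = greedy_curve r x"
    then have "card {p, q, r} \<le> card {s \<in> {1..n - 2 * k}. greedy_curve s x = greedy_curve p x}"
      using that meet by (intro card_mono) auto
    then show False
      using that(4-6) card_greedy_curves_le[of x "greedy_curve p x"]
        card_through_le_2[of x "greedy_curve p x"] by simp
  qed
qed (rule finite_atLeastAtMost antiperiodic_greedy_curve sparse_greedy_meetings
    greedy_crossing_unique; assumption)+

lemma covers_kernel_greedy_curve: "covers_kernel {1..n - 2 * k} greedy_curve"
  unfolding covers_kernel_def using curve_family_greedy_curve greedy_curves_cover by blast

lemma greedy_contacts_precede_crossings: "contacts_precede_crossings {1..n - 2 * k} greedy_curve"
  unfolding contacts_precede_crossings_def
proof (intro ballI allI impI, rule ccontr)
  fix p q x x'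
  assume pq: "p \<in> {1..n - 2 * k}" "q \<in> {1..n - 2 * k}" "p \<noteq> q"
    and W: "(x, greedy_curve p x) \<in> W" "(x', greedy_curve p x') \<in> W"
    and meet: "touches (greedy_curve p) (greedy_curve q) x"
      "crosses (greedy_curve p) (greedy_curve q) x'" and "\<not> x < x'"
  then have "x' < x" using crosses_not_touches by (metis linorder_neqE)
  then show False using no_meeting_after_crossing[OF pq W(2,1) meet(2)] touches_imp_eq[OF meet(1)]
    by blast
qed

theorem greedy_crossing_iff_saturated:
  assumes \<alpha>\<beta>: "\<alpha> \<in> {1..n}" "\<beta> \<in> {1..n}" "\<alpha> < \<beta>"
  shows "(X \<alpha> \<beta>, f \<alpha> (X \<alpha> \<beta>)) \<in> crossings {1..n - 2 * k} greedy_curve \<longleftrightarrow> saturated \<alpha> \<beta>"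
proof
  assume "(X \<alpha> \<beta>, f \<alpha> (X \<alpha> \<beta>)) \<in> crossings {1..n - 2 * k} greedy_curve"
  then obtain p q where pq: "p \<in> {1..n - 2 * k}" "q \<in> {1..n - 2 * k}" "p \<noteq> q"
    "greedy_curve p (X \<alpha> \<beta>) = f \<alpha> (X \<alpha> \<beta>)" "greedy_curve q (X \<alpha> \<beta>) = f \<alpha> (X \<alpha> \<beta>)"
    and cross: "crosses (greedy_curve p) (greedy_curve q) (X \<alpha> \<beta>)" by (rule crossingsE)
  consider "p < q" | "q < p" using pq(3) by linarith
  then show "saturated \<alpha> \<beta>"
    using greedy_curves_cross_iff[OF \<alpha>\<beta> pq(1,2) _ pq(4,5)]
      greedy_curves_cross_iff[OF \<alpha>\<beta> pq(2,1) _ pq(5,4)]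
      cross crosses_commute by cases blast+
next
  assume saturated: "saturated \<alpha> \<beta>"
  obtain p q where pq: "p \<in> {1..n - 2 * k}" "q \<in> {1..n - 2 * k}" "p < q"
    "greedy_curve p (X \<alpha> \<beta>) = f \<alpha> (X \<alpha> \<beta>)" "greedy_curve q (X \<alpha> \<beta>) = f \<alpha> (X \<alpha> \<beta>)"
    using greedy_curves_through_saturated[OF \<alpha>\<beta> saturated] .
  have "crosses (greedy_curve p) (greedy_curve q) (X \<alpha> \<beta>)"
    using greedy_curves_cross_iff[OF \<alpha>\<beta> pq] saturated by blast
  then show "(X \<alpha> \<beta>, f \<alpha> (X \<alpha> \<beta>)) \<in> crossings {1..n - 2 * k} greedy_curve"
    using crossingsI[OF pq(1,2)] pq(3,4) by force
qed

end

section \<open>The window of a cut\<close>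

lemma path_le_imp_less: "path_le L z z' \<Longrightarrow> z = z' \<or> fst z < fst z'"
  unfolding path_le_def
proof (induction rule: rtranclp_induct)
  case (step y z)
  then have "fst y < fst z" unfolding lifted_edge_def by blast
  then show ?case using step.IH by auto
qed simp

lemma path_le_trans: "path_le L u v \<Longrightarrow> path_le L v w \<Longrightarrow> path_le L u w"
  unfolding path_le_def by (rule rtranclp_trans)

lemma mem_tau_image_iff: "(x, y) \<in> tau ` S \<longleftrightarrow> (x - pi, - y) \<in> S"
  by (force simp: tau_def image_iff)

context curve_family
begin

lemma lifted_vertices_arrangement_of: "lifted_vertices (arrangement_of G g) = vertices G g"
  unfolding lifted_vertices_def using mem_intersection_points_iff by blast

lemma mem_lifted_curve_iff: "p \<in> G \<Longrightarrow> z \<in> mproj -` proj_graph (g p) \<longleftrightarrow> snd z = g p (fst z)"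
  using mem_curve_iff[of p "fst z" "snd z"] by simp

lemma finite_vertex_abscissas: "finite ({a..b} \<inter> fst ` vertices G g)"
  by (intro sparse_in_compact_finite sparse_in_subset[OF sparse_fst_vertices]) auto

lemma vertex_diff_pi_iff: "(x - pi, - y) \<in> vertices G g \<longleftrightarrow> (x, y) \<in> vertices G g"
  using deck_mem_vertices_iff[of "- 1" "(x, y)"] by (simp add: deck_def)

lemma follows_no_vertex_between:
  assumes h: "follows G g h" and "a < b" and none: "\<And>t. a < t \<Longrightarrow> t < b \<Longrightarrow> (t, h t) \<notin> vertices G g"
  shows "\<exists>p\<in>G. \<forall>t\<in>{a..b}. h t = g p t"
proof -
  have h_anti: "antiperiodic h" using h by (simp add: follows_def)
  have "\<exists>!p. p \<in> G \<and> h t = g p t" if "t \<in> {a<..<b}" for t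
  proof -
    obtain p where "p \<in> G" "h t = g p t" using h by (auto simp: follows_def)
    moreover have "(t, h t) \<notin> vertices G g" using none that by simp
    ultimately show ?thesis by (intro ex1I[of _ p]) (auto intro: verticesI)
  qed
  then have "\<exists>p\<in>G. \<forall>t\<in>{a<..<b}. h t = g p t"
    using \<open>a < b\<close> antiperiodic_continuous_on[OF h_anti] continuous finite_index
    by (intro connected_unique_choice) auto
  then obtain p where p: "p \<in> G" "\<And>t. a < t \<Longrightarrow> t < b \<Longrightarrow> h t = g p t" by auto
  then have "\<forall>\<^sub>F t in at_right a. h t = g p t" "\<forall>\<^sub>F t in at_left b. h t = g p t"
    unfolding eventually_at_right_field eventually_at_left_field using \<open>a < b\<close> by blast+
  then have "h a = g p a" "h b = g p b"
    using antiperiodic_eq_right_limit antiperiodic_eq_left_limit h_anti antiperiodic[OF p(1)] by blast+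
  then have "\<forall>t\<in>{a..b}. h t = g p t" using p(2) by (auto simp: order_le_less)
  then show ?thesis using p(1) by blast
qed

lemma lifted_edge_along:
  assumes h: "follows G g h" and v: "(x1, h x1) \<in> vertices G g" "(x2, h x2) \<in> vertices G g" and "x1 < x2"
    and none: "\<And>t. x1 < t \<Longrightarrow> t < x2 \<Longrightarrow> (t, h t) \<notin> vertices G g"
  shows "lifted_edge (arrangement_of G g) (x1, h x1) (x2, h x2)"
proof -
  obtain p where p: "p \<in> G" "\<forall>t\<in>{x1..x2}. h t = g p t"
    using follows_no_vertex_between[OF h \<open>x1 < x2\<close> none] by blast
  show ?thesis
    unfolding lifted_edge_def lifted_vertices_arrangement_of
  proof (intro bexI[of _ "proj_graph (g p)"] conjI ballI)
    show "(x1, h x1) \<in> vertices G g \<inter> mproj -` proj_graph (g p)"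
      "(x2, h x2) \<in> vertices G g \<inter> mproj -` proj_graph (g p)"
      using v p \<open>x1 < x2\<close> by (simp_all add: mem_curve_iff)
    show "proj_graph (g p) \<in> arrangement_of G g" using p(1) by (simp add: arrangement_of_def)
    fix u assume "u \<in> vertices G g \<inter> mproj -` proj_graph (g p)"
    then have "(fst u, g p (fst u)) \<in> vertices G g"
      using mem_lifted_curve_iff[OF p(1), of u] by (metis IntE prod.collapse)
    then show "\<not> (fst (x1, h x1) < fst u \<and> fst u < fst (x2, h x2))" using none[of "fst u"] p(2) by auto
  qed (use \<open>x1 < x2\<close> in simp)
qed

lemma path_le_along:
  assumes h: "follows G g h" and "(x1, h x1) \<in> vertices G g" "(x2, h x2) \<in> vertices G g" "x1 \<le> x2"
  shows "path_le (arrangement_of G g) (x1, h x1) (x2, h x2)"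
  using assms(2-4)
proof (induction "card ({t. (t, h t) \<in> vertices G g} \<inter> {x1<..<x2})" arbitrary: x1 x2 rule: less_induct)
  case less
  let ?V = "\<lambda>a b. {t. (t, h t) \<in> vertices G g} \<inter> {a<..<b}"
  have fin: "finite (?V a b)" for a b
    by (rule finite_subset[OF _ finite_vertex_abscissas[of a b]]) force
  consider "x1 = x2" | "x1 < x2" "?V x1 x2 = {}" | t where "(t, h t) \<in> vertices G g" "x1 < t" "t < x2"
    using less.prems(3) by fastforce
  then show ?case
  proof cases
    case 1
    then show ?thesis by (simp add: path_le_def)
  next
    case 2
    then have "lifted_edge (arrangement_of G g) (x1, h x1) (x2, h x2)"
      by (intro lifted_edge_along[OF h less.prems(1,2)]) auto
    then show ?thesis unfolding path_le_def by blast
  next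
    case 3
    then have "?V x1 t \<subset> ?V x1 x2" "?V t x2 \<subset> ?V x1 x2" by auto
    then have "card (?V x1 t) < card (?V x1 x2)" "card (?V t x2) < card (?V x1 x2)"
      using fin by (auto intro: psubset_card_mono)
    then have "path_le (arrangement_of G g) (x1, h x1) (t, h t)"
      "path_le (arrangement_of G g) (t, h t) (x2, h x2)"
      using less.hyps[of x1 t] less.hyps[of t x2] less.prems 3 by auto
    then show ?thesis by (rule path_le_trans)
  qed
qed

end

locale cut = contact_free_family I f k for I :: "'a set" and f :: "'a \<Rightarrow> real \<Rightarrow> real" and k :: nat +
  fixes F :: "(real \<times> real) set" and c :: "real \<Rightarrow> real \<times> real"
  assumes cut_filter: "cut_filter (arrangement_of I f) F"
    and cut_curve: "cut_curve (arrangement_of I f) F c"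
begin

abbreviation L :: "moebius set set" where
  "L \<equiv> arrangement_of I f"

definition cut_parameter :: "'a \<Rightarrow> real" where
  "cut_parameter \<alpha> = (THE t. c t \<in> mproj -` proj_graph (f \<alpha>))"

definition cut_abscissa :: "'a \<Rightarrow> real" where
  "cut_abscissa \<alpha> = fst (c (cut_parameter \<alpha>))"

definition window :: "(real \<times> real) set" where
  "window = F - tau ` F"

lemma line_mem_L: "\<alpha> \<in> I \<Longrightarrow> proj_graph (f \<alpha>) \<in> L"
  by (simp add: arrangement_of_def)

lemma
  assumes "\<alpha> \<in> I"
  shows cut_parameter: "c (cut_parameter \<alpha>) \<in> mproj -` proj_graph (f \<alpha>)"
    and cut_parameter_unique: "c t \<in> mproj -` proj_graph (f \<alpha>) \<Longrightarrow> t = cut_parameter \<alpha>"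
proof -
  have ex1: "\<exists>!t. c t \<in> mproj -` proj_graph (f \<alpha>)"
    using cut_curve[unfolded cut_curve_def] line_mem_L[OF assms] by (elim conjE) (rule bspec)
  show "c (cut_parameter \<alpha>) \<in> mproj -` proj_graph (f \<alpha>)"
    unfolding cut_parameter_def by (rule theI'[OF ex1])
  show "c t \<in> mproj -` proj_graph (f \<alpha>) \<Longrightarrow> t = cut_parameter \<alpha>"
    unfolding cut_parameter_def by (rule the1_equality[OF ex1, symmetric])
qed

lemma cut_point: "\<alpha> \<in> I \<Longrightarrow> c (cut_parameter \<alpha>) = (cut_abscissa \<alpha>, f \<alpha> (cut_abscissa \<alpha>))"
  using cut_parameter mem_lifted_curve_iff by (simp add: cut_abscissa_def prod_eq_iff)

lemma filter_subset: "F \<subseteq> vertices I f"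
  using cut_filter by (simp add: cut_filter_def lifted_vertices_arrangement_of)

lemma
  assumes \<alpha>: "\<alpha> \<in> I" and vertex: "(x, f \<alpha> x) \<in> vertices I f"
  shows mem_filter_iff: "(x, f \<alpha> x) \<in> F \<longleftrightarrow> cut_abscissa \<alpha> < x"
    and not_mem_filter_iff: "(x, f \<alpha> x) \<notin> F \<longleftrightarrow> x < cut_abscissa \<alpha>"
proof -
  have "((x, f \<alpha> x) \<in> F \<longrightarrow> cut_abscissa \<alpha> < x) \<and> ((x, f \<alpha> x) \<notin> F \<longrightarrow> x < cut_abscissa \<alpha>)"
    using cut_curve[unfolded cut_curve_def, THEN conjunct2, THEN conjunct2, THEN conjunct2, THEN
      conjunct2,
        rule_format, OF line_mem_L[OF \<alpha>] cut_parameter[OF \<alpha>], of "(x, f \<alpha> x)"] vertex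
    by (simp add: lifted_vertices_arrangement_of mem_curve_iff[OF \<alpha>] cut_abscissa_def)
  then show "(x, f \<alpha> x) \<in> F \<longleftrightarrow> cut_abscissa \<alpha> < x" "(x, f \<alpha> x) \<notin> F \<longleftrightarrow> x < cut_abscissa \<alpha>" by auto
qed

lemma mem_window_along_iff:
  "antiperiodic h \<Longrightarrow> (x, h x) \<in> window \<longleftrightarrow> (x, h x) \<in> F \<and> (x - pi, h (x - pi)) \<notin> F"
  by (simp add: window_def mem_tau_image_iff antiperiodic_diff_pi)

lemma window_subset: "window \<subseteq> vertices I f"
  using filter_subset by (auto simp: window_def)

lemma vertex_on_line_diff_pi:
  assumes "antiperiodic h" "(x, h x) \<in> vertices I f" shows "(x - pi, h (x - pi)) \<in> vertices I f"
  using assms vertex_diff_pi_iff by (simp add: antiperiodic_diff_pi)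

lemma mem_window_iff:
  assumes \<alpha>: "\<alpha> \<in> I" and vertex: "(x, f \<alpha> x) \<in> vertices I f"
  shows "(x, f \<alpha> x) \<in> window \<longleftrightarrow> cut_abscissa \<alpha> < x \<and> x < cut_abscissa \<alpha> + pi"
  unfolding mem_window_along_iff[OF antiperiodic[OF \<alpha>]] mem_filter_iff[OF assms]
    not_mem_filter_iff[OF \<alpha> vertex_on_line_diff_pi[OF antiperiodic[OF \<alpha>] vertex]] by auto

lemma filter_along:
  assumes "follows I f h" "(x1, h x1) \<in> F" "(x2, h x2) \<in> vertices I f" "x1 \<le> x2"
  shows "(x2, h x2) \<in> F"
proof -
  have "path_le L (x1, h x1) (x2, h x2)"
    by (rule path_le_along[OF assms(1) subsetD[OF filter_subset assms(2)] assms(3,4)])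
  then show ?thesis using cut_filter assms(2,3)
    unfolding cut_filter_def lifted_vertices_arrangement_of by simp
qed

lemma window_meets_orbit: assumes "z \<in> vertices I f" shows "\<exists>r. deck r z \<in> window"
proof -
  obtain x y where z: "z = (x, y)" by fastforce
  then obtain \<alpha> where \<alpha>: "\<alpha> \<in> I" "f \<alpha> x = y" using assms by (auto elim: verticesE)
  obtain x0 where x0: "[x = x0] (rmod pi)" "cut_abscissa \<alpha> \<le> x0" "x0 < cut_abscissa \<alpha> + pi"
    using rcong_representative[OF pi_gt_zero] .
  then obtain r where "x0 = x + of_int r * pi" by (auto simp: rcong_altdef)
  then have deck: "deck r z = (x0, f \<alpha> x0)"
    using deck_graph[OF antiperiodic[OF \<alpha>(1)], of r x] z \<alpha>(2) by simp
  then have vertex: "(x0, f \<alpha> x0) \<in> vertices I f" using assms deck_mem_vertices_iff[of r z] by simp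
  then have "x0 \<noteq> cut_abscissa \<alpha>"
    using mem_filter_iff[OF \<alpha>(1) vertex] not_mem_filter_iff[OF \<alpha>(1) vertex] by auto
  then have "(x0, f \<alpha> x0) \<in> window" using mem_window_iff[OF \<alpha>(1) vertex] x0 by simp
  then show ?thesis using deck by metis
qed

lemma finite_window: "finite window"
proof (rule finite_subset)
  let ?segment = "\<lambda>\<alpha>. (\<lambda>t. (t, f \<alpha> t)) ` ({cut_abscissa \<alpha>..cut_abscissa \<alpha> + pi} \<inter> fst ` vertices I f)"
  show "finite (\<Union>\<alpha>\<in>I. ?segment \<alpha>)" using finite_index finite_vertex_abscissas by simp
  show "window \<subseteq> (\<Union>\<alpha>\<in>I. ?segment \<alpha>)"
  proof
    fix z assume z: "z \<in> window"
    obtain x y where xy: "z = (x, y)" by fastforce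
    have vertex: "(x, y) \<in> vertices I f" using z window_subset xy by blast
    then obtain \<alpha> where \<alpha>: "\<alpha> \<in> I" "f \<alpha> x = y" by (auto elim: verticesE)
    then have "cut_abscissa \<alpha> < x" "x < cut_abscissa \<alpha> + pi"
      using mem_window_iff[OF \<alpha>(1)] z vertex xy by auto
    then have "x \<in> {cut_abscissa \<alpha>..cut_abscissa \<alpha> + pi} \<inter> fst ` vertices I f" using vertex by force
    then show "z \<in> (\<Union>\<alpha>\<in>I. ?segment \<alpha>)" using \<alpha> xy by blast
  qed
qed

sublocale cut_window I f k window
proof
  fix h x1 x3 assume h: "follows I f h" and W: "(x1, h x1) \<in> window" "(x3, h x3) \<in> window"
  have anti: "antiperiodic h" using h by (simp add: follows_def)
  note window_iff = mem_window_along_iff[OF anti]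
  have F: "(x1, h x1) \<in> F" "(x3 - pi, h (x3 - pi)) \<notin> F" using W window_iff by auto
  have vertex: "(x3 - pi, h (x3 - pi)) \<in> vertices I f"
    by (rule vertex_on_line_diff_pi[OF anti]) (use W(2) window_subset in blast)
  show "x3 < x1 + pi"
  proof (rule ccontr)
    assume "\<not> ?thesis"
    then show False using filter_along[OF h F(1) vertex] F(2) by simp
  qed
  show "(x2, h x2) \<in> window" if x2: "x1 < x2" "x2 < x3" "(x2, h x2) \<in> vertices I f" for x2
    using filter_along[OF h F(1) x2(3)] filter_along[OF h _ vertex, of "x2 - pi"] F(2) x2 window_iff
    by auto
qed (use window_subset window_meets_orbit finite_window in auto)

lemma inj_on_mproj_window: "inj_on mproj window"
proof (rule inj_onI)
  fix z z' assume W: "z \<in> window" "z' \<in> window" and "mproj z = mproj z'"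
  obtain x y x' y' where xy: "z = (x, y)" "z' = (x', y')" by fastforce
  have vertices: "(x, y) \<in> vertices I f" "(x', y') \<in> vertices I f" using W window_subset xy by auto
  then obtain \<alpha> where \<alpha>: "\<alpha> \<in> I" "f \<alpha> x = y" by (auto elim: verticesE)
  have "[x = x'] (rmod pi)" and y': "f \<alpha> x' = y'"
    using \<open>mproj z = mproj z'\<close> mproj_eq_graph_iff[OF antiperiodic[OF \<alpha>(1)], of x' y' x] \<alpha>(2) xy by auto
  moreover have "cut_abscissa \<alpha> < x" "x < cut_abscissa \<alpha> + pi" "cut_abscissa \<alpha> < x'"
    "x' < cut_abscissa \<alpha> + pi"
    using mem_window_iff[OF \<alpha>(1)] W vertices \<alpha>(2) y' xy by auto
  ultimately have "x = x'" by (intro rcong_imp_eq[of x _ pi]) (auto simp: abs_if)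
  then show "z = z'" using \<alpha>(2) y' xy by simp
qed

lemma cut_less_iff:
  assumes h: "follows I f h" and W: "(x, h x) \<in> window" "(x', h x') \<in> window"
  shows "cut_less L F (mproj (x, h x)) (mproj (x', h x')) \<longleftrightarrow> x < x'"
proof
  assume less: "cut_less L F (mproj (x, h x)) (mproj (x', h x'))"
  then obtain v w where vw: "v \<in> window" "w \<in> window" "mproj v = mproj (x, h x)"
      "mproj w = mproj (x', h x')" "path_le L v w"
    unfolding cut_less_def cut_le_def window_def by blast
  then have "v = (x, h x)" "w = (x', h x')" using W inj_onD[OF inj_on_mproj_window] by blast+
  then have "(x, h x) = (x', h x') \<or> x < x'" using path_le_imp_less[OF vw(5)] by simp
  then show "x < x'" using less unfolding cut_less_def by auto
next
  assume "x < x'"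
  then have "path_le L (x, h x) (x', h x')"
    by (intro path_le_along[OF h] subsetD[OF window_subset] W less_imp_le)
  then have "cut_le L F (mproj (x, h x)) (mproj (x', h x'))"
    unfolding cut_le_def window_def[symmetric] using W by blast
  moreover have "mproj (x, h x) \<noteq> mproj (x', h x')"
    using inj_onD[OF inj_on_mproj_window _ W] \<open>x < x'\<close> by auto
  ultimately show "cut_less L F (mproj (x, h x)) (mproj (x', h x'))" by (simp add: cut_less_def)
qed

section \<open>The greedy pseudotriangulation\<close>

lemma contact_points_empty: "contact_points L = {}"
proof -
  have "p \<notin> contact_points L" for p
  proof -
    obtain x y where p: "p = mproj (x, y)" by (rule mproj_cases)
    have "(x, y) \<notin> contacts I f"
    proof
      assume "(x, y) \<in> contacts I f"
      then obtain \<alpha> \<beta> where "\<alpha> \<in> I" "\<beta> \<in> I" "\<alpha> \<noteq> \<beta>" "touches (f \<alpha>) (f \<beta>) x" by (rule contactsE)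
      then show False using meet_crosses touches_imp_eq crosses_not_touches by blast
    qed
    then show ?thesis by (simp add: p mem_contact_points_iff)
  qed
  then show ?thesis by blast
qed

lemma pseudotriangulation_iff_covers_kernel:
  assumes "curve_family G g" shows "pseudotriangulation L k (arrangement_of G g) \<longleftrightarrow> covers_kernel G g"
proof -
  interpret G: curve_family G g by (rule assms)
  have "support (arrangement_of G g) = kernel L k \<longleftrightarrow>
      (\<forall>x y. mproj (x, y) \<in> support (arrangement_of G g) \<longleftrightarrow> mproj (x, y) \<in> kernel L k)"
    by (metis mproj_cases set_eqI)
  then show ?thesis
    unfolding pseudotriangulation_def covers_kernel_def G.mem_support_iff mem_kernel_iff
    by (simp add: G.simple_arrangement_of contact_points_empty assms)
qed

lemma pseudotriangulation_rep_fun: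
  assumes "pseudotriangulation L k \<Lambda>"
  shows "arrangement_of \<Lambda> rep_fun = \<Lambda>" "covers_kernel \<Lambda> rep_fun"
proof -
  have simple: "simple_arrangement \<Lambda>" using assms by (simp add: pseudotriangulation_def)
  show eq: "arrangement_of \<Lambda> rep_fun = \<Lambda>"
    using simple arrangement_of_rep_fun by (simp add: simple_arrangement_def)
  show "covers_kernel \<Lambda> rep_fun"
    using pseudotriangulation_iff_covers_kernel[OF curve_family_rep_fun[OF simple]] assms eq by simp
qed

lemma source_contacts_precede_crossings:
  assumes G: "covers_kernel G g" and source: "\<nexists>\<Lambda>. increasing_flip_arc L F k \<Lambda> (arrangement_of G g)"
  shows "contacts_precede_crossings G g"
  unfolding contacts_precede_crossings_def
proof (intro ballI allI impI, rule ccontr)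
  interpret G: curve_family G g by (rule covers_kernel_family[OF G])
  fix p q xw xv
  assume pq: "p \<in> G" "q \<in> G" "p \<noteq> q" and W: "(xw, g p xw) \<in> window" "(xv, g p xv) \<in> window"
    and meet: "touches (g p) (g q) xw" "crosses (g p) (g q) xv" and "\<not> xw < xv"
  then have "xv < xw" using crosses_not_touches by (metis linorder_neqE)
  note line = covers_kernel_follows_lines[OF G pq(1)]
  interpret exchange G g p q xv xw
    using pq meet \<open>xv < xw\<close> W_width[OF line W(2,1)] by unfold_locales auto
  have "covers_kernel G exchanged"
    using G curve_family_exchanged unfolding covers_kernel_def exchanged_support_iff by blast
  then have "pseudotriangulation L k (arrangement_of G exchanged)"
    using pseudotriangulation_iff_covers_kernel[OF curve_family_exchanged] by blast
  moreover have "pseudotriangulation L k (arrangement_of G g)"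
    using pseudotriangulation_iff_covers_kernel[OF G.curve_family_axioms] G by blast
  moreover have "cut_less L F (mproj (xv, g p xv)) (mproj (xw, g p xw))"
    using cut_less_iff[OF line W(2,1)] \<open>xv < xw\<close> by blast
  ultimately have "increasing_flip_arc L F k (arrangement_of G exchanged) (arrangement_of G g)"
    using flip_exchanged unfolding increasing_flip_arc_def by blast
  then show False using source by blast
qed

lemma
  assumes \<Lambda>: "pseudotriangulation L k \<Lambda>" and PQ: "P \<in> \<Lambda>" "Q \<in> \<Lambda>" "P \<noteq> Q"
  shows contact_point_in_window: "contact_point P Q z \<Longrightarrow>
      \<exists>x. (x, rep_fun P x) \<in> window \<and> touches (rep_fun P) (rep_fun Q) x \<and> z = mproj (x, rep_fun P x)"
    and crossing_point_in_window: "crossing_point P Q z \<Longrightarrow>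
      \<exists>x. (x, rep_fun P x) \<in> window \<and> crosses (rep_fun P) (rep_fun Q) x \<and> z = mproj (x, rep_fun P x)"
proof -
  have pseudoline: "pseudoline P" "pseudoline Q"
    using \<Lambda> PQ unfolding pseudotriangulation_def simple_arrangement_def arrangement_def by blast+
  note anti = antiperiodic_rep_fun[OF pseudoline(1)] antiperiodic_rep_fun[OF pseudoline(2)]
  obtain x1 y where z: "z = mproj (x1, y)" by (rule mproj_cases)
  have lift: "\<exists>x. (x, rep_fun P x) \<in> window \<and> [x1 = x] (rmod pi) \<and> z = mproj (x, rep_fun P x)"
    if meet: "y = rep_fun P x1" "rep_fun P x1 = rep_fun Q x1"
  proof -
    obtain x where "[x1 = x] (rmod pi)" "(x, rep_fun P x) \<in> window"
      using vertex_in_W_along_pair[OF pseudotriangulation_rep_fun(2)[OF \<Lambda>] PQ meet(2)] .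
    then show ?thesis unfolding z mproj_eq_graph_iff[OF anti(1)] using meet(1) rcong_sym by blast
  qed
  show "\<exists>x. (x, rep_fun P x) \<in> window \<and> touches (rep_fun P) (rep_fun Q) x \<and> z = mproj (x, rep_fun P x)"
    if "contact_point P Q z"
  proof -
    have touch: "y = rep_fun P x1" "touches (rep_fun P) (rep_fun Q) x1"
      using that contact_point_iff[OF pseudoline] z by auto
    then show ?thesis using lift[OF touch(1) touches_imp_eq[OF touch(2)]] touches_rcong[OF anti] by blast
  qed
  show "\<exists>x. (x, rep_fun P x) \<in> window \<and> crosses (rep_fun P) (rep_fun Q) x \<and> z = mproj (x, rep_fun P x)"
    if "crossing_point P Q z"
  proof -
    have cross: "y = rep_fun P x1" "crosses (rep_fun P) (rep_fun Q) x1"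
      using that crossing_point_iff[OF pseudoline] z by auto
    then show ?thesis using lift[OF cross(1) crosses_imp_eq[OF cross(2)]] crosses_rcong[OF anti] by blast
  qed
qed

lemma contacts_precede_crossings_imp_source:
  assumes G: "covers_kernel G g" "contacts_precede_crossings G g"
  shows "\<not> increasing_flip_arc L F k \<Lambda> (arrangement_of G g)"
proof
  assume "increasing_flip_arc L F k \<Lambda> (arrangement_of G g)"
  then obtain v w where \<Lambda>: "pseudotriangulation L k \<Lambda>" and flip: "flip \<Lambda> (arrangement_of G g) v w"
      and less: "cut_less L F v w"
    unfolding increasing_flip_arc_def by blast
  note \<Lambda>_eq = pseudotriangulation_rep_fun(1)[OF \<Lambda>] and cover = pseudotriangulation_rep_fun(2)[OF \<Lambda>]
  interpret G: curve_family G g by (rule covers_kernel_family[OF G(1)])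
  interpret \<Lambda>: curve_family \<Lambda> rep_fun by (rule covers_kernel_family[OF cover])
  obtain P Q where PQ: "P \<in> \<Lambda>" "Q \<in> \<Lambda>" "P \<noteq> Q" and points: "contact_point P Q v" "crossing_point P Q w"
    and contacts: "contact_points (arrangement_of G g) = contact_points \<Lambda> - {v} \<union> {w}"
    using flip unfolding flip_def by blast
  obtain xv where xv: "(xv, rep_fun P xv) \<in> window" "touches (rep_fun P) (rep_fun Q) xv"
      "v = mproj (xv, rep_fun P xv)"
    using contact_point_in_window[OF \<Lambda> PQ points(1)] by blast
  obtain xw where xw: "(xw, rep_fun P xw) \<in> window" "crosses (rep_fun P) (rep_fun Q) xw"
      "w = mproj (xw, rep_fun P xw)"
    using crossing_point_in_window[OF \<Lambda> PQ points(2)] by blast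
  have contacts_iff: "z \<in> contacts G g \<longleftrightarrow> z \<in> contacts \<Lambda> rep_fun \<and> mproj z \<noteq> v \<or> mproj z = w" for z
    using contacts G.mem_contact_points_iff[of z] \<Lambda>.mem_contact_points_iff[of z] unfolding \<Lambda>_eq by blast
  have "v \<noteq> w" using less by (simp add: cut_less_def)
  have "xw < xv"
  proof (rule no_increasing_flip_to_source[OF cover G PQ xv(2,1) xw(2,1)])
    show "(xv, rep_fun P xv) \<notin> contacts G g" "(xw, rep_fun P xw) \<in> contacts G g"
      using contacts_iff xv(3) xw(3) \<open>v \<noteq> w\<close> by auto
    show "(x, y) \<in> contacts \<Lambda> rep_fun \<longleftrightarrow> (x, y) \<in> contacts G g"
      if "\<not> [xv = x] (rmod pi)" "\<not> [xw = x] (rmod pi)" for x y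
      using contacts_iff[of "(x, y)"] that xv(3) xw(3)
        mproj_eq_graph_iff[OF \<Lambda>.antiperiodic[OF PQ(1)]] by auto
  qed
  moreover have "xv < xw"
    using less cut_less_iff[OF covers_kernel_follows_lines[OF cover PQ(1)] xv(1) xw(1)] xv(3) xw(3)
    by simp
  ultimately show False by simp
qed

theorem greedy_pseudotriangulation_eq:
  assumes G: "covers_kernel G g" "contacts_precede_crossings G g"
  shows "greedy_pseudotriangulation L F k = arrangement_of G g"
  unfolding greedy_pseudotriangulation_def
proof (rule the_equality, intro conjI)
  show "pseudotriangulation L k (arrangement_of G g)"
    using pseudotriangulation_iff_covers_kernel[OF covers_kernel_family[OF G(1)]] G(1) by blast
  show "\<nexists>\<Lambda>. increasing_flip_arc L F k \<Lambda> (arrangement_of G g)"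
    using contacts_precede_crossings_imp_source[OF G] by blast
next
  fix \<Lambda> assume source: "pseudotriangulation L k \<Lambda> \<and> (\<nexists>\<Lambda>'. increasing_flip_arc L F k \<Lambda>' \<Lambda>)"
  then have eq: "arrangement_of \<Lambda> rep_fun = \<Lambda>" and cover: "covers_kernel \<Lambda> rep_fun"
    using pseudotriangulation_rep_fun by blast+
  have "contacts_precede_crossings \<Lambda> rep_fun"
    by (rule source_contacts_precede_crossings[OF cover]) (use source eq in simp)
  note unique = covering_curves_unique[OF cover this G] covering_curves_unique[OF G cover this]
  have "rep_fun ` \<Lambda> = g ` G" using unique by (auto simp: image_iff)
  then have "proj_graph ` rep_fun ` \<Lambda> = proj_graph ` g ` G" by simp
  then have "arrangement_of \<Lambda> rep_fun = arrangement_of G g" by (simp add: arrangement_of_def image_image)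
  then show "\<Lambda> = arrangement_of G g" using eq by simp
qed

end

section \<open>Separated chains\<close>

lemma ex_strict_mono_on_subset_iff:
  fixes S :: "nat set"
  assumes "finite S"
  shows "(\<exists>s. strict_mono_on {1..k} s \<and> s ` {1..k} \<subseteq> S) \<longleftrightarrow> k \<le> card S"
proof
  assume "\<exists>s. strict_mono_on {1..k} s \<and> s ` {1..k} \<subseteq> S"
  then obtain s where s: "strict_mono_on {1..k} s" "s ` {1..k} \<subseteq> S" by blast
  then show "k \<le> card S"
    using card_mono[OF assms s(2)] card_image[OF strict_mono_on_imp_inj_on[OF s(1)]] by simp
next
  assume k: "k \<le> card S"
  obtain s where s: "bij_betw s {..<card S} S" "strict_mono_on {..<card S} s"
    by (rule ex_bij_betw_strict_mono_card[OF assms])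
  have "strict_mono_on {1..k} (\<lambda>i. s (i - 1))"
    using k by (intro strict_mono_onI strict_mono_onD[OF s(2)]) auto
  moreover have "(\<lambda>i. s (i - 1)) ` {1..k} \<subseteq> S" using k bij_betwE[OF s(1)] by auto
  ultimately show "\<exists>s. strict_mono_on {1..k} s \<and> s ` {1..k} \<subseteq> S" by blast
qed

lemma separated_chains_iff:
  fixes \<alpha> \<beta> n k :: nat
  assumes "1 \<le> k" "1 \<le> \<alpha>" "\<alpha> < \<beta>" "\<beta> \<le> n"
  shows "(\<exists>\<gamma> \<delta>. \<gamma> ` {1..k} \<subseteq> {1..n} \<and> \<delta> ` {1..k} \<subseteq> {1..n} \<and>
      strict_mono_on {1..k} \<gamma> \<and> strict_mono_on {1..k} \<delta> \<and>
      \<alpha> < \<gamma> 1 \<and> \<delta> k < \<beta> \<and> \<delta> k < \<gamma> 1 \<and> (\<forall>i\<in>{1..k}. P (\<gamma> i) \<and> Q (\<delta> i))) \<longleftrightarrow>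
    (\<exists>t. \<alpha> \<le> t \<and> t < \<beta> \<and> k \<le> card {\<gamma> \<in> {t<..n}. P \<gamma>} \<and> k \<le> card {\<delta> \<in> {1..t}. Q \<delta>})"
    (is "(\<exists>\<gamma> \<delta>. ?chains \<gamma> \<delta>) \<longleftrightarrow> (\<exists>t. ?cards t)")
proof
  assume "\<exists>\<gamma> \<delta>. ?chains \<gamma> \<delta>"
  then obtain \<gamma> \<delta> where chains: "?chains \<gamma> \<delta>" by blast
  define t where "t = max \<alpha> (\<delta> k)"
  have t: "\<alpha> \<le> t" "t < \<beta>" "\<delta> k \<le> t" "t < \<gamma> 1" using chains assms(3) by (auto simp: t_def)
  have mono: "strict_mono_on {1..k} \<gamma>" "strict_mono_on {1..k} \<delta>" using chains by blast+
  have "\<gamma> 1 \<le> \<gamma> i" "\<delta> i \<le> \<delta> k" if "i \<in> {1..k}" for i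
    using strict_mono_on_leD[OF mono(1), of 1 i] strict_mono_on_leD[OF mono(2), of i k] that
      assms(1) by auto
  then have "\<gamma> ` {1..k} \<subseteq> {\<gamma> \<in> {t<..n}. P \<gamma>}" "\<delta> ` {1..k} \<subseteq> {\<delta> \<in> {1..t}. Q \<delta>}"
    using chains t by (fastforce simp: image_subset_iff)+
  then have "?cards t"
    using t(1,2) mono ex_strict_mono_on_subset_iff[of "{\<gamma> \<in> {t<..n}. P \<gamma>}" k]
      ex_strict_mono_on_subset_iff[of "{\<delta> \<in> {1..t}. Q \<delta>}" k] by auto
  then show "\<exists>t. ?cards t" by blast
next
  assume "\<exists>t. ?cards t"
  then obtain t where t: "?cards t" by blast
  then obtain \<gamma> \<delta> where \<gamma>: "strict_mono_on {1..k} \<gamma>" "\<gamma> ` {1..k} \<subseteq> {\<gamma> \<in> {t<..n}. P \<gamma>}"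
    and \<delta>: "strict_mono_on {1..k} \<delta>" "\<delta> ` {1..k} \<subseteq> {\<delta> \<in> {1..t}. Q \<delta>}"
    using ex_strict_mono_on_subset_iff[of "{\<gamma> \<in> {t<..n}. P \<gamma>}" k]
      ex_strict_mono_on_subset_iff[of "{\<delta> \<in> {1..t}. Q \<delta>}" k] by auto
  have "1 \<in> {1..k}" "k \<in> {1..k}" using assms(1) by simp_all
  then have "\<gamma> 1 \<in> {t<..n}" "\<delta> k \<in> {1..t}" using \<gamma>(2) \<delta>(2) by blast+
  then have "?chains \<gamma> \<delta>" using \<gamma> \<delta> t assms(4) by (fastforce simp: image_subset_iff)
  then show "\<exists>\<gamma> \<delta>. ?chains \<gamma> \<delta>" by blast
qed

definition blocked_at ::
  "moebius set set \<Rightarrow> (real \<times> real) set \<Rightarrow> nat \<Rightarrow> nat \<Rightarrow> (nat \<Rightarrow> moebius set) \<Rightarrow> nat \<Rightarrow> nat \<Rightarrow> nat \<Rightarrow> bool" where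
  "blocked_at L F k n l t \<alpha> \<beta> \<longleftrightarrow> \<alpha> \<le> t \<and> t < \<beta> \<and>
     k \<le> card {\<gamma> \<in> {t<..n}. cut_less L F (wedge (l \<alpha>) (l \<gamma>)) (wedge (l \<alpha>) (l \<beta>))} \<and>
     k \<le> card {\<delta> \<in> {1..t}. cut_less L F (wedge (l \<beta>) (l \<delta>)) (wedge (l \<alpha>) (l \<beta>))}"

definition blocked ::
  "moebius set set \<Rightarrow> (real \<times> real) set \<Rightarrow> nat \<Rightarrow> nat \<Rightarrow> (nat \<Rightarrow> moebius set) \<Rightarrow> nat \<Rightarrow> nat \<Rightarrow> bool" where
  "blocked L F k n l \<alpha> \<beta> \<longleftrightarrow> (\<exists>t. blocked_at L F k n l t \<alpha> \<beta>)"

lemma greedy_crossings_eq: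
  assumes "1 \<le> k"
  shows "greedy_crossings L F k n l =
    {wedge (l \<alpha>) (l \<beta>) | \<alpha> \<beta>. 1 \<le> \<alpha> \<and> \<alpha> < \<beta> \<and> \<beta> \<le> n \<and> \<not> blocked L F k n l \<alpha> \<beta>}"
  unfolding greedy_crossings_def blocked_def blocked_at_def
  by (intro Collect_cong iff_exI conj_cong refl arg_cong[where f = Not] separated_chains_iff[OF assms])

lemma blocked_imp_kernel_nonempty:
  assumes "blocked L F k n l \<alpha> \<beta>" "1 \<le> \<alpha>" "\<beta> \<le> n" shows "2 * k < n"
proof -
  have irrefl: "\<not> cut_less L F p p" for p by (simp add: cut_less_def)
  obtain t where t: "\<alpha> \<le> t" "t < \<beta>"
    "k \<le> card {\<gamma> \<in> {t<..n}. cut_less L F (wedge (l \<alpha>) (l \<gamma>)) (wedge (l \<alpha>) (l \<beta>))}"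
    "k \<le> card {\<delta> \<in> {1..t}. cut_less L F (wedge (l \<beta>) (l \<delta>)) (wedge (l \<alpha>) (l \<beta>))}"
    using assms(1) unfolding blocked_def blocked_at_def by blast
  note t(3)
  also have "card {\<gamma> \<in> {t<..n}. cut_less L F (wedge (l \<alpha>) (l \<gamma>)) (wedge (l \<alpha>) (l \<beta>))} \<le>
      card ({t<..n} - {\<beta>})"
    using irrefl by (intro card_mono) auto
  finally have ones: "k \<le> n - t - 1" using t(2) assms(3) by simp
  note t(4)
  also have "card {\<delta> \<in> {1..t}. cut_less L F (wedge (l \<beta>) (l \<delta>)) (wedge (l \<alpha>) (l \<beta>))} \<le>
      card ({1..t} - {\<alpha>})"
    using irrefl wedge_commute[of "l \<beta>" "l \<alpha>"] by (intro card_mono) auto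
  finally have "k \<le> t - 1" using t(1) assms(2) by simp
  then show ?thesis using ones t(1,2) assms(2,3) by linarith
qed

lemma card_filter_reverse:
  fixes t n :: nat
  assumes "t \<le> n" shows "card {\<gamma> \<in> {1..n - t}. P (n + 1 - \<gamma>)} = card {\<gamma> \<in> {t<..n}. P \<gamma>}"
  by (rule bij_betw_same_card[of "\<lambda>\<gamma>. n + 1 - \<gamma>"], rule bij_betw_byWitness[where f' = "\<lambda>\<gamma>. n + 1 - \<gamma>"])
    (use assms in auto)

lemma blocked_at_reverse:
  assumes "t \<le> n" "1 \<le> \<alpha>" "\<alpha> \<le> n" "1 \<le> \<beta>" "\<beta> \<le> n"
  shows "blocked_at L F k n (\<lambda>i. l (n + 1 - i)) (n - t) (n + 1 - \<beta>) (n + 1 - \<alpha>) \<longleftrightarrow>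
    blocked_at L F k n l t \<alpha> \<beta>"
proof -
  have bounds: "n + 1 - \<beta> \<le> n - t \<longleftrightarrow> t < \<beta>" "n - t < n + 1 - \<alpha> \<longleftrightarrow> \<alpha> \<le> t" using assms by auto
  have labels: "n + 1 - (n + 1 - \<alpha>) = \<alpha>" "n + 1 - (n + 1 - \<beta>) = \<beta>" "n - (n - t) = t" using assms by auto
  have card: "card {\<gamma> \<in> {n - t<..n}. P (n + 1 - \<gamma>)} = card {\<gamma> \<in> {1..t}. P \<gamma>}" for P
  proof -
    have "n + 1 - (n + 1 - \<gamma>) = \<gamma>" if "\<gamma> \<in> {1..t}" for \<gamma> using that assms(1) by simp
    then have "{\<gamma> \<in> {1..t}. P (n + 1 - (n + 1 - \<gamma>))} = {\<gamma> \<in> {1..t}. P \<gamma>}" by (intro Collect_cong) auto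
    then show ?thesis using card_filter_reverse[of "n - t" n "\<lambda>\<gamma>. P (n + 1 - \<gamma>)"] labels(3) by simp
  qed
  show ?thesis
    unfolding blocked_at_def labels bounds wedge_commute[of "l \<beta>" "l \<alpha>"]
      card[of "\<lambda>\<gamma>. cut_less L F (wedge (l \<beta>) (l \<gamma>)) (wedge (l \<alpha>) (l \<beta>))"]
      card_filter_reverse[OF assms(1), of "\<lambda>\<gamma>. cut_less L F (wedge (l \<alpha>) (l \<gamma>)) (wedge (l \<alpha>) (l \<beta>))"]
    by blast
qed

lemma blocked_reverse:
  assumes "1 \<le> \<alpha>" "\<alpha> < \<beta>" "\<beta> \<le> n"
  shows "blocked L F k n (\<lambda>i. l (n + 1 - i)) (n + 1 - \<beta>) (n + 1 - \<alpha>) \<longleftrightarrow> blocked L F k n l \<alpha> \<beta>"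
proof
  assume "blocked L F k n (\<lambda>i. l (n + 1 - i)) (n + 1 - \<beta>) (n + 1 - \<alpha>)"
  then obtain t where t: "blocked_at L F k n (\<lambda>i. l (n + 1 - i)) t (n + 1 - \<beta>) (n + 1 - \<alpha>)"
    by (auto simp: blocked_def)
  then have "t < n + 1 - \<alpha>" by (simp add: blocked_at_def)
  then have "t \<le> n" using assms(1) by linarith
  then have "blocked_at L F k n l (n - t) \<alpha> \<beta>" using blocked_at_reverse[of "n - t" n \<alpha> \<beta>] t assms by simp
  then show "blocked L F k n l \<alpha> \<beta>" by (auto simp: blocked_def)
next
  assume "blocked L F k n l \<alpha> \<beta>"
  then obtain t where t: "blocked_at L F k n l t \<alpha> \<beta>" by (auto simp: blocked_def)
  then have "t \<le> n" using assms(3) by (auto simp: blocked_at_def)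
  then show "blocked L F k n (\<lambda>i. l (n + 1 - i)) (n + 1 - \<beta>) (n + 1 - \<alpha>)"
    unfolding blocked_def using blocked_at_reverse[of t n \<alpha> \<beta>] t assms by (intro exI[of _ "n - t"]) simp
qed

lemma greedy_crossings_reverse:
  assumes "1 \<le> k" shows "greedy_crossings L F k n (\<lambda>i. l (n + 1 - i)) = greedy_crossings L F k n l"
proof (rule subset_antisym; rule subsetI)
  fix p assume "p \<in> greedy_crossings L F k n (\<lambda>i. l (n + 1 - i))"
  then obtain \<alpha> \<beta> where \<alpha>\<beta>: "1 \<le> \<alpha>" "\<alpha> < \<beta>" "\<beta> \<le> n" "p = wedge (l (n + 1 - \<alpha>)) (l (n + 1 - \<beta>))"
    "\<not> blocked L F k n (\<lambda>i. l (n + 1 - i)) \<alpha> \<beta>" unfolding greedy_crossings_eq[OF assms] by blast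
  then have "\<not> blocked L F k n l (n + 1 - \<beta>) (n + 1 - \<alpha>)"
    using blocked_reverse[of "n + 1 - \<beta>" "n + 1 - \<alpha>" n] by simp
  moreover have "p = wedge (l (n + 1 - \<beta>)) (l (n + 1 - \<alpha>))" using \<alpha>\<beta>(4) wedge_commute by simp
  moreover have "1 \<le> n + 1 - \<beta>" "n + 1 - \<beta> < n + 1 - \<alpha>" "n + 1 - \<alpha> \<le> n" using \<alpha>\<beta>(1-3) by auto
  ultimately show "p \<in> greedy_crossings L F k n l" unfolding greedy_crossings_eq[OF assms] by blast
next
  fix p assume "p \<in> greedy_crossings L F k n l"
  then obtain \<alpha> \<beta> where \<alpha>\<beta>: "1 \<le> \<alpha>" "\<alpha> < \<beta>" "\<beta> \<le> n" "p = wedge (l \<alpha>) (l \<beta>)" "\<not> blocked L F k n l \<alpha> \<beta>"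
    unfolding greedy_crossings_eq[OF assms] by blast
  then have "\<not> blocked L F k n (\<lambda>i. l (n + 1 - i)) (n + 1 - \<beta>) (n + 1 - \<alpha>)"
    using blocked_reverse[of \<alpha> \<beta> n] by simp
  moreover have "p = wedge (l (n + 1 - (n + 1 - \<beta>))) (l (n + 1 - (n + 1 - \<alpha>)))"
    using \<alpha>\<beta>(1-4) wedge_commute by simp
  moreover have "1 \<le> n + 1 - \<beta>" "n + 1 - \<beta> < n + 1 - \<alpha>" "n + 1 - \<alpha> \<le> n" using \<alpha>\<beta>(1-3) by auto
  ultimately show "p \<in> greedy_crossings L F k n (\<lambda>i. l (n + 1 - i))"
    unfolding greedy_crossings_eq[OF assms] by blast
qed

section \<open>Reversing a cut\<close>

lemma cut_curve_reverse: assumes "cut_curve L F c" shows "cut_curve L F (\<lambda>t. c (- t))"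
proof -
  have cont: "continuous_on UNIV c" and inj: "inj c"
    and ends: "filterlim (snd \<circ> c) at_top at_bot \<and> filterlim (snd \<circ> c) at_bot at_top \<or>
      filterlim (snd \<circ> c) at_bot at_bot \<and> filterlim (snd \<circ> c) at_top at_top"
    and once: "\<forall>P\<in>L. \<exists>!t. c t \<in> mproj -` P"
    and separates: "\<forall>P\<in>L. \<forall>t. c t \<in> mproj -` P \<longrightarrow> (\<forall>z \<in> lifted_vertices L \<inter> mproj -` P.
      (z \<in> F \<longrightarrow> fst (c t) < fst z) \<and> (z \<notin> F \<longrightarrow> fst z < fst (c t)))"
    using assms unfolding cut_curve_def by - (elim conjE, assumption)+
  have "continuous_on UNIV (\<lambda>t. c (- t))"
    by (rule continuous_on_compose2[OF cont]) (auto intro: continuous_intros)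
  moreover have "inj (\<lambda>t. c (- t))" by (auto intro!: injI dest!: injD[OF inj])
  moreover have "snd \<circ> (\<lambda>t. c (- t)) = (\<lambda>t. (snd \<circ> c) (- t))" by auto
  then have "filterlim (snd \<circ> (\<lambda>t. c (- t))) at_top at_bot \<and>
      filterlim (snd \<circ> (\<lambda>t. c (- t))) at_bot at_top \<or>
      filterlim (snd \<circ> (\<lambda>t. c (- t))) at_bot at_bot \<and> filterlim (snd \<circ> (\<lambda>t. c (- t))) at_top at_top"
    using ends filterlim_compose[OF _ filterlim_uminus_at_bot_at_top]
      filterlim_compose[OF _ filterlim_uminus_at_top_at_bot]
    by metis
  moreover have "\<forall>P\<in>L. \<exists>!t. c (- t) \<in> mproj -` P" using once by (metis minus_minus)
  ultimately show ?thesis unfolding cut_curve_def using separates by blast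
qed

lemma crossing_order_reverse:
  assumes "crossing_order L c n l" shows "crossing_order L (\<lambda>t. c (- t)) n (\<lambda>i. l (n + 1 - i))"
proof -
  obtain t where l: "bij_betw l {1..n} L"
      and t: "strict_mono_on {1..n} t" "\<forall>i\<in>{1..n}. c (t i) \<in> mproj -` l i"
    using assms unfolding crossing_order_def by blast
  have mem: "n + 1 - i \<in> {1..n}" if "i \<in> {1..n}" for i using that by auto
  have "bij_betw (\<lambda>i. n + 1 - i) {1..n} {1..n}"
    by (rule bij_betw_byWitness[where f' = "\<lambda>i. n + 1 - i"]) auto
  then have "bij_betw (\<lambda>i. l (n + 1 - i)) {1..n} L" using bij_betw_trans[OF _ l] by (simp add: comp_def)
  moreover have "strict_mono_on {1..n} (\<lambda>i. - t (n + 1 - i))"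
    by (intro strict_mono_onI) (auto intro!: strict_mono_onD[OF t(1)])
  moreover have "\<forall>i\<in>{1..n}. c (- (- t (n + 1 - i))) \<in> mproj -` l (n + 1 - i)" using t(2) mem by simp
  ultimately show ?thesis unfolding crossing_order_def by blast
qed

section \<open>The crossings of the greedy pseudotriangulation\<close>

context cut
begin

abbreviation line :: "'a \<Rightarrow> moebius set" where
  "line \<alpha> \<equiv> proj_graph (f \<alpha>)"

lemma wedge_eq_meeting:
  assumes \<alpha>\<beta>: "\<alpha> \<in> I" "\<beta> \<in> I" "\<alpha> \<noteq> \<beta>"
  shows "wedge (line \<alpha>) (line \<beta>) = mproj (meeting \<alpha> \<beta>, f \<alpha> (meeting \<alpha> \<beta>))"
  unfolding wedge_def
proof (rule the1_equality[OF ex1_crossing_point[OF \<alpha>\<beta>]])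
  show "crossing_point (line \<alpha>) (line \<beta>) (mproj (meeting \<alpha> \<beta>, f \<alpha> (meeting \<alpha> \<beta>)))"
    using crossing_point_curves_iff[OF \<alpha>\<beta>(1,2)] meet_crosses[OF \<alpha>\<beta> meeting_eq[OF \<alpha>\<beta>]] by simp
qed

lemma cut_less_wedge_iff:
  assumes "\<alpha> \<in> I" "\<beta> \<in> I" "\<gamma> \<in> I" "\<alpha> \<noteq> \<beta>" "\<alpha> \<noteq> \<gamma>"
  shows "cut_less L F (wedge (line \<alpha>) (line \<gamma>)) (wedge (line \<alpha>) (line \<beta>)) \<longleftrightarrow> meeting \<alpha> \<gamma> < meeting \<alpha> \<beta>"
  unfolding wedge_eq_meeting[OF assms(1,2,4)] wedge_eq_meeting[OF assms(1,3,5)]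
  by (rule cut_less_iff[OF follows_line]) (use assms meeting_in_W in auto)

lemma mem_intersection_points_iff_wedge:
  "z \<in> intersection_points L \<longleftrightarrow> (\<exists>\<alpha>\<in>I. \<exists>\<beta>\<in>I. \<alpha> \<noteq> \<beta> \<and> z = wedge (line \<alpha>) (line \<beta>))"
proof
  assume z: "z \<in> intersection_points L"
  obtain x y where xy: "z = mproj (x, y)" by (rule mproj_cases)
  then obtain \<alpha> \<beta> where \<alpha>\<beta>: "\<alpha> \<in> I" "\<beta> \<in> I" "\<alpha> \<noteq> \<beta>" "f \<alpha> x = y" "f \<beta> x = y"
    using z mem_intersection_points_iff by (auto elim: verticesE)
  have "[meeting \<alpha> \<beta> = x] (rmod pi)"
    by (rule line_meetings_rcong[OF \<alpha>\<beta>(1-3) meeting_eq[OF \<alpha>\<beta>(1-3)]]) (simp add: \<alpha>\<beta>(4,5))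
  then have "z = wedge (line \<alpha>) (line \<beta>)"
    unfolding xy wedge_eq_meeting[OF \<alpha>\<beta>(1-3)] mproj_eq_graph_iff[OF antiperiodic[OF \<alpha>\<beta>(1)]]
    using \<alpha>\<beta>(4) by simp
  then show "\<exists>\<alpha>\<in>I. \<exists>\<beta>\<in>I. \<alpha> \<noteq> \<beta> \<and> z = wedge (line \<alpha>) (line \<beta>)" using \<alpha>\<beta>(1-3) by blast
next
  assume "\<exists>\<alpha>\<in>I. \<exists>\<beta>\<in>I. \<alpha> \<noteq> \<beta> \<and> z = wedge (line \<alpha>) (line \<beta>)"
  then obtain \<alpha> \<beta> where \<alpha>\<beta>: "\<alpha> \<in> I" "\<beta> \<in> I" "\<alpha> \<noteq> \<beta>" and z: "z = wedge (line \<alpha>) (line \<beta>)" by blast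
  then show "z \<in> intersection_points L"
    unfolding z wedge_eq_meeting[OF \<alpha>\<beta>] mem_intersection_points_iff
    using meeting_in_W window_subset by blast
qed

lemma cut_abscissa_meeting:
  assumes \<alpha>\<beta>: "\<alpha> \<in> I" "\<beta> \<in> I" "\<alpha> \<noteq> \<beta>"
  shows "cut_abscissa \<alpha> < meeting \<alpha> \<beta>" "meeting \<alpha> \<beta> < cut_abscissa \<alpha> + pi"
  using mem_window_iff[OF \<alpha>\<beta>(1)] meeting_in_W[OF \<alpha>\<beta>] window_subset by blast+

lemma meetings_dist:
  assumes "\<alpha> \<in> I" "\<beta> \<in> I" "\<gamma> \<in> I" "\<alpha> \<noteq> \<beta>" "\<alpha> \<noteq> \<gamma>" shows "\<bar>meeting \<alpha> \<beta> - meeting \<alpha> \<gamma>\<bar> < pi"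
  using cut_abscissa_meeting[OF assms(1,2,4)] cut_abscissa_meeting[OF assms(1,3,5)]
  by (auto simp: abs_if)

text \<open>Beyond its intersection with a line the cut stays on one side of it, namely on the side where it ends.\<close>

lemma cut_descends_below:
  assumes downwards: "filterlim (snd \<circ> c) at_bot at_top" and \<alpha>: "\<alpha> \<in> I" and t: "cut_parameter \<alpha> < t"
  shows "snd (c t) < f \<alpha> (fst (c t))"
proof -
  obtain M where M: "M > 0" "\<And>\<alpha> x. \<alpha> \<in> I \<Longrightarrow> \<bar>f \<alpha> x\<bar> < M" using curves_bounded by blast
  have "\<forall>\<^sub>F u in at_top. snd (c u) \<le> - M" using downwards by (simp add: filterlim_at_bot)
  then have "\<forall>\<^sub>F u in at_top. snd (c u) \<le> - M \<and> t \<le> u"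
    using eventually_ge_at_top[of t] by eventually_elim simp
  then obtain u where u: "snd (c u) \<le> - M" "t \<le> u"
    using eventually_happens'[OF trivial_limit_at_top_linorder] by blast
  have cont: "continuous_on UNIV c" using cut_curve by (simp add: cut_curve_def)
  have "(\<forall>s\<in>{t..u}. snd (c s) < f \<alpha> (fst (c s))) \<or> (\<forall>s\<in>{t..u}. f \<alpha> (fst (c s)) < snd (c s))"
  proof (rule connected_neq_imp_less_or_greater)
    show "continuous_on UNIV (\<lambda>s. snd (c s))" by (rule continuous_on_snd[OF cont])
    show "continuous_on UNIV (\<lambda>s. f \<alpha> (fst (c s)))"
      by (rule continuous_on_compose2[OF continuous[OF \<alpha>, of UNIV] continuous_on_fst[OF cont]]) simp
    show "snd (c s) \<noteq> f \<alpha> (fst (c s))" if "s \<in> {t..u}" for s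
      using cut_parameter_unique[OF \<alpha>, of s] mem_lifted_curve_iff[OF \<alpha>, of "c s"] that t by auto
  qed (rule connected_Icc)
  moreover have "snd (c u) < f \<alpha> (fst (c u))" using M(2)[OF \<alpha>, of "fst (c u)"] u(1) by linarith
  ultimately show ?thesis using u(2) by force
qed

end

locale descending_cut = cut "{1..n}" f k F c
  for n :: nat and f :: "nat \<Rightarrow> real \<Rightarrow> real" and k :: nat and F :: "(real \<times> real) set"
    and c :: "real \<Rightarrow> real \<times> real" +
  fixes l :: "nat \<Rightarrow> moebius set"
  assumes label: "\<alpha> \<in> {1..n} \<Longrightarrow> l \<alpha> = proj_graph (f \<alpha>)"
    and downwards: "filterlim (snd \<circ> c) at_bot at_top"
    and cut_parameter_less: "\<alpha> \<in> {1..n} \<Longrightarrow> \<beta> \<in> {1..n} \<Longrightarrow> \<alpha> < \<beta> \<Longrightarrow> cut_parameter \<alpha> < cut_parameter \<beta>"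
begin

lemma less_before_meeting:
  assumes \<alpha>\<beta>: "\<alpha> \<in> {1..n}" "\<beta> \<in> {1..n}" "\<alpha> < \<beta>" and x: "meeting \<alpha> \<beta> - pi < x" "x < meeting \<alpha> \<beta>"
  shows "f \<beta> x < f \<alpha> x"
proof -
  have neq: "\<alpha> \<noteq> \<beta>" using \<alpha>\<beta>(3) by simp
  let ?S = "{meeting \<alpha> \<beta> - pi<..<meeting \<alpha> \<beta>}"
  have "(\<forall>t\<in>?S. f \<alpha> t < f \<beta> t) \<or> (\<forall>t\<in>?S. f \<beta> t < f \<alpha> t)"
  proof (rule connected_neq_imp_less_or_greater)
    fix t assume t: "t \<in> ?S"
    show "f \<alpha> t \<noteq> f \<beta> t"
    proof
      assume "f \<alpha> t = f \<beta> t"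
      then have "[t = meeting \<alpha> \<beta>] (rmod pi)"
        using line_meetings_rcong[OF \<alpha>\<beta>(1,2) neq] meeting_eq[OF \<alpha>\<beta>(1,2) neq] by simp
      then show False using rcong_less_imp_add_le[of t "meeting \<alpha> \<beta>" pi] t by simp
    qed
  qed (use continuous \<alpha>\<beta> in auto)
  moreover have "f \<beta> (cut_abscissa \<beta>) < f \<alpha> (cut_abscissa \<beta>)"
    using cut_descends_below[OF downwards \<alpha>\<beta>(1) cut_parameter_less[OF \<alpha>\<beta>]] cut_point[OF \<alpha>\<beta>(2)] by simp
  moreover have "cut_abscissa \<beta> \<in> ?S"
    using cut_abscissa_meeting[OF \<alpha>\<beta>(2,1) neq[symmetric]] meeting_commute[OF \<alpha>\<beta>(1,2) neq] by simp
  ultimately show ?thesis using x by force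
qed

lemma greedy_window_meeting:
  assumes "2 * k < n" shows "greedy_window n f k window meeting cut_abscissa"
proof
  fix \<alpha> \<beta> :: nat assume \<alpha>\<beta>: "\<alpha> \<in> {1..n}" "\<beta> \<in> {1..n}" "\<alpha> < \<beta>"
  then have neq: "\<alpha> \<noteq> \<beta>" by simp
  show "meeting \<alpha> \<beta> - pi < cut_abscissa \<alpha> \<and> cut_abscissa \<alpha> < meeting \<alpha> \<beta> \<and>
      meeting \<alpha> \<beta> - pi < cut_abscissa \<beta> \<and> cut_abscissa \<beta> < meeting \<alpha> \<beta>"
    using cut_abscissa_meeting[OF \<alpha>\<beta>(1,2) neq] cut_abscissa_meeting[OF \<alpha>\<beta>(2,1) neq[symmetric]]
      meeting_commute[OF \<alpha>\<beta>(1,2) neq] by simp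
  show "f \<alpha> (meeting \<alpha> \<beta>) = f \<beta> (meeting \<alpha> \<beta>)" by (rule meeting_eq[OF \<alpha>\<beta>(1,2) neq])
  show "(meeting \<alpha> \<beta>, f \<alpha> (meeting \<alpha> \<beta>)) \<in> window" by (rule meeting_in_W[OF \<alpha>\<beta>(1,2) neq])
qed (use assms less_before_meeting in auto)

lemma
  assumes "2 * k < n" and \<alpha>\<beta>: "\<alpha> \<in> {1..n}" "\<beta> \<in> {1..n}" "\<alpha> < \<beta>" and x: "x = meeting \<alpha> \<beta>"
  shows above_meeting_iff: "\<gamma> \<in> {1..n} \<Longrightarrow> \<alpha> < \<gamma> \<Longrightarrow>
      f \<alpha> x < f \<gamma> x \<longleftrightarrow> cut_less L F (wedge (l \<alpha>) (l \<gamma>)) (wedge (l \<alpha>) (l \<beta>))"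
    and below_meeting_iff: "\<delta> \<in> {1..n} \<Longrightarrow> \<delta> < \<beta> \<Longrightarrow>
      f \<delta> x < f \<alpha> x \<longleftrightarrow> cut_less L F (wedge (l \<beta>) (l \<delta>)) (wedge (l \<alpha>) (l \<beta>))"
proof -
  interpret greedy_window n f k window meeting cut_abscissa by (rule greedy_window_meeting[OF assms(1)])
  have neq: "\<alpha> \<noteq> \<beta>" using \<alpha>\<beta>(3) by simp
  show "f \<alpha> x < f \<gamma> x \<longleftrightarrow> cut_less L F (wedge (l \<alpha>) (l \<gamma>)) (wedge (l \<alpha>) (l \<beta>))"
    if \<gamma>: "\<gamma> \<in> {1..n}" "\<alpha> < \<gamma>"
    using less_iff_after_vertex[OF \<alpha>\<beta>(1) \<gamma>, of x] meetings_dist[of \<alpha> \<beta> \<gamma>] cut_less_wedge_iff[of \<alpha> \<beta> \<gamma>]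
      \<alpha>\<beta>(1,2) neq \<gamma> x label by simp
  show "f \<delta> x < f \<alpha> x \<longleftrightarrow> cut_less L F (wedge (l \<beta>) (l \<delta>)) (wedge (l \<alpha>) (l \<beta>))"
    if \<delta>: "\<delta> \<in> {1..n}" "\<delta> < \<beta>"
  proof -
    have "meeting \<beta> \<alpha> = x" "meeting \<beta> \<delta> = meeting \<delta> \<beta>" "f \<alpha> x = f \<beta> x"
      using meeting_commute[of \<beta>] meeting_eq[OF \<alpha>\<beta>(1,2) neq] \<alpha>\<beta> \<delta> x by auto
    moreover from this have "f \<delta> x < f \<beta> x \<longleftrightarrow> meeting \<delta> \<beta> < x"
      using less_iff_after_vertex[OF \<delta>(1) \<alpha>\<beta>(2) \<delta>(2), of x] meetings_dist[of \<beta> \<alpha> \<delta>] \<alpha>\<beta> \<delta> by simp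
    moreover have "wedge (l \<alpha>) (l \<beta>) = wedge (l \<beta>) (l \<alpha>)" by (rule wedge_commute)
    ultimately show ?thesis using cut_less_wedge_iff[of \<beta> \<alpha> \<delta>] \<alpha>\<beta> \<delta> label by simp
  qed
qed

lemma saturated_iff_blocked:
  assumes "2 * k < n" and \<alpha>\<beta>: "\<alpha> \<in> {1..n}" "\<beta> \<in> {1..n}" "\<alpha> < \<beta>"
  shows "descending_curves.saturated n f k meeting \<alpha> \<beta> \<longleftrightarrow> blocked L F k n l \<alpha> \<beta>"
proof -
  interpret greedy_window n f k window meeting cut_abscissa by (rule greedy_window_meeting[OF assms(1)])
  let ?x = "meeting \<alpha> \<beta>"
  have "ones_above t ?x (f \<alpha> ?x) = card {\<gamma> \<in> {t<..n}. cut_less L F (wedge (l \<alpha>) (l \<gamma>))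
      (wedge (l \<alpha>) (l \<beta>))}"
    if "\<alpha> \<le> t" for t
    unfolding num_above_def using above_meeting_iff[OF assms refl] \<alpha>\<beta>(1) that
    by (intro arg_cong[where f = card] Collect_cong) auto
  moreover have "zeros_below t ?x (f \<alpha> ?x) =
      card {\<delta> \<in> {1..t}. cut_less L F (wedge (l \<beta>) (l \<delta>)) (wedge (l \<alpha>) (l \<beta>))}"
    if "t < \<beta>" for t
    unfolding num_below_def using below_meeting_iff[OF assms refl] \<alpha>\<beta>(2) that
    by (intro arg_cong[where f = card] Collect_cong) auto
  ultimately show ?thesis unfolding saturated_def saturated_at_def blocked_def blocked_at_def by auto
qed

lemma ex_greedy_family:
  obtains G :: "nat set" and g where "covers_kernel G g" "contacts_precede_crossings G g"
    "\<forall>\<alpha>\<in>{1..n}. \<forall>\<beta>\<in>{1..n}. \<alpha> < \<beta> \<longrightarrow>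
       ((meeting \<alpha> \<beta>, f \<alpha> (meeting \<alpha> \<beta>)) \<in> crossings G g \<longleftrightarrow> blocked L F k n l \<alpha> \<beta>)"
proof (cases "2 * k < n")
  case True
  interpret greedy_window n f k window meeting cut_abscissa by (rule greedy_window_meeting[OF True])
  show thesis
    using that[OF covers_kernel_greedy_curve greedy_contacts_precede_crossings]
      greedy_crossing_iff_saturated saturated_iff_blocked[OF True] by blast
next
  case False
  let ?g = "\<lambda>_ _. 0 :: real"
  show thesis
  proof (rule that)
    show "covers_kernel {} ?g"
      unfolding covers_kernel_def middle_levels_def using False by (auto intro: curve_family.intro)
    show "contacts_precede_crossings {} ?g" by (simp add: contacts_precede_crossings_def)
    show "\<forall>\<alpha>\<in>{1..n}. \<forall>\<beta>\<in>{1..n}. \<alpha> < \<beta> \<longrightarrow>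
       ((meeting \<alpha> \<beta>, f \<alpha> (meeting \<alpha> \<beta>)) \<in> crossings {} ?g \<longleftrightarrow> blocked L F k n l \<alpha> \<beta>)"
      using blocked_imp_kernel_nonempty[of L F k n l] False by (auto simp: crossings_def)
  qed
qed

theorem greedy_vertices_descending_cut:
  assumes "1 \<le> k" shows "pt_vertices L (greedy_pseudotriangulation L F k) = greedy_crossings L F k n l"
proof -
  obtain G :: "nat set" and g where G: "covers_kernel G g" "contacts_precede_crossings G g"
    and crossings: "\<forall>\<alpha>\<in>{1..n}. \<forall>\<beta>\<in>{1..n}. \<alpha> < \<beta> \<longrightarrow>
      ((meeting \<alpha> \<beta>, f \<alpha> (meeting \<alpha> \<beta>)) \<in> crossings G g \<longleftrightarrow> blocked L F k n l \<alpha> \<beta>)"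
    using ex_greedy_family .
  interpret G: curve_family G g by (rule covers_kernel_family[OF G(1)])
  have crossing_iff: "wedge (l \<alpha>) (l \<beta>) \<in> crossing_points (arrangement_of G g) \<longleftrightarrow> blocked L F k n l \<alpha> \<beta>"
    if "\<alpha> \<in> {1..n}" "\<beta> \<in> {1..n}" "\<alpha> < \<beta>" for \<alpha> \<beta>
    using that wedge_eq_meeting[of \<alpha> \<beta>] crossings label by (simp add: G.mem_crossing_points_iff)
  have intersection_iff: "z \<in> intersection_points L \<longleftrightarrow>
      (\<exists>\<alpha>\<in>{1..n}. \<exists>\<beta>\<in>{1..n}. \<alpha> < \<beta> \<and> z = wedge (l \<alpha>) (l \<beta>))" for z
  proof
    assume "z \<in> intersection_points L"
    then obtain \<alpha> \<beta> where \<alpha>\<beta>: "\<alpha> \<in> {1..n}" "\<beta> \<in> {1..n}" "\<alpha> \<noteq> \<beta>" "z = wedge (l \<alpha>) (l \<beta>)"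
      unfolding mem_intersection_points_iff_wedge using label by metis
    then have "z = wedge (l \<beta>) (l \<alpha>)" using wedge_commute by simp
    moreover have "\<alpha> < \<beta> \<or> \<beta> < \<alpha>" using \<alpha>\<beta>(3) by linarith
    ultimately show "\<exists>\<alpha>\<in>{1..n}. \<exists>\<beta>\<in>{1..n}. \<alpha> < \<beta> \<and> z = wedge (l \<alpha>) (l \<beta>)" using \<alpha>\<beta> by blast
  next
    assume "\<exists>\<alpha>\<in>{1..n}. \<exists>\<beta>\<in>{1..n}. \<alpha> < \<beta> \<and> z = wedge (l \<alpha>) (l \<beta>)"
    then show "z \<in> intersection_points L" unfolding mem_intersection_points_iff_wedge
      using label by (metis less_irrefl)
  qed
  have "pt_vertices L (greedy_pseudotriangulation L F k) =
      intersection_points L - crossing_points (arrangement_of G g)"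
    by (simp only: pt_vertices_def greedy_pseudotriangulation_eq[OF G])
  also have "\<dots> = {wedge (l \<alpha>) (l \<beta>) | \<alpha> \<beta>. 1 \<le> \<alpha> \<and> \<alpha> < \<beta> \<and> \<beta> \<le> n \<and> \<not> blocked L F k n l \<alpha> \<beta>}"
    using intersection_iff crossing_iff by fastforce
  also have "\<dots> = greedy_crossings L F k n l" by (rule greedy_crossings_eq[OF assms, symmetric])
  finally show ?thesis .
qed

end

lemma greedy_vertices_downward_cut:
  assumes L: "simple_arrangement L" "contact_points L = {}" and cut: "cut_filter L F" "cut_curve L F c"
    and order: "crossing_order L c n l" and "1 \<le> k" and downwards: "filterlim (snd \<circ> c) at_bot at_top"
  shows "pt_vertices L (greedy_pseudotriangulation L F k) = greedy_crossings L F k n l"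
proof -
  define f where "f i = rep_fun (l i)" for i
  obtain t where l: "bij_betw l {1..n} L"
      and t: "strict_mono_on {1..n} t" "\<forall>i\<in>{1..n}. c (t i) \<in> mproj -` l i"
    using order unfolding crossing_order_def by blast
  have label: "l i = proj_graph (f i)" if "i \<in> {1..n}" for i
    using L(1) bij_betwE[OF l] that
    by (simp add: f_def simple_arrangement_def arrangement_def proj_graph_rep_fun)
  then have arrangement: "arrangement_of {1..n} f = L"
    using bij_betw_imp_surj_on[OF l] by (simp add: arrangement_of_def)
  interpret curve_family "{1..n}" f
    unfolding f_def using l
    by (intro curve_family_reindex[OF curve_family_rep_fun[OF L(1)]]) (auto simp: bij_betw_def)
  interpret contact_free_family "{1..n}" f k
    by (rule contact_free_familyI) (simp only: arrangement L(2))
  interpret cut "{1..n}" f k F c using cut arrangement by unfold_locales simp_all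
  interpret descending_cut n f k F c l
  proof
    fix i j assume ij: "i \<in> {1..n}" "j \<in> {1..n}" "i < j"
    then have "t i = cut_parameter i" "t j = cut_parameter j"
      using cut_parameter_unique t(2) label by auto
    then show "cut_parameter i < cut_parameter j" using strict_mono_onD[OF t(1) ij] by simp
  qed (use label downwards in auto)
  show ?thesis using greedy_vertices_descending_cut[OF \<open>1 \<le> k\<close>] unfolding arrangement .
qed

theorem theorem41:
  fixes L :: "moebius set set" and F :: "(real \<times> real) set" and c :: "real \<Rightarrow> real \<times> real"
    and n k :: nat and l :: "nat \<Rightarrow> moebius set"
  assumes "simple_arrangement L" and "contact_points L = {}"
    and "cut_filter L F" and "cut_curve L F c" and "crossing_order L c n l"
    and "k \<ge> 1"
  shows "pt_vertices L (greedy_pseudotriangulation L F k) = greedy_crossings L F k n l"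
proof -
  have "filterlim (snd \<circ> c) at_bot at_top \<or> filterlim (snd \<circ> c) at_bot at_bot"
    using assms(4) by (auto simp: cut_curve_def)
  then show ?thesis
  proof
    assume "filterlim (snd \<circ> c) at_bot at_top"
    then show ?thesis by (rule greedy_vertices_downward_cut[OF assms])
  next
    assume "filterlim (snd \<circ> c) at_bot at_bot"
    then have downwards: "filterlim (snd \<circ> (\<lambda>t. c (- t))) at_bot at_top"
      using filterlim_compose[OF _ filterlim_uminus_at_bot_at_top] by (simp add: comp_def)
    have "pt_vertices L (greedy_pseudotriangulation L F k) =
        greedy_crossings L F k n (\<lambda>i. l (n + 1 - i))"
      by (rule greedy_vertices_downward_cut[OF assms(1-3) cut_curve_reverse[OF assms(4)]
            crossing_order_reverse[OF assms(5)] assms(6) downwards])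
    then show ?thesis using greedy_crossings_reverse[OF assms(6)] by simp
  qed
qed

end
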